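(* Let $s>0$ and let $K\geq 1$ be an integer. Then the supremum $$\sup\left\{\sum_{k=1}^{K}\lambda_k(\Omega)\;:\;\Omega\subset\mathbb{C}\text{ measurable},\ |\Omega|=s\right\}$$ is attained, i.e. there exists a measurable set $\Omega\subset\mathbb{C}$ with $|\Omega|=s$ for which $\sum_{k=1}^{K}\lambda_k(\Omega)$ equals this supremum.
   Context: The Fock space $\mathcal{F}$ is the Hilbert space of entire functions $f:\mathbb{C}\to\mathbb{C}$ with $\|f\|^2=\int_{\mathbb{C}}|f(z)|^2e^{-\pi|z|^2}\,dA(z)<\infty$, where $dA$ is Lebesgue measure on $\mathbb{C}$, with the inner product $\langle f,g\rangle=\int_{\mathbb{C}}f(z)\overline{g(z)}e^{-\pi|z|^2}\,dA(z)$ inherited from $L^2=L^2(\mathbb{C},e^{-\pi|z|^2}dA(z))$. $|\Omega|$ denotes the Lebesgue measure of $\Omega\subset\mathbb{C}$. Let $P:L^2\to\mathcal{F}$ be the orthogonal projection. For measurable $\Omega\subset\mathbb{C}$, the Toeplitz operator $T_\Omega:\mathcal{F}\to\mathcal{F}$ is $T_\Omega f=P(\chi_\Omega f)$, so that $\langle T_\Omega f,f\rangle=\int_\Omega|f(z)|^2e^{-\pi|z|^2}\,dA(z)$. When $|\Omega|<\infty$ this operator is compact and nonnegative, and $\lambda_1(\Omega)\geq\lambda_2(\Omega)\geq\cdots$ denote its eigenvalues in nonincreasing order, counted with multiplicity. *)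

theory Defs
  imports "HOL-Complex_Analysis.Complex_Analysis" "HOL-Library.Function_Algebras"
begin

definition gauss_weight :: "complex \<Rightarrow> real" where
  "gauss_weight z = exp (- pi * (norm z)\<^sup>2)"

text \<open>Square-integrable functions are kept as genuine functions, not as classes modulo null sets.
  On the Fock space itself nothing is lost, since entire functions that agree almost everywhere
  are equal.\<close>

definition gauss_L2 :: "(complex \<Rightarrow> complex) set" where
  "gauss_L2 = {f. f \<in> borel_measurable lebesgue \<and>
     integrable lebesgue (\<lambda>z. (norm (f z))\<^sup>2 * gauss_weight z)}"

definition fock_space :: "(complex \<Rightarrow> complex) set" where
  "fock_space = {f. f holomorphic_on UNIV \<and> f \<in> gauss_L2}"

definition fock_inner :: "(complex \<Rightarrow> complex) \<Rightarrow> (complex \<Rightarrow> complex) \<Rightarrow> complex" where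
  "fock_inner f g = (LINT z|lebesgue. f z * cnj (g z) * complex_of_real (gauss_weight z))"

text \<open>The orthogonal projection of \<open>L\<^sup>2\<close> onto the Fock space: \<open>fock_proj g\<close> is the unique
  element \<open>h\<close> of the Fock space with \<open>g - h\<close> orthogonal to the Fock space. The value
  is meaningful for \<open>g\<close> in \<^const>\<open>gauss_L2\<close> only.\<close>

definition fock_proj :: "(complex \<Rightarrow> complex) \<Rightarrow> complex \<Rightarrow> complex" where
  "fock_proj g =
     (THE h. h \<in> fock_space \<and> (\<forall>f\<in>fock_space. fock_inner (\<lambda>z. g z - h z) f = 0))"

definition toeplitz :: "complex set \<Rightarrow> (complex \<Rightarrow> complex) \<Rightarrow> complex \<Rightarrow> complex" where
  "toeplitz \<Omega> f = fock_proj (\<lambda>z. indicator \<Omega> z * f z)"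

definition cfun_scale :: "complex \<Rightarrow> (complex \<Rightarrow> complex) \<Rightarrow> complex \<Rightarrow> complex" where
  "cfun_scale c f = (\<lambda>z. c * f z)"

interpretation cfun: vector_space cfun_scale
  by unfold_locales (auto simp: cfun_scale_def fun_eq_iff algebra_simps)

definition fock_eigenspace ::
    "((complex \<Rightarrow> complex) \<Rightarrow> complex \<Rightarrow> complex) \<Rightarrow> complex \<Rightarrow> (complex \<Rightarrow> complex) set" where
  "fock_eigenspace T \<mu> = {f \<in> fock_space. T f = cfun_scale \<mu> f}"

text \<open>\<open>l 0 \<ge> l 1 \<ge> \<dots>\<close> lists the eigenvalues of a compact nonnegative operator \<open>T\<close> on the
  (infinite-dimensional) Fock space, each repeated according to its multiplicity. The multiplicity
  condition is restricted to nonzero eigenvalues: only these are sure to have finite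
  multiplicity, and \<open>0\<close> occurs in the list only if \<open>T\<close> has finite rank (in particular not for
  a Toeplitz operator of a set of positive measure, which is injective). For such \<open>T\<close> both sides of the
  equation are finite, so neither \<open>card\<close> nor \<open>dim\<close> takes its default value \<open>0\<close> for infinite
  arguments. The list is then unique.\<close>

definition eigenvalue_list ::
    "((complex \<Rightarrow> complex) \<Rightarrow> complex \<Rightarrow> complex) \<Rightarrow> (nat \<Rightarrow> real) \<Rightarrow> bool" where
  "eigenvalue_list T l \<longleftrightarrow>
     antimono l \<and>
     (\<forall>k. \<exists>f \<in> fock_eigenspace T (complex_of_real (l k)). f \<noteq> 0) \<and>
     (\<forall>\<mu>. \<mu> \<noteq> 0 \<longrightarrow>
        card {k. complex_of_real (l k) = \<mu>} = cfun.dim (fock_eigenspace T \<mu>))"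

text \<open>The index \<open>k\<close> starts at \<open>1\<close>.\<close>

definition toeplitz_eigenvalue :: "nat \<Rightarrow> complex set \<Rightarrow> real" where
  "toeplitz_eigenvalue k \<Omega> = (THE l. eigenvalue_list (toeplitz \<Omega>) l) (k - 1)"

end

theory Submission
  imports Defs
begin

text \<open>By Ky Fan's principle the sum of the first \<open>K\<close> eigenvalues of \<open>T\<^sub>\<Omega>\<close> is the maximum of
  \<open>\<Sum>k<K. \<integral>\<^sub>\<Omega> \<bar>f k\<bar>\<^sup>2 e\<^bsup>-\<pi>\<bar>z\<bar>\<^sup>2\<^esup>\<close> over orthonormal \<open>f k\<close> in the Fock space, and also, dually, the maximum of
  \<open>\<Sum>k<K. \<parallel>P (v k)\<parallel>\<^sup>2\<close> over orthonormal \<open>v k\<close> in \<open>L\<^sup>2(\<Omega>)\<close>. By the first form, \<open>\<Omega>\<close> may be replaced by a set of the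
  same measure inside a superlevel set \<open>{u \<ge> t}\<close> of the density \<open>u\<close> of the optimal \<open>f k\<close>. Montel's theorem makes \<open>t\<close>
  uniform, and since \<open>\<integral> u = K\<close> the superlevel set is covered by a bounded number of unit-size discs. By the dual form,
  the part of \<open>\<Omega>\<close> in a disc far away from the others can be moved close to them at an arbitrarily small cost: optimal
  \<open>v k\<close> split into parts supported on the two pieces, whose interaction vanishes with growing distance. Hence it suffices to
  maximise over subsets of one fixed disc, where near optimal \<open>f k\<close> converge along a subsequence
  and the bathtub principle for the limit density yields a maximiser.\<close>

subsection \<open>The Gaussian \<open>L\<^sup>2\<close> space\<close>

text \<open>The obstacle is loss of compactness: a maximising sequence of sets can spread out
  thinly, or split into pieces that drift apart. Drifting pieces have to be handled in the dual
  form, because an entire function cannot be cut at the boundary of a piece, whereas a function in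
  L2 of the set can, and multiplying one part by -1 cancels its interaction with the other. Each
  move costs something, however, and a limit of ever smaller losses would not by itself yield
  attainment. The induction on the number of discs therefore argues by contradiction: if no set is
  best, there is a strict gap over what fewer, larger discs achieve, and the tolerance of a single
  move is set equal to this gap before the distance is chosen. No explicit kernel or eigenvalue
  occurs. The analysis rests on one bound for point evaluations, on Weyl translations, and on
  Montel's theorem, so that pointwise convergence stands in for weak convergence.\<close>

abbreviation cscale (infixr "\<odot>" 75) where "c \<odot> f \<equiv> cfun_scale c f"

lemma cscale_apply [simp]: "(c \<odot> f) z = c * f z"
  by (simp add: cfun_scale_def)

lemma sum_fun_apply: "(\<Sum>i\<in>A. f i) z = (\<Sum>i\<in>A. f i (z::complex) :: complex)"
  by (induction A rule: infinite_finite_induct) auto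

lemma gauss_weight_pos [simp]: "gauss_weight z > 0"
  and gauss_weight_nonneg [simp]: "gauss_weight z \<ge> 0"
  and gauss_weight_nonzero [simp]: "gauss_weight z \<noteq> 0"
  by (auto simp: gauss_weight_def)

lemma continuous_gauss_weight: "continuous_on A gauss_weight"
  unfolding gauss_weight_def by (intro continuous_intros)

lemma borel_measurable_lebesgue_continuous:
  fixes f :: "complex \<Rightarrow> 'b::topological_space"
  shows "continuous_on UNIV f \<Longrightarrow> f \<in> borel_measurable lebesgue"
  by (intro measurable_completion) (simp add: borel_measurable_continuous_onI)

lemma gauss_weight_measurable [measurable]: "gauss_weight \<in> borel_measurable lebesgue"
  by (intro borel_measurable_lebesgue_continuous continuous_gauss_weight)

abbreviation wsq :: "(complex \<Rightarrow> complex) \<Rightarrow> complex \<Rightarrow> real" where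
  "wsq f z \<equiv> (norm (f z))\<^sup>2 * gauss_weight z"

definition gnorm2 :: "(complex \<Rightarrow> complex) \<Rightarrow> real" where
  "gnorm2 f = (LINT z|lebesgue. wsq f z)"

lemma gauss_L2_integrable: "f \<in> gauss_L2 \<Longrightarrow> integrable lebesgue (\<lambda>z. wsq f z)"
  by (auto simp: gauss_L2_def)

lemma norm_add_square_le: "(norm (x + y))\<^sup>2 \<le> 2 * (norm x)\<^sup>2 + 2 * (norm (y::'a::real_normed_vector))\<^sup>2"
proof -
  have "(norm (x + y))\<^sup>2 \<le> (norm x + norm y)\<^sup>2"
    by (simp add: norm_triangle_ineq power_mono)
  also have "\<dots> \<le> 2 * (norm x)\<^sup>2 + 2 * (norm y)\<^sup>2"
    using sum_squares_bound[of "norm x" "norm y"] by (simp add: power2_sum)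
  finally show ?thesis .
qed

lemma gauss_L2_add [intro]:
  assumes "f \<in> gauss_L2" "g \<in> gauss_L2"
  shows "f + g \<in> gauss_L2"
proof -
  have m [measurable]: "f \<in> borel_measurable lebesgue" "g \<in> borel_measurable lebesgue"
    using assms by (auto simp: gauss_L2_def)
  have "integrable lebesgue (\<lambda>z. (norm (f z + g z))\<^sup>2 * gauss_weight z)"
  proof (rule Bochner_Integration.integrable_bound)
    show "integrable lebesgue (\<lambda>z. 2 * wsq f z + 2 * wsq g z)"
      using assms by (auto simp: gauss_L2_def)
    show "AE z in lebesgue. norm ((norm (f z + g z))\<^sup>2 * gauss_weight z)
       \<le> norm (2 * wsq f z + 2 * wsq g z)"
    proof (intro always_eventually allI)
      fix z
      have "(norm (f z + g z))\<^sup>2 * gauss_weight z \<le> (2 * (norm (f z))\<^sup>2 + 2 * (norm (g z))\<^sup>2) * gauss_weight z"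
        by (intro mult_right_mono norm_add_square_le) auto
      then show "norm ((norm (f z + g z))\<^sup>2 * gauss_weight z)
       \<le> norm (2 * wsq f z + 2 * wsq g z)"
        by (simp add: algebra_simps)
    qed
  qed measurable
  then show ?thesis by (simp add: gauss_L2_def plus_fun_def)
qed

lemma gauss_L2_mult_bounded:
  assumes f: "f \<in> gauss_L2" and [measurable]: "m \<in> borel_measurable lebesgue" and "\<And>z. norm (m z) \<le> B"
  shows "(\<lambda>z. m z * f z) \<in> gauss_L2"
proof -
  have m [measurable]: "f \<in> borel_measurable lebesgue"
    using assms by (auto simp: gauss_L2_def)
  have "integrable lebesgue (\<lambda>z. (norm (m z * f z))\<^sup>2 * gauss_weight z)"
  proof (rule Bochner_Integration.integrable_bound)
    show "integrable lebesgue (\<lambda>z. B\<^sup>2 * wsq f z)"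
      using assms by (auto simp: gauss_L2_def)
    have "(norm (m z * f z))\<^sup>2 * gauss_weight z \<le> B\<^sup>2 * wsq f z" for z
      using assms(3)[of z] by (simp add: norm_mult power_mult_distrib mult.assoc mult_right_mono power_mono)
    then show "AE z in lebesgue. norm ((norm (m z * f z))\<^sup>2 * gauss_weight z) \<le> norm (B\<^sup>2 * wsq f z)"
      by auto
  qed measurable
  then show ?thesis using assms m by (simp add: gauss_L2_def)
qed

lemma gauss_L2_scale [intro]: "f \<in> gauss_L2 \<Longrightarrow> c \<odot> f \<in> gauss_L2"
  unfolding cfun_scale_def by (rule gauss_L2_mult_bounded[where B="norm c"]) auto

lemma subspace_gauss_L2: "cfun.subspace gauss_L2"
  by (auto simp: cfun.subspace_def) (simp add: gauss_L2_def zero_fun_def)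

lemma subspace_fock_space: "cfun.subspace fock_space"
  using subspace_gauss_L2
  by (auto simp: cfun.subspace_def fock_space_def zero_fun_def plus_fun_def cfun_scale_def intro!: holomorphic_intros)

lemma fock_imp_L2 [intro, simp]: "f \<in> fock_space \<Longrightarrow> f \<in> gauss_L2"
  by (simp add: fock_space_def)

lemmas gauss_L2_diff [intro] = cfun.subspace_diff[OF subspace_gauss_L2]
  and gauss_L2_sum [intro] = cfun.subspace_sum[OF subspace_gauss_L2]
  and gauss_L2_zero [simp] = cfun.subspace_0[OF subspace_gauss_L2]
  and fock_add [intro] = cfun.subspace_add[OF subspace_fock_space]
  and fock_scale [intro] = cfun.subspace_scale[OF subspace_fock_space]
  and fock_diff [intro] = cfun.subspace_diff[OF subspace_fock_space]
  and fock_sum [intro] = cfun.subspace_sum[OF subspace_fock_space]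
  and fock_zero [simp] = cfun.subspace_0[OF subspace_fock_space]

lemma integrable_inner:
  assumes "f \<in> gauss_L2" "g \<in> gauss_L2"
  shows "integrable lebesgue (\<lambda>z. f z * cnj (g z) * complex_of_real (gauss_weight z))"
proof (rule Bochner_Integration.integrable_bound)
  have [measurable]: "f \<in> borel_measurable lebesgue" "g \<in> borel_measurable lebesgue"
    using assms by (auto simp: gauss_L2_def)
  have [measurable]: "(\<lambda>z. cnj (g z)) \<in> borel_measurable lebesgue"
    using borel_measurable_continuous_onI[of cnj] by (intro measurable_compose[of g _ borel cnj]) (auto intro: continuous_intros)
  show "(\<lambda>z. f z * cnj (g z) * complex_of_real (gauss_weight z)) \<in> borel_measurable lebesgue"
    by measurable
  show "integrable lebesgue (\<lambda>z. wsq f z + wsq g z)"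
    using assms by (auto simp: gauss_L2_def)
  have "norm (f z) * norm (g z) * gauss_weight z \<le> wsq f z + wsq g z" for z
  proof -
    have "0 \<le> norm (f z) * norm (g z)" by simp
    with sum_squares_bound[of "norm (f z)" "norm (g z)"]
    have "norm (f z) * norm (g z) \<le> (norm (f z))\<^sup>2 + (norm (g z))\<^sup>2" by linarith
    then show ?thesis unfolding distrib_right[symmetric] by (rule mult_right_mono) simp
  qed
  then show "AE z in lebesgue. norm (f z * cnj (g z) * complex_of_real (gauss_weight z))
     \<le> norm (wsq f z + wsq g z)"
    by (auto simp: norm_mult)
qed

lemma fock_inner_add_left:
  assumes "f \<in> gauss_L2" "g \<in> gauss_L2" "h \<in> gauss_L2"
  shows "fock_inner (f + g) h = fock_inner f h + fock_inner g h"
  unfolding fock_inner_def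
  by (subst Bochner_Integration.integral_add[symmetric]) (simp_all add: assms integrable_inner distrib_right)

lemma fock_inner_scale_left: "fock_inner (c \<odot> f) h = c * fock_inner f h"
  unfolding fock_inner_def by (simp add: mult.assoc)

lemma fock_inner_commute: "fock_inner g f = cnj (fock_inner f g)"
proof -
  have "cnj (fock_inner f g) = (LINT z|lebesgue. cnj (f z * cnj (g z) * complex_of_real (gauss_weight z)))"
    unfolding fock_inner_def by (rule Bochner_Integration.integral_cnj[symmetric])
  then show ?thesis by (simp add: fock_inner_def mult_ac)
qed

lemma fock_inner_add_right:
  assumes "f \<in> gauss_L2" "g \<in> gauss_L2" "h \<in> gauss_L2"
  shows "fock_inner h (f + g) = fock_inner h f + fock_inner h g"
  using assms by (simp add: fock_inner_commute[of h] fock_inner_add_left)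

lemma fock_inner_scale_right: "fock_inner h (c \<odot> f) = cnj c * fock_inner h f"
  by (simp add: fock_inner_commute[of h] fock_inner_scale_left)

lemma fock_inner_zero [simp]: "fock_inner 0 f = 0" "fock_inner f 0 = 0"
  by (simp_all add: fock_inner_def)

lemma fock_inner_diff_left:
  assumes "f \<in> gauss_L2" "g \<in> gauss_L2" "h \<in> gauss_L2"
  shows "fock_inner (f - g) h = fock_inner f h - fock_inner g h"
  using fock_inner_add_left[of "f - g" g h] assms by (simp add: gauss_L2_diff)

lemma fock_inner_diff_right:
  assumes "f \<in> gauss_L2" "g \<in> gauss_L2" "h \<in> gauss_L2"
  shows "fock_inner h (f - g) = fock_inner h f - fock_inner h g"
  using assms by (simp add: fock_inner_commute[of h] fock_inner_diff_left)

lemma fock_inner_sum_left: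
  assumes "\<And>i. i \<in> A \<Longrightarrow> f i \<in> gauss_L2" "h \<in> gauss_L2"
  shows "fock_inner (\<Sum>i\<in>A. f i) h = (\<Sum>i\<in>A. fock_inner (f i) h)"
  using assms
  by (induction A rule: infinite_finite_induct) (simp_all add: fock_inner_add_left gauss_L2_sum)

lemma fock_inner_sum_right:
  assumes "\<And>i. i \<in> A \<Longrightarrow> f i \<in> gauss_L2" "h \<in> gauss_L2"
  shows "fock_inner h (\<Sum>i\<in>A. f i) = (\<Sum>i\<in>A. fock_inner h (f i))"
  using assms by (simp add: fock_inner_commute[of h] fock_inner_sum_left)

lemma fock_inner_self: "fock_inner f f = of_real (gnorm2 f)"
  unfolding fock_inner_def gnorm2_def integral_complex_of_real[symmetric]
  by (intro Bochner_Integration.integral_cong refl) (simp only: of_real_mult complex_norm_square)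

lemma gnorm2_nonneg [simp]: "gnorm2 f \<ge> 0"
  unfolding gnorm2_def by (intro Bochner_Integration.integral_nonneg) auto

lemma gnorm2_eq_Re: "gnorm2 f = Re (fock_inner f f)"
  by (simp add: fock_inner_self)

lemma gnorm2_scale [simp]: "gnorm2 (c \<odot> f) = (norm c)\<^sup>2 * gnorm2 f"
  unfolding gnorm2_def by (simp add: norm_mult power_mult_distrib mult.assoc)

lemma gnorm2_add:
  assumes "f \<in> gauss_L2" "g \<in> gauss_L2"
  shows "gnorm2 (f + g) = gnorm2 f + gnorm2 g + 2 * Re (fock_inner f g)"
  using assms unfolding gnorm2_eq_Re
  by (simp add: fock_inner_add_left fock_inner_add_right gauss_L2_add fock_inner_commute[of g f])

lemma gnorm2_diff:
  assumes "f \<in> gauss_L2" "g \<in> gauss_L2"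
  shows "gnorm2 (f - g) = gnorm2 f + gnorm2 g - 2 * Re (fock_inner f g)"
  using assms unfolding gnorm2_eq_Re
  by (simp add: fock_inner_diff_left fock_inner_diff_right gauss_L2_diff fock_inner_commute[of g f])

lemma gnorm2_diff_le:
  assumes "f \<in> gauss_L2" "g \<in> gauss_L2"
  shows "gnorm2 (f - g) \<le> 2 * gnorm2 f + 2 * gnorm2 g"
  using gnorm2_add[OF assms] gnorm2_diff[OF assms] gnorm2_nonneg[of "f + g"] by linarith

lemma gnorm2_sum:
  assumes "\<And>i. i \<in> A \<Longrightarrow> f i \<in> gauss_L2"
  shows "of_real (gnorm2 (\<Sum>i\<in>A. f i)) = (\<Sum>i\<in>A. \<Sum>j\<in>A. fock_inner (f i) (f j))"
  unfolding fock_inner_self[symmetric]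
  by (simp add: fock_inner_sum_left fock_inner_sum_right assms gauss_L2_sum) (rule sum.swap)

text \<open>The scalar minimising the distance does not exist if \<open>gnorm2 g = 0\<close>; the expansion is then linear in \<open>r\<close>,
  and a large \<open>r\<close> forces \<open>x = 0\<close>.\<close>

lemma fock_inner_Cauchy_Schwarz:
  assumes "f \<in> gauss_L2" "g \<in> gauss_L2"
  shows "(norm (fock_inner f g))\<^sup>2 \<le> gnorm2 f * gnorm2 g"
proof -
  define x where "x = fock_inner f g"
  have main: "0 \<le> gnorm2 f + r\<^sup>2 * (norm x)\<^sup>2 * gnorm2 g - 2 * r * (norm x)\<^sup>2" for r :: real
  proof -
    have "0 \<le> gnorm2 (f - (of_real r * x) \<odot> g)" by simp
    also have "\<dots> = gnorm2 f + r\<^sup>2 * (norm x)\<^sup>2 * gnorm2 g - 2 * Re (cnj (of_real r * x) * x)"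
      using assms by (simp add: gnorm2_diff gauss_L2_scale fock_inner_scale_right x_def norm_mult power_mult_distrib)
    also have "cnj (of_real r * x) * x = of_real (r * (norm x)\<^sup>2)"
      using complex_norm_square[of x] by (simp add: mult_ac)
    finally show ?thesis by (simp add: mult.assoc)
  qed
  show ?thesis
  proof (cases "gnorm2 g = 0")
    case True
    show ?thesis
    proof (cases "x = 0")
      case False
      then have "gnorm2 f + 1 = 2 * ((gnorm2 f + 1) / (2 * (norm x)\<^sup>2)) * (norm x)\<^sup>2" by simp
      with main[of "(gnorm2 f + 1) / (2 * (norm x)\<^sup>2)"] True have False by simp
      then show ?thesis ..
    qed (simp add: x_def[symmetric])
  next
    case False
    then have pos: "gnorm2 g > 0" using gnorm2_nonneg[of g] by linarith
    have "0 \<le> gnorm2 f + (1 / gnorm2 g)\<^sup>2 * (norm x)\<^sup>2 * gnorm2 g - 2 * (1 / gnorm2 g) * (norm x)\<^sup>2"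
      by (rule main)
    also have "\<dots> = gnorm2 f - (norm x)\<^sup>2 / gnorm2 g"
      using pos by (simp add: field_simps power2_eq_square)
    finally show ?thesis using pos by (simp add: field_simps x_def)
  qed
qed

lemma gnorm2_eq_nn_integral:
  assumes "f \<in> gauss_L2"
  shows "(\<integral>\<^sup>+z. ennreal (wsq f z) \<partial>lebesgue) = ennreal (gnorm2 f)"
  unfolding gnorm2_def using assms by (intro nn_integral_eq_integral) (auto simp: gauss_L2_def)

text \<open>Makes norm bounds survive pointwise limits. The bound is asked for only eventually
  because a minimising sequence, as in \<open>fock_proj_exists\<close>, comes within a given
  tolerance only from some index on.\<close>

lemma gnorm2_Fatou:
  assumes f: "\<And>n. f n \<in> gauss_L2" and lim: "\<And>z. (\<lambda>n. f n z) \<longlonglongrightarrow> g z"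
    and b: "\<forall>\<^sub>F n in sequentially. gnorm2 (f n) \<le> C"
  shows "g \<in> gauss_L2" "gnorm2 g \<le> C"
proof -
  have [measurable]: "f n \<in> borel_measurable lebesgue" for n using f by (simp add: gauss_L2_def)
  have g [measurable]: "g \<in> borel_measurable lebesgue"
    by (rule borel_measurable_LIMSEQ_metric[of f]) (use lim in auto)
  from b obtain n where "gnorm2 (f n) \<le> C" by (auto simp: eventually_sequentially)
  then have C: "C \<ge> 0" using gnorm2_nonneg[of "f n"] by linarith
  have "(\<integral>\<^sup>+z. ennreal (wsq g z) \<partial>lebesgue)
     = (\<integral>\<^sup>+z. liminf (\<lambda>n. ennreal (wsq (f n) z)) \<partial>lebesgue)"
  proof (intro nn_integral_cong)
    fix z
    have "(\<lambda>n. ennreal (wsq (f n) z)) \<longlonglongrightarrow> ennreal (wsq g z)"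
      by (intro tendsto_intros lim)
    then show "ennreal (wsq g z) = liminf (\<lambda>n. ennreal (wsq (f n) z))"
      by (rule lim_imp_Liminf[symmetric, OF trivial_limit_sequentially])
  qed
  also have "\<dots> \<le> liminf (\<lambda>n. \<integral>\<^sup>+z. ennreal (wsq (f n) z) \<partial>lebesgue)"
    by (intro nn_integral_liminf) measurable
  also have "\<dots> = liminf (\<lambda>n. ennreal (gnorm2 (f n)))"
    using gnorm2_eq_nn_integral[OF f] by simp
  also have "\<dots> \<le> limsup (\<lambda>n. ennreal (gnorm2 (f n)))"
    by (rule Liminf_le_Limsup) simp
  also have "\<dots> \<le> ennreal C"
    by (rule Limsup_bounded) (use b in \<open>auto elim!: eventually_mono intro!: ennreal_leI\<close>)
  finally have le: "(\<integral>\<^sup>+z. ennreal (wsq g z) \<partial>lebesgue) \<le> ennreal C" .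
  have "integrable lebesgue (\<lambda>z. wsq g z)"
    by (rule integrableI_nonneg) (use le in \<open>auto simp: order_le_less_trans\<close>)
  then show gL: "g \<in> gauss_L2" by (simp add: gauss_L2_def g)
  show "gnorm2 g \<le> C"
    using le C unfolding gnorm2_eq_nn_integral[OF gL] by (simp add: ennreal_le_iff)
qed

section \<open>Restriction to a set\<close>

definition restr :: "complex set \<Rightarrow> (complex \<Rightarrow> complex) \<Rightarrow> complex \<Rightarrow> complex" where
  "restr A f = (\<lambda>z. indicator A z * f z)"

lemma restr_L2 [intro]:
  assumes "f \<in> gauss_L2" "A \<in> sets lebesgue"
  shows "restr A f \<in> gauss_L2"
  unfolding restr_def using assms by (intro gauss_L2_mult_bounded[where B=1]) (auto simp: indicator_def)

lemma restr_add: "restr A (f + g) = restr A f + restr A g"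
  and restr_diff: "restr A (f - g) = restr A f - restr A g"
  and restr_scale: "restr A (c \<odot> f) = c \<odot> restr A f"
  and restr_restr: "restr A (restr B f) = restr (A \<inter> B) f"
  by (auto simp: restr_def fun_eq_iff algebra_simps indicator_def)

text \<open>Multiplication by an indicator is a self-adjoint idempotent. The integrands agree
  pointwise, so arbitrary functions are allowed.\<close>

lemma fock_inner_restr: "fock_inner (restr A f) g = fock_inner f (restr A g)"
  and fock_inner_restr2: "fock_inner (restr A f) (restr A g) = fock_inner (restr A f) g"
  unfolding fock_inner_def
  by (intro Bochner_Integration.integral_cong refl; simp add: restr_def indicator_def)+

lemma gnorm2_restr: "gnorm2 (restr A f) = Re (fock_inner (restr A f) f)"
  by (simp add: gnorm2_eq_Re fock_inner_restr2)

lemma gnorm2_restr_mono: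
  assumes "f \<in> gauss_L2" "A \<in> sets lebesgue" "B \<in> sets lebesgue" "A \<subseteq> B"
  shows "gnorm2 (restr A f) \<le> gnorm2 (restr B f)"
  unfolding gnorm2_def
proof (rule integral_mono)
  show "integrable lebesgue (\<lambda>z. wsq (restr A f) z)"
       "integrable lebesgue (\<lambda>z. wsq (restr B f) z)"
    using assms by (auto intro!: gauss_L2_integrable)
  show "wsq (restr A f) z \<le> wsq (restr B f) z" for z
    using assms by (auto simp: restr_def indicator_def)
qed

lemma restr_UNIV [simp]: "restr UNIV f = f"
  by (simp add: restr_def)

lemma gnorm2_restr_le:
  assumes "f \<in> gauss_L2" "A \<in> sets lebesgue"
  shows "gnorm2 (restr A f) \<le> gnorm2 f"
  using gnorm2_restr_mono[of f A UNIV] assms by simp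

lemma gnorm2_restr_set_integral:
  "gnorm2 (restr A f) = (LINT z:A|lebesgue. wsq f z)"
  unfolding gnorm2_def set_lebesgue_integral_def
  by (intro Bochner_Integration.integral_cong) (auto simp: restr_def indicator_def)

subsection \<open>Pointwise bounds and Weyl translations\<close>

lemma fock_holomorphic: "f \<in> fock_space \<Longrightarrow> f holomorphic_on UNIV"
  and fock_spaceI: "f holomorphic_on UNIV \<Longrightarrow> f \<in> gauss_L2 \<Longrightarrow> f \<in> fock_space"
  by (simp_all add: fock_space_def del: fock_imp_L2)

text \<open>Cauchy's formula for the square of \<open>f\<close> on a circle of radius 1/2 that need
  not be centred at 0: the centre has norm at most 1/4, so the denominator stays at least 1/4 in
  norm. Leaving the centre free permits averaging over it. The factor 2 is the speed pi of the
  parametrisation times 4, divided by 2 pi.\<close>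

lemma entire_square_le_circle_mean:
  assumes f: "f holomorphic_on UNIV" and a: "norm a \<le> 1/4"
  shows "(norm (f 0))\<^sup>2 \<le> 2 * integral {0..1} (\<lambda>t. (norm (f (a + exp (2 * of_real pi * \<i> * of_real t) / 2)))\<^sup>2)"
proof -
  define e where "e = (\<lambda>t::real. exp (2 * of_real pi * \<i> * of_real t) / 2)"
  have cf: "continuous_on UNIV f" using f by (rule holomorphic_on_imp_continuous_on)
  have cp: "circlepath a (1/2) t = a + e t" for t
    by (simp add: circlepath e_def)
  have ne: "norm (e t) = 1/2" for t
    by (simp add: e_def norm_divide)
  have "((\<lambda>u. (f u)\<^sup>2 / (u - 0)) has_contour_integral (2 * of_real pi * \<i> * (f 0)\<^sup>2)) (circlepath a (1/2))"
    by (rule Cauchy_integral_circlepath_simple)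
       (use a in \<open>auto intro!: holomorphic_intros holomorphic_on_subset[OF f]\<close>)
  then have h: "((\<lambda>t. (f (a + e t))\<^sup>2 / (a + e t) * vector_derivative (circlepath a (1/2)) (at t)) has_integral
      (2 * of_real pi * \<i> * (f 0)\<^sup>2)) {0..1}"
    by (simp add: has_contour_integral cp)
  have "norm (2 * of_real pi * \<i> * (f 0)\<^sup>2) \<le> integral {0..1} (\<lambda>t. 4 * pi * (norm (f (a + e t)))\<^sup>2)"
    unfolding integral_unique[OF h, symmetric]
  proof (rule integral_norm_bound_integral)
    show "(\<lambda>t. (f (a + e t))\<^sup>2 / (a + e t) * vector_derivative (circlepath a (1/2)) (at t)) integrable_on {0..1}"
      using h by blast
    show "(\<lambda>t. 4 * pi * (norm (f (a + e t)))\<^sup>2) integrable_on {0..1}"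
      unfolding e_def
      by (intro integrable_continuous_real continuous_intros continuous_on_compose2[OF cf]) auto
    fix t :: real
    have n: "norm (a + e t) \<ge> 1/4"
      using norm_diff_ineq[of "e t" a] a ne[of t] by (simp add: add.commute)
    have "vector_derivative (circlepath a (1/2)) (at t) = 2 * of_real pi * \<i> * e t"
      by (simp add: vector_derivative_circlepath e_def)
    then have "norm (vector_derivative (circlepath a (1/2)) (at t)) = pi"
      by (simp add: norm_mult ne)
    then have "norm ((f (a + e t))\<^sup>2 / (a + e t) * vector_derivative (circlepath a (1/2)) (at t))
       = (norm (f (a + e t)))\<^sup>2 / norm (a + e t) * pi"
      by (simp add: norm_mult norm_divide norm_power)
    also have "\<dots> \<le> (norm (f (a + e t)))\<^sup>2 / (1/4) * pi"
      using n by (intro mult_right_mono divide_left_mono) auto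
    finally show "norm ((f (a + e t))\<^sup>2 / (a + e t) * vector_derivative (circlepath a (1/2)) (at t))
       \<le> 4 * pi * (norm (f (a + e t)))\<^sup>2" by (simp add: mult_ac)
  qed
  also have "\<dots> = 4 * pi * integral {0..1} (\<lambda>t. (norm (f (a + e t)))\<^sup>2)" by simp
  also have "norm (2 * of_real pi * \<i> * (f 0)\<^sup>2) = 2 * pi * (norm (f 0))\<^sup>2"
    by (simp add: norm_mult norm_power)
  finally show ?thesis by (simp add: e_def)
qed

text \<open>Averaging the circle means over centres in a small square turns them into an area integral,
  using translation invariance only.\<close>

lemma entire_square_le_area:
  assumes f: "f holomorphic_on UNIV"
  shows "(norm (f 0))\<^sup>2 \<le> 32 * integral (cbox (Complex (-1) (-1)) (Complex 1 1)) (\<lambda>z. (norm (f z))\<^sup>2)"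
proof -
  define e where "e = (\<lambda>t::real. exp (2 * of_real pi * \<i> * of_real t) / 2)"
  \<comment> \<open>Every point of this square has norm at most 1/4, and adding a vector of length
    1/2 stays inside \<open>S\<close>. The area 1/16 and the factor 2 of the circle means give
    32.\<close>
  define p q where "p = Complex (-1/8) (-1/8)" and "q = Complex (1/8) (1/8)"
  define S where "S = cbox (Complex (-1) (-1)) (Complex 1 1)"
  define F where "F = (\<lambda>z. (norm (f z))\<^sup>2)"
  have cF: "continuous_on A F" for A
    unfolding F_def by (intro continuous_intros continuous_on_subset[OF holomorphic_on_imp_continuous_on[OF f]]) auto
  have Fnn: "F z \<ge> 0" for z by (simp add: F_def)
  have ce: "continuous_on A e" for A unfolding e_def by (intro continuous_intros) auto
  have ne: "norm (e t) = 1/2" for t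
    by (simp add: e_def norm_divide)
  have content: "measure lborel (cbox p q) = 1/16"
    by (subst content_cbox) (auto simp: p_def q_def Basis_complex_def)
  have small: "norm a \<le> 1/4" if "a \<in> cbox p q" for a
  proof -
    have "\<bar>Re a\<bar> \<le> 1/8" "\<bar>Im a\<bar> \<le> 1/8"
      using that by (auto simp: p_def q_def in_cbox_complex_iff)
    then show ?thesis using cmod_le[of a] by linarith
  qed
  have c2: "continuous_on (cbox (p, 0) (q, 1)) (\<lambda>(a,t). F (a + e t))"
    unfolding split_def by (intro continuous_on_compose2[OF cF] continuous_intros continuous_on_compose2[OF ce]) auto
  have inner: "integral (cbox p q) (\<lambda>a. F (a + e t)) \<le> integral S F" for t
  proof -
    have sub: "cbox (p + e t) (q + e t) \<subseteq> S"
    proof -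
      have "\<bar>Re (e t)\<bar> \<le> 1/2" "\<bar>Im (e t)\<bar> \<le> 1/2"
        using ne[of t] abs_Re_le_cmod[of "e t"] abs_Im_le_cmod[of "e t"] by auto
      then show ?thesis by (auto simp: p_def q_def S_def in_cbox_complex_iff)
    qed
    have "integral (cbox p q) (\<lambda>a. F (a + e t)) = integral (cbox (p + e t) (q + e t)) F"
      using integral_shift_cbox[of "p + e t" "e t" "q + e t" F] by simp
    also have "\<dots> \<le> integral S F"
      unfolding S_def
      by (rule integral_subset_le[OF sub[unfolded S_def]]) (auto intro!: integrable_continuous cF simp: Fnn)
    finally show ?thesis .
  qed
  have "(norm (f 0))\<^sup>2 / 16 = integral (cbox p q) (\<lambda>_. (norm (f 0))\<^sup>2)"
    by (simp add: content)
  also have "\<dots> \<le> integral (cbox p q) (\<lambda>a. 2 * integral {0..1} (\<lambda>t. F (a + e t)))"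
  proof (rule integral_le)
    show "(\<lambda>a. 2 * integral {0..1} (\<lambda>t. F (a + e t))) integrable_on cbox p q"
      using integral_continuous_on_param[of "cbox p q" 0 1 "\<lambda>a t. F (a + e t)"] c2
      by (intro integrable_continuous continuous_intros) (auto simp: cbox_Pair_eq)
    show "(norm (f 0))\<^sup>2 \<le> 2 * integral {0..1} (\<lambda>t. F (a + e t))" if "a \<in> cbox p q" for a
      using entire_square_le_circle_mean[OF f small[OF that]] by (simp add: F_def e_def)
  qed auto
  also have "\<dots> = 2 * integral (cbox p q) (\<lambda>a. integral (cbox 0 1) (\<lambda>t. F (a + e t)))" by simp
  also have "\<dots> = 2 * integral (cbox 0 1) (\<lambda>t. integral (cbox p q) (\<lambda>a. F (a + e t)))"
    by (subst integral_swap_continuous[OF c2]) simp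
  also have "\<dots> \<le> 2 * integral (cbox 0 (1::real)) (\<lambda>t. integral S F)"
  proof (intro mult_left_mono integral_le)
    show "(\<lambda>t. integral (cbox p q) (\<lambda>a. F (a + e t))) integrable_on cbox 0 1"
    proof -
      have "continuous_on (cbox (0, p) (1, q)) (\<lambda>(t,a). F (a + e t))"
        unfolding split_def by (intro continuous_on_compose2[OF cF] continuous_intros continuous_on_compose2[OF ce]) auto
      then show ?thesis
        using integral_continuous_on_param[of "cbox 0 1" p q "\<lambda>t a. F (a + e t)"]
        by (intro integrable_continuous) (auto simp: cbox_Pair_eq)
    qed
  qed (use inner in auto)
  also have "\<dots> = 2 * integral S F" by simp
  finally show ?thesis by (simp add: S_def F_def)
qed

text \<open>The 32 comes from \<open>entire_square_le_area\<close>; \<open>exp (4 * pi)\<close> is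
  the reciprocal of the least weight on \<open>cball 0 2\<close>, a disc that contains the square of
  that lemma.\<close>

definition fock_const :: real where "fock_const = 32 * exp (4 * pi)"

lemma fock_const_pos: "fock_const > 0"
  by (simp add: fock_const_def)

lemma continuous_on_fock: "f \<in> fock_space \<Longrightarrow> continuous_on A f"
  by (rule continuous_on_subset[OF holomorphic_on_imp_continuous_on[OF fock_holomorphic]]) auto

text \<open>The area bound sees only a square around the point, where the weight is bounded below.
  Keeping the right-hand side local is what later allows disjoint discs to be counted in
  \<open>superlevel_packing\<close>.\<close>

lemma fock_square_le_local_0:
  assumes "f \<in> fock_space"
  shows "(norm (f 0))\<^sup>2 \<le> fock_const * gnorm2 (restr (cball 0 2) f)"
proof -
  define S where "S = cbox (Complex (-1) (-1)) (Complex 1 1)"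
  have hf: "f holomorphic_on UNIV" and L: "f \<in> gauss_L2" using assms by (auto intro: fock_holomorphic)
  have S: "S \<subseteq> cball 0 2"
  proof
    fix z assume "z \<in> S"
    then have "\<bar>Re z\<bar> \<le> 1" "\<bar>Im z\<bar> \<le> 1" by (auto simp: S_def in_cbox_complex_iff)
    then show "z \<in> cball 0 2" using cmod_le[of z] by simp
  qed
  have S_sets: "S \<in> sets lebesgue" by (simp add: S_def)
  have ai: "(\<lambda>z. (norm (f z))\<^sup>2) absolutely_integrable_on S"
    unfolding S_def by (intro absolutely_integrable_continuous continuous_intros continuous_on_fock assms)
  have iw: "set_integrable lebesgue A (\<lambda>z. wsq f z)" if "A \<in> sets lebesgue" for A
    unfolding set_integrable_def using that
    by (intro integrable_mult_indicator gauss_L2_integrable L)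
  have "integral S (\<lambda>z. (norm (f z))\<^sup>2) = (LINT z:S|lebesgue. (norm (f z))\<^sup>2)"
    by (rule set_lebesgue_integral_eq_integral(2)[OF ai, symmetric])
  also have "\<dots> \<le> (LINT z:S|lebesgue. exp (4 * pi) * wsq f z)"
  proof (rule set_integral_mono[OF ai])
    show "set_integrable lebesgue S (\<lambda>z. exp (4 * pi) * wsq f z)"
      using iw[OF S_sets] by simp
    fix z assume "z \<in> S"
    with S have "norm z \<le> 2" by auto
    then have "(norm z)\<^sup>2 \<le> 2\<^sup>2" by (intro power_mono) auto
    then have "pi * (norm z)\<^sup>2 \<le> pi * 4" by (intro mult_left_mono) auto
    then have "exp (4 * pi) * gauss_weight z \<ge> 1"
      by (simp add: gauss_weight_def exp_add[symmetric])
    then show "(norm (f z))\<^sup>2 \<le> exp (4 * pi) * wsq f z"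
      using mult_left_mono[of 1 "exp (4 * pi) * gauss_weight z" "(norm (f z))\<^sup>2"] by (simp add: mult_ac)
  qed
  also have "\<dots> = exp (4 * pi) * gnorm2 (restr S f)"
    by (simp add: gnorm2_restr_set_integral)
  also have "\<dots> \<le> exp (4 * pi) * gnorm2 (restr (cball 0 2) f)"
    by (intro mult_left_mono gnorm2_restr_mono L S S_sets) auto
  finally show ?thesis
    using entire_square_le_area[OF hf] by (simp add: S_def fock_const_def)
qed

section \<open>Translation invariance and Weyl operators\<close>

lemma distr_lebesgue_translation: "distr lebesgue lebesgue (\<lambda>z. z - a) = (lebesgue :: complex measure)"
  and measurable_lebesgue_translation [measurable]: "(\<lambda>z. z - a) \<in> lebesgue \<rightarrow>\<^sub>M (lebesgue :: complex measure)"
proof -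
  have T: "(\<lambda>x. - a + (\<Sum>j\<in>Basis. (1 * (x \<bullet> j)) *\<^sub>R j)) = (\<lambda>z::complex. z - a)"
    by (simp add: euclidean_representation fun_eq_iff)
  show "distr lebesgue lebesgue (\<lambda>z. z - a) = (lebesgue :: complex measure)"
    using lebesgue_affine_euclidean[of "\<lambda>_. 1" "-a"] unfolding T by (simp add: density_1)
  show "(\<lambda>z. z - a) \<in> lebesgue \<rightarrow>\<^sub>M (lebesgue :: complex measure)"
    using lebesgue_affine_measurable[of "\<lambda>_. 1" "-a"] unfolding T by simp
qed

lemma integral_lebesgue_translation:
  fixes F :: "complex \<Rightarrow> 'b::{banach, second_countable_topology}"
  assumes "F \<in> borel_measurable lebesgue"
  shows "(LINT z|lebesgue. F (z - a)) = (LINT z|lebesgue. F z)"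
  using integral_distr[of "\<lambda>z. z - a" lebesgue lebesgue F] assms
  by (simp add: distr_lebesgue_translation measurable_lebesgue_translation)

lemma integrable_lebesgue_translation:
  fixes F :: "complex \<Rightarrow> 'b::{banach, second_countable_topology}"
  assumes "F \<in> borel_measurable lebesgue"
  shows "integrable lebesgue (\<lambda>z. F (z - a)) \<longleftrightarrow> integrable lebesgue F"
  using integrable_distr_eq[of "\<lambda>z. z - a" lebesgue lebesgue F] assms
  by (simp add: distr_lebesgue_translation measurable_lebesgue_translation)

text \<open>A plain translation does not respect the Gaussian weight. The holomorphic factor
  compensates for this and makes the map unitary on L2 and on the Fock space: these are the Weyl
  operators of the Bargmann-Fock representation of the Heisenberg group.\<close>

definition weyl :: "complex \<Rightarrow> (complex \<Rightarrow> complex) \<Rightarrow> complex \<Rightarrow> complex" where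
  "weyl a f = (\<lambda>z. exp (of_real pi * (cnj a * z) - of_real (pi * (norm a)\<^sup>2 / 2)) * f (z - a))"

text \<open>Completing the square in the exponent. The identity is pointwise, so norms, inner
  products and masses on subsets all follow by translation invariance of Lebesgue measure.\<close>

lemma weyl_mult_weight:
  "weyl a f z * cnj (weyl a g z) * of_real (gauss_weight z)
     = f (z - a) * cnj (g (z - a)) * of_real (gauss_weight (z - a))"
proof -
  define x where "x = of_real pi * (cnj a * z) - complex_of_real (pi * (norm a)\<^sup>2 / 2)"
  have w: "complex_of_real (gauss_weight u) = exp (- of_real pi * (u * cnj u))" for u
    unfolding gauss_weight_def exp_of_real[symmetric] by (simp add: complex_norm_square[symmetric])
  have n: "complex_of_real ((norm a)\<^sup>2) = a * cnj a" by (rule complex_norm_square)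
  have "x + cnj x - of_real pi * (z * cnj z) = - of_real pi * ((z - a) * cnj (z - a))"
    unfolding x_def using n by (simp add: algebra_simps)
  then have "exp x * cnj (exp x) * of_real (gauss_weight z) = of_real (gauss_weight (z - a))"
    unfolding w exp_cnj by (simp add: exp_add[symmetric])
  then show ?thesis
    unfolding weyl_def x_def[symmetric] by (simp add: mult_ac)
qed

lemma weyl_norm_weight:
  "wsq (weyl a f) z = (norm (f (z - a)))\<^sup>2 * gauss_weight (z - a)"
proof -
  have "complex_of_real (wsq (weyl a f) z) = complex_of_real ((norm (f (z - a)))\<^sup>2 * gauss_weight (z - a))"
    using weyl_mult_weight[of a f z f] by (simp only: of_real_mult complex_norm_square)
  then show ?thesis by (simp only: of_real_eq_iff)
qed

lemma weyl_L2 [intro]: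
  assumes "f \<in> gauss_L2"
  shows "weyl a f \<in> gauss_L2"
proof -
  have [measurable]: "f \<in> borel_measurable lebesgue" using assms by (simp add: gauss_L2_def)
  have m: "(\<lambda>z. exp (of_real pi * (cnj a * z) - of_real (pi * (norm a)\<^sup>2 / 2))) \<in> borel_measurable lebesgue"
    by (intro borel_measurable_lebesgue_continuous continuous_intros)
  have "(\<lambda>z. f (z - a)) \<in> borel_measurable lebesgue" by measurable
  with m have "weyl a f \<in> borel_measurable lebesgue" unfolding weyl_def by (rule borel_measurable_times)
  moreover have "integrable lebesgue (\<lambda>z. (norm (f (z - a)))\<^sup>2 * gauss_weight (z - a))"
    using gauss_L2_integrable[OF assms]
    by (subst integrable_lebesgue_translation[of "\<lambda>z. wsq f z"]) simp_all
  ultimately show ?thesis by (simp add: gauss_L2_def weyl_norm_weight)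
qed

lemma fock_inner_weyl:
  assumes "f \<in> gauss_L2" "g \<in> gauss_L2"
  shows "fock_inner (weyl a f) (weyl a g) = fock_inner f g"
  unfolding fock_inner_def weyl_mult_weight
  by (rule integral_lebesgue_translation[of "\<lambda>z. f z * cnj (g z) * of_real (gauss_weight z)"])
     (rule borel_measurable_integrable[OF integrable_inner[OF assms]])

lemma gnorm2_weyl: "f \<in> gauss_L2 \<Longrightarrow> gnorm2 (weyl a f) = gnorm2 f"
  by (simp add: gnorm2_eq_Re fock_inner_weyl)

lemma weyl_fock [intro]: "f \<in> fock_space \<Longrightarrow> weyl a f \<in> fock_space"
proof (rule fock_spaceI)
  assume *: "f \<in> fock_space"
  then show "weyl a f \<in> gauss_L2" by auto
  from * have f: "f holomorphic_on UNIV" by (rule fock_holomorphic)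
  have "(f \<circ> (\<lambda>z. z - a)) holomorphic_on UNIV"
    by (intro holomorphic_on_compose holomorphic_intros holomorphic_on_subset[OF f]) auto
  then show "weyl a f holomorphic_on UNIV"
    unfolding weyl_def comp_def by (intro holomorphic_intros)
qed

lemma weyl_scale: "weyl a (c \<odot> f) = c \<odot> weyl a f"
  by (auto simp: weyl_def fun_eq_iff algebra_simps)

lemma weyl_sum: "weyl a (\<Sum>i\<in>A. f i) = (\<Sum>i\<in>A. weyl a (f i))"
  by (auto simp: weyl_def fun_eq_iff sum_fun_apply sum_distrib_left)

text \<open>Two Weyl operators compose up to a unimodular factor, which is 1 for opposite
  translations. Hence \<open>weyl a\<close> maps the Fock space onto itself;
  \<open>fock_proj_weyl\<close> uses this to write a test function as
  \<open>weyl a h\<close>.\<close>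

lemma weyl_weyl_inverse [simp]: "weyl a (weyl (- a) f) = f"
proof
  fix z
  have n: "complex_of_real ((norm a)\<^sup>2) = a * cnj a" by (rule complex_norm_square)
  have "(of_real pi * (cnj a * z) - of_real (pi * (norm a)\<^sup>2 / 2)) +
     (of_real pi * (cnj (- a) * (z - a)) - complex_of_real (pi * (norm (-a))\<^sup>2 / 2)) = 0"
    using n by (simp add: algebra_simps)
  then show "weyl a (weyl (- a) f) z = f z"
    unfolding weyl_def by (simp add: exp_add[symmetric] mult.assoc[symmetric])
qed

lemma restr_weyl: "restr ((+) a ` A) (weyl a f) = weyl a (restr A f)"
proof
  fix z
  have "z \<in> (+) a ` A \<longleftrightarrow> z - a \<in> A" by (auto simp: image_iff algebra_simps) (metis add_diff_cancel_left' diff_add_cancel add.commute)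
  then show "restr ((+) a ` A) (weyl a f) z = weyl a (restr A f) z"
    by (simp add: restr_def weyl_def indicator_def)
qed

lemma fock_square_le_local:
  assumes "f \<in> fock_space"
  shows "(norm (f a))\<^sup>2 * gauss_weight a \<le> fock_const * gnorm2 (restr (cball a 2) f)"
proof -
  have "(norm (f a))\<^sup>2 * gauss_weight a = (norm (weyl (- a) f 0))\<^sup>2"
    using weyl_norm_weight[of "- a" f 0] by (simp add: gauss_weight_def)
  also have "\<dots> \<le> fock_const * gnorm2 (restr (cball 0 2) (weyl (- a) f))"
    by (intro fock_square_le_local_0 weyl_fock assms)
  also have "cball 0 2 = (+) (- a) ` cball a 2"
    by (metis add.left_inverse cball_translation)
  also have "restr \<dots> (weyl (- a) f) = weyl (- a) (restr (cball a 2) f)"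
    by (rule restr_weyl)
  also have "gnorm2 \<dots> = gnorm2 (restr (cball a 2) f)"
    using assms by (intro gnorm2_weyl restr_L2) auto
  finally show ?thesis .
qed

lemma fock_square_le:
  assumes "f \<in> fock_space"
  shows "(norm (f a))\<^sup>2 * gauss_weight a \<le> fock_const * gnorm2 f"
proof -
  have "gnorm2 (restr (cball a 2) f) \<le> gnorm2 f"
    using assms by (intro gnorm2_restr_le) auto
  then have "fock_const * gnorm2 (restr (cball a 2) f) \<le> fock_const * gnorm2 f"
    using fock_const_pos by (intro mult_left_mono) auto
  with fock_square_le_local[OF assms, of a] show ?thesis by linarith
qed

text \<open>Bounded point evaluations turn a vanishing norm into vanishing everywhere. On
  \<open>gauss_L2\<close>, whose elements are genuine functions, \<open>gnorm2\<close> is only a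
  seminorm.\<close>

lemma fock_zero_iff:
  assumes "f \<in> fock_space"
  shows "gnorm2 f = 0 \<longleftrightarrow> f = 0"
proof
  assume "gnorm2 f = 0"
  then have "(norm (f a))\<^sup>2 * gauss_weight a \<le> 0" for a
    using fock_square_le[OF assms, of a] by simp
  then have "f a = 0" for a
    by (metis gauss_weight_pos mult_le_0_iff not_less power2_less_eq_zero_iff norm_eq_zero zero_less_power2 linorder_not_less)
  then show "f = 0" by (simp add: fun_eq_iff)
qed (simp add: gnorm2_def)

section \<open>Compactness and convergence\<close>

text \<open>Stands in for weak sequential compactness of balls. By \<open>fock_square_le\<close> the
  sequence is uniformly bounded on compact sets, so Montel's theorem applies, and Fatou's lemma
  carries the norm bound to the limit.\<close>

lemma fock_bounded_subsequence:
  assumes f: "\<And>n. f n \<in> fock_space" and B: "\<And>n. gnorm2 (f n) \<le> B"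
  shows "\<exists>g r. g \<in> fock_space \<and> gnorm2 g \<le> B \<and> strict_mono (r :: nat \<Rightarrow> nat) \<and>
    (\<forall>z. (\<lambda>n. f (r n) z) \<longlonglongrightarrow> g z)"
proof -
  have bd: "(norm (f n z))\<^sup>2 \<le> fock_const * B / gauss_weight z" for n z
  proof -
    have "wsq (f n) z \<le> fock_const * B"
      using fock_square_le[OF f, of n z] mult_left_mono[OF B[of n] less_imp_le[OF fock_const_pos]] by linarith
    then show ?thesis by (simp add: pos_le_divide_eq)
  qed
  obtain g r where gr: "g holomorphic_on UNIV" "strict_mono (r :: nat \<Rightarrow> nat)" "\<And>z. (\<lambda>n. f (r n) z) \<longlonglongrightarrow> g z"
  proof (rule Montel[of UNIV "range f" f])
    show "h holomorphic_on UNIV" if "h \<in> range f" for h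
      using that f by (auto intro: fock_holomorphic)
    show "\<exists>B. \<forall>h\<in>range f. \<forall>z\<in>K. norm (h z) \<le> B" if "compact K" for K
    proof -
      have "continuous_on K (\<lambda>z. sqrt (fock_const * B / gauss_weight z))"
        by (intro continuous_intros continuous_gauss_weight) auto
      then have "compact ((\<lambda>z. sqrt (fock_const * B / gauss_weight z)) ` K)"
        using that compact_continuous_image by blast
      then obtain M where M: "\<And>z. z \<in> K \<Longrightarrow> norm (sqrt (fock_const * B / gauss_weight z)) \<le> M"
        using compact_imp_bounded bounded_iff by (metis (no_types, lifting) image_eqI)
      have "norm (f n z) \<le> M" if "z \<in> K" for n z
        using M[OF that] real_le_rsqrt[OF bd[of n z]] by simp
      then show ?thesis by auto
    qed
  qed auto
  have "g \<in> gauss_L2" "gnorm2 g \<le> B"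
    using gnorm2_Fatou[of "\<lambda>n. f (r n)" g B] f B gr(3) by auto
  with gr show ?thesis by (intro exI[of _ g] exI[of _ r]) (auto intro: fock_spaceI)
qed

lemma gnorm2_tail_tendsto_0:
  assumes "h \<in> gauss_L2"
  shows "(\<lambda>n. gnorm2 (restr (- cball 0 (real n)) h)) \<longlonglongrightarrow> 0"
proof -
  have m [measurable]: "h \<in> borel_measurable lebesgue" using assms by (simp add: gauss_L2_def)
  have L: "restr (- cball 0 (real n)) h \<in> gauss_L2" for n
    using assms by (intro restr_L2) (auto intro!: borel_open simp: open_Compl)
  have "(\<lambda>n. LINT z|lebesgue. (norm (restr (- cball 0 (real n)) h z))\<^sup>2 * gauss_weight z) \<longlonglongrightarrow> (LINT z::complex|lebesgue. 0)"
  proof (rule integral_dominated_convergence)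
    show "integrable lebesgue (\<lambda>z. wsq h z)"
      by (rule gauss_L2_integrable[OF assms])
    show "(\<lambda>z. (norm (restr (- cball 0 (real n)) h z))\<^sup>2 * gauss_weight z) \<in> borel_measurable lebesgue" for n
      using gauss_L2_integrable[OF L[of n]] by (rule borel_measurable_integrable)
    have "(\<lambda>n. (norm (restr (- cball 0 (real n)) h z))\<^sup>2 * gauss_weight z) \<longlonglongrightarrow> 0" for z
    proof (rule tendsto_eventually)
      obtain N where "norm z \<le> real N" using real_arch_simple by blast
      then show "\<forall>\<^sub>F n in sequentially. (norm (restr (- cball 0 (real n)) h z))\<^sup>2 * gauss_weight z = 0"
        unfolding eventually_sequentially by (intro exI[of _ N]) (auto simp: restr_def)
    qed
    then show "AE z in lebesgue. (\<lambda>n. (norm (restr (- cball 0 (real n)) h z))\<^sup>2 * gauss_weight z) \<longlonglongrightarrow> 0" by simp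
    show "AE z in lebesgue. norm ((norm (restr (- cball 0 (real n)) h z))\<^sup>2 * gauss_weight z) \<le> wsq h z" for n
      by (auto simp: restr_def indicator_def)
  qed simp
  then show ?thesis by (simp add: gnorm2_def)
qed

text \<open>The point evaluation bound dominates the integrand by a constant, which is integrable
  over a set of finite measure. This is compactness of the localization operator in terms of
  sequences.\<close>

lemma fock_tendsto_restr_diff:
  assumes f: "\<And>n. f n \<in> fock_space" and B: "\<And>n. gnorm2 (f n) \<le> B"
    and g: "g \<in> fock_space" "gnorm2 g \<le> B" and lim: "\<And>z. (\<lambda>n. f n z) \<longlonglongrightarrow> g z"
    and A: "A \<in> sets lebesgue" "emeasure lebesgue A < \<infinity>"
  shows "(\<lambda>n. gnorm2 (restr A (f n - g))) \<longlonglongrightarrow> 0"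
proof -
  have L: "restr A (f n - g) \<in> gauss_L2" for n
    using f g A by (intro restr_L2 gauss_L2_diff) auto
  have b: "gnorm2 (f n - g) \<le> 4 * B" for n
    using gnorm2_diff_le[of "f n" g] f[of n] g B[of n] by simp
  have "(\<lambda>n. LINT z|lebesgue. wsq (restr A (f n - g)) z) \<longlonglongrightarrow> (LINT z::complex|lebesgue. 0)"
  proof (rule integral_dominated_convergence)
    show "integrable lebesgue (\<lambda>z. fock_const * (4 * B) * indicator A z)"
      using A by simp
    show "(\<lambda>z. wsq (restr A (f n - g)) z) \<in> borel_measurable lebesgue" for n
      using gauss_L2_integrable[OF L[of n]] by (rule borel_measurable_integrable)
    have "(\<lambda>n. wsq (restr A (f n - g)) z) \<longlonglongrightarrow> (norm (indicator A z * (g z - g z)))\<^sup>2 * gauss_weight z" for z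
      unfolding restr_def fun_diff_def by (intro tendsto_intros lim)
    then show "AE z in lebesgue. (\<lambda>n. wsq (restr A (f n - g)) z) \<longlonglongrightarrow> 0" by simp
    have "wsq (restr A (f n - g)) z \<le> fock_const * (4 * B) * indicator A z" for n z
    proof (cases "z \<in> A")
      case True
      have "wsq (f n - g) z \<le> fock_const * gnorm2 (f n - g)"
        by (intro fock_square_le fock_diff f g)
      also have "\<dots> \<le> fock_const * (4 * B)"
        using b[of n] fock_const_pos by (intro mult_left_mono) auto
      finally show ?thesis using True by (simp add: restr_def)
    qed (simp add: restr_def)
    then show "AE z in lebesgue. norm (wsq (restr A (f n - g)) z) \<le> fock_const * (4 * B) * indicator A z" for n
      by simp
  qed simp
  then show ?thesis by (simp add: gnorm2_def)
qed

text \<open>Weak convergence from pointwise convergence: \<open>h\<close> has little mass outside a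
  large disc, and on the disc the differences tend to 0 in norm.\<close>

lemma fock_tendsto_inner:
  assumes f: "\<And>n. f n \<in> fock_space" and B: "\<And>n. gnorm2 (f n) \<le> B"
    and g: "g \<in> fock_space" "gnorm2 g \<le> B" and lim: "\<And>z. (\<lambda>n. f n z) \<longlonglongrightarrow> g z"
    and h: "h \<in> gauss_L2"
  shows "(\<lambda>n. fock_inner (f n) h) \<longlonglongrightarrow> fock_inner g h"
proof (rule Lim_transform2[OF tendsto_const], rule tendsto_norm_zero_cancel, rule LIMSEQ_I)
  fix \<epsilon> :: real assume e: "\<epsilon> > 0"
  have B0: "B \<ge> 0" using B[of 0] gnorm2_nonneg[of "f 0"] by linarith
  have b: "gnorm2 (f n - g) \<le> 4 * B" for n
    using gnorm2_diff_le[of "f n" g] f[of n] g B[of n] by simp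
  have "(\<lambda>n. sqrt (4 * B * gnorm2 (restr (- cball 0 (real n)) h))) \<longlonglongrightarrow> sqrt (4 * B * 0)"
    by (intro tendsto_intros gnorm2_tail_tendsto_0 h)
  then have "\<forall>\<^sub>F n in sequentially. sqrt (4 * B * gnorm2 (restr (- cball 0 (real n)) h)) < \<epsilon> / 2"
    using e by (intro order_tendstoD) auto
  then obtain R :: nat where R: "sqrt (4 * B * gnorm2 (restr (- cball 0 (real R)) h)) < \<epsilon> / 2"
    by (auto simp: eventually_sequentially)
  define A where "A = cball (0::complex) (real R)"
  have A: "A \<in> sets lebesgue" "emeasure lebesgue A < \<infinity>" "- A \<in> sets lebesgue"
    unfolding A_def by (auto simp: emeasure_cball intro!: borel_open)
  have "(\<lambda>n. sqrt (gnorm2 (restr A (f n - g)) * gnorm2 h)) \<longlonglongrightarrow> sqrt (0 * gnorm2 h)"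
    by (intro tendsto_intros fock_tendsto_restr_diff[OF f B g lim A(1,2)])
  then have "\<forall>\<^sub>F n in sequentially. sqrt (gnorm2 (restr A (f n - g)) * gnorm2 h) < \<epsilon> / 2"
    using e by (intro order_tendstoD) auto
  then obtain N where N: "\<And>n. n \<ge> N \<Longrightarrow> sqrt (gnorm2 (restr A (f n - g)) * gnorm2 h) < \<epsilon> / 2"
    by (auto simp: eventually_sequentially)
  have CS: "norm (fock_inner u v) \<le> sqrt (gnorm2 u * gnorm2 v)" if "u \<in> gauss_L2" "v \<in> gauss_L2" for u v
    using fock_inner_Cauchy_Schwarz[OF that] by (intro real_le_rsqrt)
  show "\<exists>no. \<forall>n\<ge>no. norm (norm (fock_inner g h - fock_inner (f n) h) - 0) < \<epsilon>"
  proof (intro exI[of _ N] allI impI)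
    fix n assume n: "n \<ge> N"
    define d where "d = f n - g"
    have L: "d \<in> gauss_L2" using f g unfolding d_def by (intro gauss_L2_diff) auto
    have "h = restr A h + restr (- A) h" by (auto simp: restr_def fun_eq_iff indicator_def)
    then have "fock_inner (d) h = fock_inner (d) (restr A h) + fock_inner (d) (restr (- A) h)"
      using fock_inner_add_right[of "restr A h" "restr (- A) h" "d"] L h A by (metis restr_L2)
    also have "fock_inner (d) (restr A h) = fock_inner (restr A (d)) h"
      by (simp add: fock_inner_restr)
    finally have "norm (fock_inner (d) h) \<le> norm (fock_inner (restr A (d)) h) + norm (fock_inner (d) (restr (- A) h))"
      using norm_triangle_ineq by metis
    also have "norm (fock_inner (restr A (d)) h) \<le> sqrt (gnorm2 (restr A (d)) * gnorm2 h)"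
      by (intro CS restr_L2 L h A)
    also have "norm (fock_inner (d) (restr (- A) h)) \<le> sqrt (gnorm2 (d) * gnorm2 (restr (- A) h))"
      by (intro CS restr_L2 L h A)
    also have "sqrt (gnorm2 (d) * gnorm2 (restr (- A) h)) \<le> sqrt (4 * B * gnorm2 (restr (- A) h))"
      by (intro real_sqrt_le_mono mult_right_mono b[of n, folded d_def]) simp
    finally have "norm (fock_inner (d) h) < \<epsilon>"
      using N[OF n, folded d_def] R[folded A_def] by linarith
    moreover have "fock_inner d h = fock_inner (f n) h - fock_inner g h"
      using f g h unfolding d_def by (intro fock_inner_diff_left) auto
    ultimately show "norm (norm (fock_inner g h - fock_inner (f n) h) - 0) < \<epsilon>"
      by (simp add: norm_minus_commute)
  qed
qed

subsection \<open>The projection onto the Fock space\<close>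

text \<open>Near \<open>t = 0\<close> the linear term would win. The test point \<open>x / b\<close>
  has \<open>b\<close> positive and above \<open>A\<close>, so nothing is assumed about the sign of
  \<open>A\<close>.\<close>

lemma quadratic_nonneg_imp_zero:
  fixes A x :: real
  assumes "\<And>t. 0 \<le> t\<^sup>2 * A - 2 * t * x"
  shows "x = 0"
proof (rule ccontr)
  assume x: "x \<noteq> 0"
  define b where "b = \<bar>A\<bar> + 1"
  have b: "b > 0" "A < b" by (auto simp: b_def)
  have "0 \<le> (x / b)\<^sup>2 * A - 2 * (x / b) * x" by (rule assms)
  then have "0 \<le> b\<^sup>2 * ((x / b)\<^sup>2 * A - 2 * (x / b) * x)" by simp
  also have "\<dots> = x\<^sup>2 * (A - 2 * b)" using b by (simp add: field_simps power2_eq_square)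
  finally have "0 \<le> A - 2 * b" using x by (simp add: zero_le_mult_iff)
  with b show False by simp
qed

lemma gnorm2_diff_scale:
  assumes "u \<in> gauss_L2" "f \<in> gauss_L2"
  shows "gnorm2 (u - c \<odot> f) = gnorm2 u + (norm c)\<^sup>2 * gnorm2 f - 2 * Re (cnj c * fock_inner u f)"
  using assms by (simp add: gnorm2_diff gauss_L2_scale fock_inner_scale_right)

lemma minimiser_orthogonal:
  assumes "u \<in> gauss_L2" "f \<in> gauss_L2" and min: "\<And>c. gnorm2 u \<le> gnorm2 (u - c \<odot> f)"
  shows "fock_inner u f = 0"
proof -
  define x where "x = fock_inner u f"
  \<comment> \<open>Varying along real multiples of \<open>x\<close> itself turns the real part into
    \<open>(norm x)\<^sup>2\<close>, so one real parameter controls both components of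
    \<open>x\<close>.\<close>
  have "0 \<le> t\<^sup>2 * ((norm x)\<^sup>2 * gnorm2 f) - 2 * t * (norm x)\<^sup>2" for t :: real
  proof -
    have "cnj (of_real t * x) * x = of_real (t * (norm x)\<^sup>2)"
      using complex_norm_square[of x] by (simp add: mult_ac)
    then have "Re (cnj (of_real t * x) * x) = t * (norm x)\<^sup>2" by (simp only: Re_complex_of_real)
    with min[of "of_real t * x"] show ?thesis
      unfolding gnorm2_diff_scale[OF assms(1,2)] x_def[symmetric]
      by (simp add: norm_mult power_mult_distrib)
  qed
  then have "(norm x)\<^sup>2 = 0" by (rule quadratic_nonneg_imp_zero)
  then show ?thesis by (simp add: x_def)
qed

text \<open>Closest point argument: a minimising sequence is bounded, hence converges pointwise
  along a subsequence, and Fatou's lemma shows that the limit attains the distance. Montel's theorem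
  thus takes the place of completeness.\<close>

lemma fock_proj_exists:
  assumes g: "g \<in> gauss_L2"
  shows "\<exists>h\<in>fock_space. \<forall>f\<in>fock_space. fock_inner (g - h) f = 0"
proof -
  define d where "d = (INF h\<in>fock_space. gnorm2 (g - h))"
  have bdd: "bdd_below ((\<lambda>h. gnorm2 (g - h)) ` fock_space)"
    by (intro bdd_belowI[of _ 0]) auto
  have ne: "fock_space \<noteq> {}" using fock_zero by blast
  have "\<exists>h\<in>fock_space. gnorm2 (g - h) < d + 1 / real (Suc n)" for n
    using cINF_less_iff[OF ne bdd, of "d + 1 / real (Suc n)"] by (simp add: d_def)
  then obtain h where h: "\<And>n. h n \<in> fock_space" "\<And>n. gnorm2 (g - h n) < d + 1 / real (Suc n)"
    by metis
  have hb: "gnorm2 (h n) \<le> 2 * gnorm2 g + 2 * (d + 1)" for n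
  proof -
    have "1 / real (Suc n) \<le> 1" by simp
    with h(2)[of n] have 1: "gnorm2 (g - h n) \<le> d + 1" by linarith
    have "gnorm2 (g - (g - h n)) \<le> 2 * gnorm2 g + 2 * gnorm2 (g - h n)"
      using g h(1) by (intro gnorm2_diff_le gauss_L2_diff) auto
    with 1 show ?thesis by simp
  qed
  obtain k r where k: "k \<in> fock_space" "strict_mono (r :: nat \<Rightarrow> nat)" "\<And>z. (\<lambda>n. h (r n) z) \<longlonglongrightarrow> k z"
    using fock_bounded_subsequence[of h, OF h(1) hb] by blast
  have "gnorm2 (g - k) \<le> d + \<epsilon>" if "\<epsilon> > 0" for \<epsilon>
  proof (rule gnorm2_Fatou(2))
    show "g - h (r n) \<in> gauss_L2" for n using g h(1) by auto
    show "(\<lambda>n. (g - h (r n)) z) \<longlonglongrightarrow> (g - k) z" for z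
      unfolding fun_diff_def by (intro tendsto_intros k)
    have "(\<lambda>n. 1 / real (Suc n)) \<longlonglongrightarrow> 0" by (rule LIMSEQ_Suc[OF lim_1_over_n])
    then have "\<forall>\<^sub>F n in sequentially. 1 / real (Suc n) < \<epsilon>" using that by (rule order_tendstoD)
    then have "\<forall>\<^sub>F n in sequentially. 1 / real (Suc (r n)) < \<epsilon>"
      using k(2) by (rule eventually_subseq[rotated])
    then show "\<forall>\<^sub>F n in sequentially. gnorm2 (g - h (r n)) \<le> d + \<epsilon>"
      by (rule eventually_mono) (use h(2) less_trans add_strict_left_mono less_imp_le in metis)
  qed
  then have kd: "gnorm2 (g - k) \<le> d" by (rule field_le_epsilon)
  have "fock_inner (g - k) f = 0" if f: "f \<in> fock_space" for f
  proof (rule minimiser_orthogonal)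
    show "g - k \<in> gauss_L2" "f \<in> gauss_L2" using g k f by auto
    fix c
    have "d \<le> gnorm2 (g - (k + c \<odot> f))"
      unfolding d_def by (rule cINF_lower[OF bdd]) (use k f in auto)
    with kd show "gnorm2 (g - k) \<le> gnorm2 (g - k - c \<odot> f)" by (simp add: diff_diff_add)
  qed
  with k(1) show ?thesis by blast
qed

lemma fock_inner_eq_imp_eq:
  assumes "h \<in> fock_space" "k \<in> fock_space" "\<And>f. f \<in> fock_space \<Longrightarrow> fock_inner h f = fock_inner k f"
  shows "h = k"
proof -
  have "fock_inner (h - k) (h - k) = 0"
    using assms by (simp add: fock_inner_diff_left fock_diff)
  then have "gnorm2 (h - k) = 0" by (simp add: fock_inner_self)
  then have "h - k = 0" using assms by (simp add: fock_zero_iff fock_diff)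
  then show ?thesis by simp
qed

lemma fock_proj_eqI:
  assumes "g \<in> gauss_L2" "h \<in> fock_space" "\<And>f. f \<in> fock_space \<Longrightarrow> fock_inner g f = fock_inner h f"
  shows "fock_proj g = h"
proof -
  have D: "(\<lambda>z. g z - k z) = g - k" for k by (rule ext) simp
  show ?thesis
    unfolding fock_proj_def
  proof (rule the_equality)
    have "fock_inner (g - h) f = 0" if "f \<in> fock_space" for f
      using assms that by (simp add: fock_inner_diff_left)
    then show "h \<in> fock_space \<and> (\<forall>f\<in>fock_space. fock_inner (\<lambda>z. g z - h z) f = 0)"
      unfolding D[of h] using assms(2) by blast
  next
    fix k assume "k \<in> fock_space \<and> (\<forall>f\<in>fock_space. fock_inner (\<lambda>z. g z - k z) f = 0)"
    then have k: "k \<in> fock_space" "\<And>f. f \<in> fock_space \<Longrightarrow> fock_inner (g - k) f = 0"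
      unfolding D[of k] by blast+
    show "k = h"
    proof (rule fock_inner_eq_imp_eq[OF k(1) assms(2)])
      fix f assume f: "f \<in> fock_space"
      with k(2)[OF f] show "fock_inner k f = fock_inner h f"
        using assms k(1) by (simp add: fock_inner_diff_left)
    qed
  qed
qed

lemma
  assumes "g \<in> gauss_L2"
  shows fock_proj_in_fock [intro, simp]: "fock_proj g \<in> fock_space"
    and fock_inner_proj: "f \<in> fock_space \<Longrightarrow> fock_inner (fock_proj g) f = fock_inner g f"
proof -
  obtain h where h: "h \<in> fock_space" "\<forall>f\<in>fock_space. fock_inner (g - h) f = 0"
    using fock_proj_exists[OF assms] by blast
  have *: "fock_inner g f = fock_inner h f" if "f \<in> fock_space" for f
    using h assms that by (simp add: fock_inner_diff_left)
  have "fock_proj g = h" by (intro fock_proj_eqI assms h *)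
  with h * show "fock_proj g \<in> fock_space"
    "f \<in> fock_space \<Longrightarrow> fock_inner (fock_proj g) f = fock_inner g f" by auto
qed

lemma fock_proj_add:
  assumes "f \<in> gauss_L2" "g \<in> gauss_L2"
  shows "fock_proj (f + g) = fock_proj f + fock_proj g"
  using assms by (intro fock_proj_eqI) (auto simp: fock_inner_add_left fock_inner_proj)

lemma fock_proj_diff:
  assumes "f \<in> gauss_L2" "g \<in> gauss_L2"
  shows "fock_proj (f - g) = fock_proj f - fock_proj g"
  using assms by (intro fock_proj_eqI) (auto simp: fock_inner_diff_left fock_inner_proj)

lemma gnorm2_fock_proj:
  assumes "g \<in> gauss_L2"
  shows "gnorm2 (fock_proj g) = Re (fock_inner g (fock_proj g))"
  unfolding gnorm2_eq_Re using assms by (simp add: fock_inner_proj)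

lemma gnorm2_fock_proj_le:
  assumes "g \<in> gauss_L2"
  shows "gnorm2 (fock_proj g) \<le> gnorm2 g"
proof -
  have "0 \<le> gnorm2 (g - fock_proj g)" by simp
  also have "\<dots> = gnorm2 g - gnorm2 (fock_proj g)"
    using assms gnorm2_fock_proj[OF assms] by (simp add: gnorm2_diff)
  finally show ?thesis by simp
qed

lemma fock_proj_weyl:
  assumes "g \<in> gauss_L2"
  shows "fock_proj (weyl a g) = weyl a (fock_proj g)"
proof (rule fock_proj_eqI)
  show "weyl a g \<in> gauss_L2" using assms by (rule weyl_L2)
  show "weyl a (fock_proj g) \<in> fock_space" using assms by (intro weyl_fock fock_proj_in_fock)
  fix f assume f: "f \<in> fock_space"
  define h where "h = weyl (- a) f"
  have "h \<in> fock_space" using f by (auto simp: h_def)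
  moreover have "weyl a h = f" by (simp add: h_def)
  ultimately show "fock_inner (weyl a g) f = fock_inner (weyl a (fock_proj g)) f"
    using assms fock_inner_weyl[of g h a] fock_inner_weyl[of "fock_proj g" h a]
    by (simp add: fock_inner_proj)
qed

subsection \<open>Bessel families\<close>

text \<open>Families with Gram matrix at most the identity. Unlike orthonormality, this condition
  passes to pointwise limits.\<close>

definition bessel_family :: "nat \<Rightarrow> (nat \<Rightarrow> complex \<Rightarrow> complex) \<Rightarrow> bool" where
  "bessel_family K \<phi> \<longleftrightarrow> (\<forall>k<K. \<phi> k \<in> gauss_L2) \<and>
     (\<forall>c. gnorm2 (\<Sum>k<K. c k \<odot> \<phi> k) \<le> (\<Sum>k<K. (norm (c k))\<^sup>2))"

definition orthonormal_family :: "nat \<Rightarrow> (nat \<Rightarrow> complex \<Rightarrow> complex) \<Rightarrow> bool" where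
  "orthonormal_family K \<phi> \<longleftrightarrow> (\<forall>k<K. \<phi> k \<in> gauss_L2) \<and>
     (\<forall>j<K. \<forall>k<K. fock_inner (\<phi> j) (\<phi> k) = (if j = k then 1 else 0))"

lemma gnorm2_orthonormal_sum:
  assumes "orthonormal_family K \<phi>"
  shows "gnorm2 (\<Sum>k<K. c k \<odot> \<phi> k) = (\<Sum>k<K. (norm (c k))\<^sup>2)"
proof -
  have "of_real (gnorm2 (\<Sum>k<K. c k \<odot> \<phi> k))
     = (\<Sum>j<K. \<Sum>k<K. fock_inner (c j \<odot> \<phi> j) (c k \<odot> \<phi> k))"
    using assms by (intro gnorm2_sum) (auto simp: orthonormal_family_def)
  also have "\<dots> = (\<Sum>j<K. \<Sum>k<K. if k = j then c j * cnj (c j) else 0)"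
    using assms
    by (intro sum.cong refl) (auto simp: orthonormal_family_def fock_inner_scale_left fock_inner_scale_right)
  also have "\<dots> = (\<Sum>j<K. c j * cnj (c j))" by (intro sum.cong refl) (simp add: sum.delta)
  also have "\<dots> = of_real (\<Sum>k<K. (norm (c k))\<^sup>2)"
    by (simp only: of_real_sum complex_norm_square)
  finally show ?thesis by (simp only: of_real_eq_iff)
qed

lemma orthonormal_imp_bessel: "orthonormal_family K \<phi> \<Longrightarrow> bessel_family K \<phi>"
  by (simp add: bessel_family_def gnorm2_orthonormal_sum) (simp add: orthonormal_family_def)

text \<open>Choosing as coefficients the conjugates of \<open>fock_inner (\<phi> k) g\<close> makes
  the inner product of the combination with \<open>g\<close> equal to the sum \<open>S\<close> in
  question, and Cauchy-Schwarz gives \<open>S * S \<le> S * gnorm2 g\<close>. In operator terms, the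
  adjoint of a contraction is a contraction.\<close>

lemma bessel_inner_le:
  assumes "bessel_family K \<phi>" "g \<in> gauss_L2"
  shows "(\<Sum>k<K. (norm (fock_inner (\<phi> k) g))\<^sup>2) \<le> gnorm2 g"
proof -
  define c where "c k = cnj (fock_inner (\<phi> k) g)" for k
  define S where "S = (\<Sum>k<K. (norm (fock_inner (\<phi> k) g))\<^sup>2)"
  have S0: "S \<ge> 0" by (simp add: S_def sum_nonneg)
  have L: "(\<Sum>k<K. c k \<odot> \<phi> k) \<in> gauss_L2"
    using assms by (intro gauss_L2_sum gauss_L2_scale) (auto simp: bessel_family_def)
  have "fock_inner (\<Sum>k<K. c k \<odot> \<phi> k) g = (\<Sum>k<K. fock_inner (\<phi> k) g * cnj (fock_inner (\<phi> k) g))"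
    using assms by (subst fock_inner_sum_left)
      (auto simp: bessel_family_def fock_inner_scale_left c_def mult.commute)
  also have "\<dots> = of_real S" by (simp only: S_def of_real_sum complex_norm_square)
  finally have "S\<^sup>2 = (norm (fock_inner (\<Sum>k<K. c k \<odot> \<phi> k) g))\<^sup>2" by simp
  also have "\<dots> \<le> gnorm2 (\<Sum>k<K. c k \<odot> \<phi> k) * gnorm2 g"
    by (rule fock_inner_Cauchy_Schwarz[OF L assms(2)])
  also have "\<dots> \<le> (\<Sum>k<K. (norm (c k))\<^sup>2) * gnorm2 g"
    using assms(1) by (intro mult_right_mono) (auto simp: bessel_family_def)
  also have "\<dots> = S * gnorm2 g" by (simp add: S_def c_def)
  finally have "S * S \<le> S * gnorm2 g" by (simp add: power2_eq_square)
  then show ?thesis using S0 by (cases "S = 0") (auto simp: S_def[symmetric])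
qed

lemma bessel_gnorm2_le_1:
  assumes "bessel_family K \<phi>" "k < K"
  shows "gnorm2 (\<phi> k) \<le> 1"
proof -
  have "(\<Sum>j<K. (if j = k then 1 else 0) \<odot> \<phi> j) = (\<Sum>j<K. if j = k then \<phi> j else 0)"
    by (intro sum.cong refl) (auto simp: fun_eq_iff)
  also have "\<dots> = \<phi> k" using assms(2) by (simp add: sum.delta)
  finally have "gnorm2 (\<phi> k) = gnorm2 (\<Sum>j<K. (if j = k then 1 else 0) \<odot> \<phi> j)" by simp
  also have "\<dots> \<le> (\<Sum>j<K. (norm (if j = k then 1 else 0 :: complex))\<^sup>2)"
    using assms(1) unfolding bessel_family_def by fast
  also have "\<dots> = (\<Sum>j<K. if j = k then 1 else 0)" by (intro sum.cong) auto
  also have "\<dots> = 1" using assms(2) by (simp add: sum.delta)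
  finally show ?thesis .
qed

text \<open>The combination with coefficients \<open>cnj (\<phi> k z)\<close>, evaluated at
  \<open>z\<close>, is the sum of squares itself. The bound is independent of \<open>K\<close>,
  which is what makes the eigenvalues summable.\<close>

lemma bessel_pointwise_le:
  assumes "bessel_family K \<phi>" "\<And>k. k < K \<Longrightarrow> \<phi> k \<in> fock_space"
  shows "(\<Sum>k<K. wsq (\<phi> k) z) \<le> fock_const"
proof -
  define S where "S = (\<Sum>k<K. (norm (\<phi> k z))\<^sup>2)"
  have S0: "S \<ge> 0" by (simp add: S_def sum_nonneg)
  define f where "f = (\<Sum>k<K. cnj (\<phi> k z) \<odot> \<phi> k)"
  have fz: "f z = of_real S"
    unfolding f_def sum_fun_apply S_def of_real_sum complex_norm_square by (simp add: mult.commute)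
  have "wsq f z \<le> fock_const * gnorm2 f"
    unfolding f_def by (intro fock_square_le fock_sum fock_scale assms) auto
  also have "gnorm2 f \<le> (\<Sum>k<K. (norm (cnj (\<phi> k z)))\<^sup>2)"
    using assms(1) unfolding f_def bessel_family_def by fast
  also have "\<dots> = S" by (simp add: S_def)
  finally have "wsq f z \<le> fock_const * S"
    using fock_const_pos by simp
  then have "S * (S * gauss_weight z) \<le> S * fock_const"
    by (simp add: fz power2_eq_square mult_ac)
  then have "S * gauss_weight z \<le> fock_const"
    using S0 fock_const_pos by (cases "S = 0") auto
  then show ?thesis by (simp add: S_def sum_distrib_right)
qed

text \<open>In effect a trace bound: for the eigenfunctions it bounds all partial sums of the
  eigenvalues by a multiple of the measure of the set.\<close>

lemma bessel_restr_sum_le: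
  assumes "bessel_family K \<phi>" "\<And>k. k < K \<Longrightarrow> \<phi> k \<in> fock_space"
    and A: "A \<in> sets lebesgue" "emeasure lebesgue A < \<infinity>"
  shows "(\<Sum>k<K. gnorm2 (restr A (\<phi> k))) \<le> fock_const * measure lebesgue A"
proof -
  have i: "set_integrable lebesgue A (\<lambda>z. wsq (\<phi> k) z)" if "k < K" for k
    unfolding set_integrable_def using that A assms
    by (intro integrable_mult_indicator gauss_L2_integrable) auto
  have "(\<Sum>k<K. gnorm2 (restr A (\<phi> k))) = (LINT z:A|lebesgue. (\<Sum>k<K. wsq (\<phi> k) z))"
    unfolding gnorm2_restr_set_integral using i unfolding set_lebesgue_integral_def set_integrable_def
    by (subst Bochner_Integration.integral_sum[symmetric]) (auto simp: sum_distrib_left)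
  also have "\<dots> \<le> (LINT z:A|lebesgue. fock_const)"
  proof (rule set_integral_mono)
    show "set_integrable lebesgue A (\<lambda>z. \<Sum>k<K. wsq (\<phi> k) z)"
      using Bochner_Integration.integrable_sum[of "{..<K}" lebesgue "\<lambda>k z. indicator A z *\<^sub>R (wsq (\<phi> k) z)"] i
      unfolding set_integrable_def by (simp add: sum_distrib_left)
    show "set_integrable lebesgue A (\<lambda>z. fock_const)"
      unfolding set_integrable_def using A by auto
  qed (rule bessel_pointwise_le[OF assms(1,2)])
  also have "\<dots> = fock_const * measure lebesgue A"
    using A by (simp add: set_lebesgue_integral_def)
  finally show ?thesis .
qed

text \<open>The linear programming core of Ky Fan's maximum principle; \<open>a k i\<close> stands for
  \<open>\<bar>\<langle>\<phi> k, e i\<rangle>\<bar>\<^sup>2\<close> and \<open>\<mu>\<close> bounds the form off the span of the \<open>e i\<close>.\<close>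

lemma Ky_Fan_bound:
  fixes l :: "nat \<Rightarrow> real"
  assumes Q: "\<And>k. k < K \<Longrightarrow> Q k \<le> (\<Sum>i<K. l i * a k i) + \<mu> * (1 - (\<Sum>i<K. a k i))"
    and a: "\<And>i. i < K \<Longrightarrow> (\<Sum>k<K. a k i) \<le> 1"
    and l: "\<And>i. i < K \<Longrightarrow> \<mu> \<le> l i"
  shows "(\<Sum>k<K. Q k) \<le> (\<Sum>i<K. l i)"
proof -
  have "(\<Sum>k<K. Q k) \<le> (\<Sum>k<K. (\<Sum>i<K. l i * a k i) + \<mu> * (1 - (\<Sum>i<K. a k i)))"
    by (intro sum_mono Q) simp
  also have "\<dots> = (\<Sum>k<K. \<mu> + (\<Sum>i<K. (l i - \<mu>) * a k i))"
    by (simp add: algebra_simps sum_subtractf sum_distrib_left)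
  also have "\<dots> = K * \<mu> + (\<Sum>i<K. (l i - \<mu>) * (\<Sum>k<K. a k i))"
    by (simp add: sum.distrib sum_distrib_left) (rule sum.swap)
  also have "\<dots> \<le> K * \<mu> + (\<Sum>i<K. (l i - \<mu>) * 1)"
    using a l by (intro add_left_mono sum_mono mult_left_mono) auto
  also have "\<dots> = (\<Sum>i<K. l i)" by (simp add: sum_subtractf)
  finally show ?thesis .
qed

text \<open>For the full norm this would fail, since mass can escape to infinity; the finite measure
  of \<open>A\<close> prevents that. The proof polarises around the limit.\<close>

lemma fock_tendsto_restr:
  assumes f: "\<And>n. f n \<in> fock_space" and B: "\<And>n. gnorm2 (f n) \<le> B"
    and g: "g \<in> fock_space" "gnorm2 g \<le> B" and lim: "\<And>z. (\<lambda>n. f n z) \<longlonglongrightarrow> g z"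
    and A: "A \<in> sets lebesgue" "emeasure lebesgue A < \<infinity>"
  shows "(\<lambda>n. gnorm2 (restr A (f n))) \<longlonglongrightarrow> gnorm2 (restr A g)"
proof -
  have "gnorm2 (restr A (f n)) = gnorm2 (restr A (f n - g)) + 2 * Re (fock_inner (f n) (restr A g)) - gnorm2 (restr A g)" for n
  proof -
    have L: "restr A (f n) \<in> gauss_L2" "restr A g \<in> gauss_L2" using f g A by auto
    have "gnorm2 (restr A (f n - g)) = gnorm2 (restr A (f n)) + gnorm2 (restr A g) - 2 * Re (fock_inner (restr A (f n)) (restr A g))"
      unfolding restr_diff by (rule gnorm2_diff[OF L])
    then show ?thesis by (simp add: fock_inner_restr restr_restr)
  qed
  moreover have "(\<lambda>n. gnorm2 (restr A (f n - g)) + 2 * Re (fock_inner (f n) (restr A g)) - gnorm2 (restr A g))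
     \<longlonglongrightarrow> 0 + 2 * Re (fock_inner g (restr A g)) - gnorm2 (restr A g)"
    using g A by (intro tendsto_intros fock_tendsto_restr_diff[OF assms] fock_tendsto_inner[OF f B g lim]) auto
  moreover have "Re (fock_inner g (restr A g)) = gnorm2 (restr A g)"
    by (simp add: gnorm2_restr fock_inner_restr)
  ultimately show ?thesis by simp
qed

section \<open>Monomials and infinite dimension\<close>

text \<open>Comparison with a sum over discs: a point with norm between \<open>j\<close> and
  \<open>j + 1\<close> lies in the disc of radius \<open>j + 1\<close>, and there the function is at
  most its value at radius \<open>j\<close>. The areas grow only quadratically.\<close>

lemma integrable_exp_neg_norm_square: "integrable lebesgue (\<lambda>z::complex. exp (- (norm z)\<^sup>2))"
proof (rule integrableI_nonneg)
  show "(\<lambda>z::complex. exp (- (norm z)\<^sup>2)) \<in> borel_measurable lebesgue"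
    by (intro borel_measurable_lebesgue_continuous continuous_intros)
  have le_suminf: "F j \<le> (\<Sum>k. F k)" for F :: "nat \<Rightarrow> ennreal" and j
    using sum_le_suminf[OF summableI, of "{j}" F] by simp
  have "(\<integral>\<^sup>+z. ennreal (exp (- (norm (z::complex))\<^sup>2)) \<partial>lebesgue)
     \<le> (\<integral>\<^sup>+z. (\<Sum>j. ennreal (exp (- (real j)\<^sup>2)) * indicator (cball 0 (real (Suc j))) (z::complex)) \<partial>lebesgue)"
  proof (rule nn_integral_mono)
    fix z :: complex
    define j where "j = nat \<lfloor>norm z\<rfloor>"
    have j: "real j \<le> norm z" "norm z \<le> real (Suc j)"
      unfolding j_def by (auto simp: of_nat_nat) linarith
    have "ennreal (exp (- (norm z)\<^sup>2)) \<le> ennreal (exp (- (real j)\<^sup>2)) * indicator (cball 0 (real (Suc j))) z"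
      using j by (auto intro!: ennreal_leI power_mono)
    also have "\<dots> \<le> (\<Sum>j. ennreal (exp (- (real j)\<^sup>2)) * indicator (cball 0 (real (Suc j))) z)"
      by (rule le_suminf)
    finally show "ennreal (exp (- (norm z)\<^sup>2)) \<le> (\<Sum>j. ennreal (exp (- (real j)\<^sup>2)) * indicator (cball 0 (real (Suc j))) z)" .
  qed
  also have "\<dots> = (\<Sum>j. ennreal (exp (- (real j)\<^sup>2)) * emeasure lebesgue (cball 0 (real (Suc j)) :: complex set))"
    by (subst nn_integral_suminf)
       (simp_all add: nn_integral_cmult_indicator borel_measurable_times_ennreal borel_measurable_indicator del: of_nat_Suc)
  also have "\<dots> = (\<Sum>j. ennreal (exp (- (real j)\<^sup>2) * (pi * (real (Suc j))\<^sup>2)))"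
    by (simp add: emeasure_cball unit_ball_vol_2 ennreal_mult' del: of_nat_Suc)
  also have "\<dots> < \<infinity>"
  proof -
    have b: "exp (- (real j)\<^sup>2) * (pi * (real (Suc j))\<^sup>2) \<le> (8 * pi * exp (1/2)) * exp (- 1/2) ^ j" for j
    proof -
      \<comment> \<open>The quadratic Taylor term of the exponential at half of \<open>Suc j\<close>
        is the source of the 8; \<open>j \<le> j\<^sup>2\<close> then leaves a geometric
        majorant.\<close>
      have "(real (Suc j))\<^sup>2 / 8 \<le> exp (real (Suc j) / 2)"
        using exp_lower_Taylor_quadratic[of "real (Suc j) / 2"] by (simp add: power_divide del: of_nat_Suc)
      then have "exp (- (real j)\<^sup>2) * (pi * (real (Suc j))\<^sup>2) \<le> exp (- (real j)\<^sup>2) * (pi * (8 * exp (real (Suc j) / 2)))"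
        by (intro mult_left_mono) auto
      also have "\<dots> = 8 * pi * exp (1/2) * exp (real j / 2 - (real j)\<^sup>2)"
        by (simp add: exp_add[symmetric] exp_diff exp_minus field_simps)
      also have "\<dots> \<le> 8 * pi * exp (1/2) * exp (- real j / 2)"
      proof -
        have "real j \<le> (real j)\<^sup>2" by (cases j) (auto simp: power2_eq_square)
        then show ?thesis by (intro mult_left_mono) (auto simp: field_simps)
      qed
      also have "exp (- real j / 2) = exp (- 1/2) ^ j"
        by (simp add: exp_of_nat_mult[symmetric])
      finally show ?thesis .
    qed
    have "summable (\<lambda>j. (8 * pi * exp (1/2)) * exp (- 1/2 :: real) ^ j)"
      by (intro summable_mult summable_geometric) simp
    then have "summable (\<lambda>j. exp (- (real j)\<^sup>2) * (pi * (real (Suc j))\<^sup>2))"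
      by (rule summable_comparison_test'[where N=0]) (use b in \<open>auto simp del: of_nat_Suc\<close>)
    then show ?thesis
      by (subst suminf_ennreal2) (auto simp del: of_nat_Suc)
  qed
  finally show "(\<integral>\<^sup>+z. ennreal (exp (- (norm (z::complex))\<^sup>2)) \<partial>lebesgue) < \<infinity>" .
qed simp

lemma power_le_fact_exp:
  fixes x :: real assumes "x \<ge> 0" shows "x ^ n \<le> fact n * exp x"
proof -
  have "(\<lambda>k. x ^ k / fact k) sums exp x"
    using exp_converges[of x] by (simp add: divide_inverse mult.commute)
  then have "x ^ n / fact n \<le> exp x"
    using sum_le_suminf[of "\<lambda>k. x ^ k / fact k" "{n}"] assms by (simp add: sums_iff)
  then show ?thesis by (simp add: field_simps)
qed

text \<open>The squared power is at most \<open>fact n * exp ((norm z)\<^sup>2)\<close>, and since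
  \<open>pi\<close> exceeds 2 the weight absorbs this and leaves an integrable Gaussian.\<close>

lemma monomial_in_fock: "(\<lambda>z. z ^ n) \<in> fock_space"
proof (intro fock_spaceI)
  have m: "(\<lambda>z::complex. z ^ n) \<in> borel_measurable lebesgue"
    by (intro borel_measurable_lebesgue_continuous continuous_intros)
  have "integrable lebesgue (\<lambda>z::complex. (norm (z ^ n))\<^sup>2 * gauss_weight z)"
  proof (rule Bochner_Integration.integrable_bound)
    show "integrable lebesgue (\<lambda>z::complex. fact n * exp (- (norm z)\<^sup>2))"
      by (intro integrable_mult_right integrable_exp_neg_norm_square)
    show "(\<lambda>z::complex. (norm (z ^ n))\<^sup>2 * gauss_weight z) \<in> borel_measurable lebesgue"
      using m by measurable
    have "(norm (z ^ n))\<^sup>2 * gauss_weight z \<le> fact n * exp (- (norm z)\<^sup>2)" for z :: complex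
    proof -
      have "(norm (z ^ n))\<^sup>2 = ((norm z)\<^sup>2) ^ n" by (simp add: norm_power power_mult[symmetric] mult.commute)
      also have "\<dots> \<le> fact n * exp ((norm z)\<^sup>2)" by (rule power_le_fact_exp) simp
      finally have "(norm (z ^ n))\<^sup>2 * gauss_weight z \<le> fact n * exp ((norm z)\<^sup>2) * gauss_weight z"
        by (rule mult_right_mono) simp
      also have "\<dots> = fact n * exp ((norm z)\<^sup>2 - pi * (norm z)\<^sup>2)"
        by (simp add: gauss_weight_def exp_add[symmetric])
      also have "\<dots> \<le> fact n * exp (- (norm z)\<^sup>2)"
      proof -
        have "2 * (norm z)\<^sup>2 \<le> pi * (norm z)\<^sup>2" using pi_gt3 by (intro mult_right_mono) auto
        then show ?thesis by simp
      qed
      finally show ?thesis .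
    qed
    then show "AE z::complex in lebesgue. norm ((norm (z ^ n))\<^sup>2 * gauss_weight z) \<le> norm (fact n * exp (- (norm z)\<^sup>2))"
      by auto
  qed
  with m show "(\<lambda>z. z ^ n) \<in> gauss_L2" by (simp add: gauss_L2_def)
qed (intro holomorphic_intros)

text \<open>Makes the Fock space infinite-dimensional. Injectivity is stated as well because the
  dimension count in \<open>fock_perp_nontrivial\<close> needs the cardinality of this set of
  functions.\<close>

lemma independent_monomials: "cfun.independent ((\<lambda>n z. z ^ n) ` {..N::nat})"
  and inj_monomials: "inj (\<lambda>(n::nat) (z::complex). z ^ n)"
proof -
  show inj: "inj (\<lambda>(n::nat) (z::complex). z ^ n)"
  proof (rule injI)
    fix m n :: nat assume "(\<lambda>z::complex. z ^ m) = (\<lambda>z. z ^ n)"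
    then have "(2::complex) ^ m = 2 ^ n" by (rule fun_cong)
    then have "(2::real) ^ m = 2 ^ n" by (metis norm_numeral norm_power)
    then show "m = n" by simp
  qed
  show "cfun.independent ((\<lambda>n z. z ^ n) ` {..N})"
  proof (subst cfun.dependent_finite, simp, safe)
    fix u n assume s: "(\<Sum>v\<in>(\<lambda>n z. z ^ n) ` {..N}. u v \<odot> v) = 0" and n: "n \<le> N" "u (\<lambda>z. z ^ n) \<noteq> 0"
    have "(\<Sum>k\<le>N. u (\<lambda>z. z ^ k) * z ^ k) = 0" for z
    proof -
      have "(\<Sum>v\<in>(\<lambda>n z. z ^ n) ` {..N}. u v \<odot> v) = (\<Sum>k\<le>N. u (\<lambda>z. z ^ k) \<odot> (\<lambda>z. z ^ k))"
        using inj by (subst sum.reindex) (auto simp: inj_on_def inj_def)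
      with s have "(\<Sum>k\<le>N. u (\<lambda>z. z ^ k) \<odot> (\<lambda>z. z ^ k)) z = 0" by simp
      then show ?thesis by (simp add: sum_fun_apply)
    qed
    then have "u (\<lambda>z. z ^ n) = 0" using polyfun_eq_0[of "\<lambda>k. u (\<lambda>z. z ^ k)" N] n(1) by simp
    with n show False by simp
  qed
qed

subsection \<open>Eigenvalues of the localization operator\<close>

definition orthonormal_set :: "(complex \<Rightarrow> complex) set \<Rightarrow> bool" where
  "orthonormal_set S \<longleftrightarrow> S \<subseteq> fock_space \<and> (\<forall>f\<in>S. \<forall>g\<in>S. fock_inner f g = (if f = g then 1 else 0))"

definition fock_perp :: "(complex \<Rightarrow> complex) set \<Rightarrow> (complex \<Rightarrow> complex) set" where
  "fock_perp S = {f \<in> fock_space. \<forall>e\<in>S. fock_inner f e = 0}"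

lemma fock_perp_fock [intro]: "f \<in> fock_perp S \<Longrightarrow> f \<in> fock_space"
  and fock_perp_inner: "f \<in> fock_perp S \<Longrightarrow> e \<in> S \<Longrightarrow> fock_inner f e = 0"
  by (auto simp: fock_perp_def)

lemma fock_perp_diff_scale:
  assumes "S \<subseteq> fock_space" "f \<in> fock_perp S" "g \<in> fock_perp S"
  shows "f - c \<odot> g \<in> fock_perp S"
proof -
  have "fock_inner (f - c \<odot> g) e = 0" if "e \<in> S" for e
  proof -
    have "e \<in> fock_space" "f \<in> fock_space" "g \<in> fock_space" using assms that by (auto simp: fock_perp_def)
    then show ?thesis
      using assms that by (simp add: fock_inner_diff_left fock_inner_scale_left gauss_L2_scale fock_perp_def)
  qed
  moreover have "f - c \<odot> g \<in> fock_space" using assms by (auto simp: fock_perp_def)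
  ultimately show ?thesis by (simp add: fock_perp_def)
qed

lemma fock_perp_scale: "f \<in> fock_perp S \<Longrightarrow> c \<odot> f \<in> fock_perp S"
  by (auto simp: fock_perp_def fock_inner_scale_left)

lemma fock_perp_residual:
  assumes S: "orthonormal_set S" "finite S" and f: "f \<in> fock_space"
  shows "f - (\<Sum>e\<in>S. fock_inner f e \<odot> e) \<in> fock_perp S"
proof -
  have SF: "\<And>e. e \<in> S \<Longrightarrow> e \<in> fock_space" using S by (auto simp: orthonormal_set_def)
  then have sum: "(\<Sum>e\<in>S. fock_inner f e \<odot> e) \<in> fock_space" by (intro fock_sum fock_scale) auto
  have "fock_inner (f - (\<Sum>e\<in>S. fock_inner f e \<odot> e)) d = 0" if d: "d \<in> S" for d
  proof -
    have "fock_inner (\<Sum>e\<in>S. fock_inner f e \<odot> e) d = (\<Sum>e\<in>S. fock_inner f e * fock_inner e d)"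
      using SF d by (subst fock_inner_sum_left) (auto simp: fock_inner_scale_left)
    also have "\<dots> = (\<Sum>e\<in>S. if e = d then fock_inner f d else 0)"
      using S d by (intro sum.cong refl) (auto simp: orthonormal_set_def)
    also have "\<dots> = fock_inner f d" using S d by (simp add: sum.delta)
    finally show ?thesis using f sum SF[OF d] by (simp add: fock_inner_diff_left)
  qed
  moreover have "f - (\<Sum>e\<in>S. fock_inner f e \<odot> e) \<in> fock_space" using f sum by auto
  ultimately show ?thesis by (simp add: fock_perp_def)
qed

text \<open>If the complement were trivial, every element would equal its projection onto the span
  of \<open>S\<close>, and that span would contain \<open>card S + 1\<close> independent
  monomials.\<close>

lemma fock_perp_nontrivial:
  assumes S: "orthonormal_set S" "finite S"
  shows "\<exists>f\<in>fock_perp S. f \<noteq> 0"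
proof (rule ccontr)
  assume "\<not> ?thesis"
  then have z: "f = 0" if "f \<in> fock_perp S" for f using that by blast
  have "f \<in> cfun.span S" if "f \<in> fock_space" for f
  proof -
    have "f = (\<Sum>e\<in>S. fock_inner f e \<odot> e)"
      using z[OF fock_perp_residual[OF S that]] by simp
    also have "\<dots> \<in> cfun.span S" by (intro cfun.span_sum cfun.span_scale cfun.span_base)
    finally show ?thesis .
  qed
  then have "(\<lambda>n z. z ^ n) ` {..card S} \<subseteq> cfun.span S" using monomial_in_fock by auto
  then have "card ((\<lambda>n (z::complex). z ^ n) ` {..card S}) \<le> card S"
    using cfun.independent_span_bound[OF S(2) independent_monomials] by blast
  moreover have "card ((\<lambda>n (z::complex). z ^ n) ` {..card S}) = card {..card S}"
    by (intro card_image inj_on_subset[OF inj_monomials]) auto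
  ultimately show False by simp
qed

section \<open>Variational construction of the eigenfunctions\<close>

locale localization =
  fixes \<Omega> :: "complex set"
  assumes \<Omega>_sets: "\<Omega> \<in> sets lebesgue" and \<Omega>_pos: "emeasure lebesgue \<Omega> > 0"
    and \<Omega>_finite: "emeasure lebesgue \<Omega> < \<infinity>"
begin

definition energy :: "(complex \<Rightarrow> complex) \<Rightarrow> real" where "energy f = gnorm2 (restr \<Omega> f)"

lemma energy_nonneg: "energy f \<ge> 0"
  by (simp add: energy_def)

lemma energy_le: "f \<in> gauss_L2 \<Longrightarrow> energy f \<le> gnorm2 f"
  unfolding energy_def by (rule gnorm2_restr_le[OF _ \<Omega>_sets])

lemma energy_scale: "energy (c \<odot> f) = (norm c)\<^sup>2 * energy f"
  by (simp add: energy_def restr_scale)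

lemma restr_\<Omega>_L2 [intro, simp]: "f \<in> gauss_L2 \<Longrightarrow> restr \<Omega> f \<in> gauss_L2"
  using \<Omega>_sets by auto

text \<open>The zeros of a nonzero entire function form a null set, so a set of positive measure
  detects it. Constants are treated apart, as countability of the zeros is available for nonconstant
  functions.\<close>

lemma energy_pos:
  assumes f: "f \<in> fock_space" "f \<noteq> 0"
  shows "energy f > 0"
proof (rule ccontr)
  assume "\<not> energy f > 0"
  then have "energy f = 0" using energy_nonneg[of f] by linarith
  then have "(LINT z|lebesgue. wsq (restr \<Omega> f) z) = 0"
    by (simp add: energy_def gnorm2_def)
  moreover have "integrable lebesgue (\<lambda>z. wsq (restr \<Omega> f) z)"
    using f by (intro gauss_L2_integrable) auto
  ultimately have "AE z in lebesgue. wsq (restr \<Omega> f) z = 0"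
    by (subst (asm) integral_nonneg_eq_0_iff_AE) auto
  then have ae: "AE z in lebesgue. z \<in> \<Omega> \<longrightarrow> f z = 0"
    by (rule AE_mp) (auto simp: restr_def indicator_def)
  have "countable {z\<in>UNIV. f z = 0}"
  proof (rule holomorphic_countable_zeros)
    show "f holomorphic_on UNIV" by (rule fock_holomorphic[OF f(1)])
    show "\<not> f constant_on UNIV"
    proof
      assume "f constant_on UNIV"
      then obtain c where c: "f = (\<lambda>_. c)" by (auto simp: constant_on_def)
      with f(2) have "c \<noteq> 0" by (auto simp: zero_fun_def)
      have "AE z in lebesgue. z \<notin> \<Omega>"
        using ae by eventually_elim (use c \<open>c \<noteq> 0\<close> in auto)
      then have "emeasure lebesgue \<Omega> = 0"
        using AE_iff_measurable[OF \<Omega>_sets, of "\<lambda>z. z \<notin> \<Omega>"] by auto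
      with \<Omega>_pos show False by simp
    qed
  qed auto
  then have "{z. f z = 0} \<in> null_sets lebesgue"
    using countable_imp_null_set_lborel[of "{z. f z = 0}"] null_sets_completionI[of "{z. f z = 0}" lborel] by simp
  then have "AE z in lebesgue. f z \<noteq> 0"
    by (rule AE_I') auto
  with ae have "AE z in lebesgue. z \<notin> \<Omega>" by eventually_elim auto
  then have "emeasure lebesgue \<Omega> = 0"
    using AE_iff_measurable[OF \<Omega>_sets, of "\<lambda>z. z \<notin> \<Omega>"] by auto
  with \<Omega>_pos show False by simp
qed

text \<open>The direct method, run on the unit ball because the unit sphere is not closed under
  pointwise limits. The supremum is positive, and comparing it with the energy of the limit forces
  the limit to have norm 1 after all.\<close>

lemma energy_maximiser:
  assumes S: "orthonormal_set S" "finite S"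
  shows "\<exists>f\<in>fock_perp S. gnorm2 f = 1 \<and> (\<forall>g\<in>fock_perp S. energy g \<le> energy f * gnorm2 g)"
proof -
  have SF: "S \<subseteq> fock_space" using S by (simp add: orthonormal_set_def)
  define D where "D = {g \<in> fock_perp S. gnorm2 g \<le> 1}"
  define \<sigma> where "\<sigma> = (SUP g\<in>D. energy g)"
  have "energy g \<le> 1" if "g \<in> D" for g
    using energy_le[of g] that by (auto simp: D_def fock_perp_def)
  then have bdd: "bdd_above (energy ` D)" by (rule bdd_aboveI2)
  have normalised: "\<exists>c::complex. c \<noteq> 0 \<and> (norm c)\<^sup>2 * gnorm2 g = 1" if "g \<in> fock_space" "g \<noteq> 0" for g
  proof -
    have "gnorm2 g > 0" using that fock_zero_iff[of g] gnorm2_nonneg[of g] by (metis order_le_less)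
    then have "complex_of_real (1 / sqrt (gnorm2 g)) \<noteq> 0 \<and> (norm (complex_of_real (1 / sqrt (gnorm2 g))))\<^sup>2 * gnorm2 g = 1"
      by (simp add: power_divide norm_divide)
    then show ?thesis by blast
  qed
  obtain g0 where g0: "g0 \<in> fock_perp S" "g0 \<noteq> 0" using fock_perp_nontrivial[OF S] by blast
  then obtain c0 :: complex where c0: "c0 \<noteq> 0" "(norm c0)\<^sup>2 * gnorm2 g0 = 1" using normalised by blast
  have D0: "c0 \<odot> g0 \<in> D" using g0 c0 by (simp add: D_def fock_perp_scale)
  have "0 < energy (c0 \<odot> g0)"
    using energy_pos[OF fock_perp_fock[OF g0(1)] g0(2)] c0(1) by (simp add: energy_scale)
  also have "\<dots> \<le> \<sigma>" unfolding \<sigma>_def by (rule cSUP_upper[OF D0 bdd])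
  finally have pos: "\<sigma> > 0" .
  have ne: "D \<noteq> {}" using D0 by auto
  have "\<exists>g\<in>D. \<sigma> - 1 / real (Suc n) < energy g" for n
    using less_cSUP_iff[OF ne bdd, of "\<sigma> - 1 / real (Suc n)"] by (simp add: \<sigma>_def)
  then obtain g where g: "\<And>n. g n \<in> D" "\<And>n. \<sigma> - 1 / real (Suc n) < energy (g n)" by metis
  have gF: "g n \<in> fock_space" "gnorm2 (g n) \<le> 1" for n using g(1)[of n] by (auto simp: D_def fock_perp_def)
  obtain f r where f: "f \<in> fock_space" "gnorm2 f \<le> 1" "strict_mono (r :: nat \<Rightarrow> nat)" "\<And>z. (\<lambda>n. g (r n) z) \<longlonglongrightarrow> f z"
    using fock_bounded_subsequence[of g 1, OF gF] by blast
  have "fock_inner f e = 0" if e: "e \<in> S" for e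
  proof (rule LIMSEQ_unique)
    show "(\<lambda>n. fock_inner (g (r n)) e) \<longlonglongrightarrow> fock_inner f e"
      using e SF by (intro fock_tendsto_inner[of "\<lambda>n. g (r n)" 1] gF f) auto
    have "fock_inner (g (r n)) e = 0" for n using g(1)[of "r n"] e by (auto simp: D_def fock_perp_def)
    then show "(\<lambda>n. fock_inner (g (r n)) e) \<longlonglongrightarrow> 0" by simp
  qed
  then have fP: "f \<in> fock_perp S" using f by (simp add: fock_perp_def)
  have "(\<lambda>n. energy (g (r n))) \<longlonglongrightarrow> energy f"
    unfolding energy_def by (intro fock_tendsto_restr[of "\<lambda>n. g (r n)" 1] gF f \<Omega>_sets \<Omega>_finite)
  moreover have "(\<lambda>n. \<sigma> - 1 / real (Suc (r n))) \<longlonglongrightarrow> \<sigma> - 0"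
    using LIMSEQ_subseq_LIMSEQ[OF LIMSEQ_Suc[OF lim_1_over_n] f(3)]
    by (intro tendsto_intros) (simp add: comp_def)
  ultimately have ge: "\<sigma> \<le> energy f"
    using g(2) by (intro LIMSEQ_le) (auto intro: less_imp_le)
  have hom: "energy h \<le> \<sigma> * gnorm2 h" if h: "h \<in> fock_perp S" for h
  proof (cases "h = 0")
    case False
    then obtain c :: complex where c: "c \<noteq> 0" "(norm c)\<^sup>2 * gnorm2 h = 1" using normalised h by blast
    then have "c \<odot> h \<in> D" using h by (simp add: D_def fock_perp_scale)
    then have "(norm c)\<^sup>2 * energy h \<le> \<sigma>"
      unfolding \<sigma>_def energy_scale[symmetric] by (rule cSUP_upper[OF _ bdd])
    also have "\<sigma> = (norm c)\<^sup>2 * (\<sigma> * gnorm2 h)" using c(2) by (simp add: mult_ac)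
    finally show ?thesis using c(1) by simp
  qed (simp add: energy_def gnorm2_def restr_def)
  have "energy f \<le> \<sigma> * gnorm2 f" by (rule hom[OF fP])
  also have "\<dots> \<le> \<sigma> * 1" using f(2) pos by (intro mult_left_mono) auto
  finally have eq: "energy f = \<sigma>" using ge by simp
  with hom[OF fP] pos f(2) have "gnorm2 f = 1" by simp
  with fP hom eq show ?thesis by auto
qed

definition next_eigenfunction :: "(complex \<Rightarrow> complex) set \<Rightarrow> complex \<Rightarrow> complex" where
  "next_eigenfunction S = (SOME f. f \<in> fock_perp S \<and> gnorm2 f = 1 \<and>
     (\<forall>g\<in>fock_perp S. energy g \<le> energy f * gnorm2 g))"

text \<open>The recursion builds the sets of eigenfunctions rather than the functions, since each
  choice depends on all the earlier ones.\<close>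

primrec eigenset :: "nat \<Rightarrow> (complex \<Rightarrow> complex) set" where
  "eigenset 0 = {}"
| "eigenset (Suc n) = insert (next_eigenfunction (eigenset n)) (eigenset n)"

definition eigenfun :: "nat \<Rightarrow> complex \<Rightarrow> complex" where
  "eigenfun n = next_eigenfunction (eigenset n)"

definition eigenval :: "nat \<Rightarrow> real" where "eigenval n = energy (eigenfun n)"

lemma eigenset_eq: "eigenset n = eigenfun ` {..<n}"
  by (induction n) (auto simp: eigenfun_def lessThan_Suc)

lemma finite_eigenset: "finite (eigenset n)"
  by (simp add: eigenset_eq)

text \<open>A joint induction: a maximiser is known to exist only over an orthonormal set, and
  orthonormality of the next set comes from the maximiser.\<close>

lemma eigenfun_aux:
  "orthonormal_set (eigenset n) \<and> eigenfun n \<in> fock_perp (eigenset n) \<and> gnorm2 (eigenfun n) = 1 \<and>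
     (\<forall>g\<in>fock_perp (eigenset n). energy g \<le> eigenval n * gnorm2 g)"
proof (induction n)
  have step: "eigenfun n \<in> fock_perp (eigenset n) \<and> gnorm2 (eigenfun n) = 1 \<and>
     (\<forall>g\<in>fock_perp (eigenset n). energy g \<le> eigenval n * gnorm2 g)" if "orthonormal_set (eigenset n)" for n
    using someI_ex[OF energy_maximiser[OF that finite_eigenset, unfolded Bex_def]]
    unfolding eigenval_def eigenfun_def next_eigenfunction_def by simp
  case 0
  show ?case using step[of 0] by (auto simp: orthonormal_set_def)
  case (Suc n)
  then have IH: "orthonormal_set (eigenset n)" "eigenfun n \<in> fock_perp (eigenset n)" "gnorm2 (eigenfun n) = 1" by auto
  have "fock_inner (eigenfun n) (eigenfun n) = 1" using IH(3) by (simp add: fock_inner_self)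
  moreover have "fock_inner (eigenfun n) g = 0" "fock_inner g (eigenfun n) = 0" if "g \<in> eigenset n" for g
    using fock_perp_inner[OF IH(2) that] fock_inner_commute[of g "eigenfun n"] by auto
  moreover have "eigenfun n \<notin> eigenset n"
    using calculation by auto
  ultimately have "orthonormal_set (eigenset (Suc n))"
    using IH(1,2) unfolding orthonormal_set_def by (auto simp: eigenfun_def[symmetric] fock_perp_def)
  then show ?case using step by blast
qed

lemma eigenfun_fock [intro, simp]: "eigenfun n \<in> fock_space"
  using eigenfun_aux[of n] by (auto simp: fock_perp_def)

lemma eigenfun_orthonormal: "fock_inner (eigenfun j) (eigenfun k) = (if j = k then 1 else 0)"
proof -
  have less: "fock_inner (eigenfun k) (eigenfun j) = 0" if "j < k" for j k
    using eigenfun_aux[of k] that by (auto simp: fock_perp_def eigenset_eq)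
  show ?thesis
    using less[of j k] less[of k j] eigenfun_aux[of j] fock_inner_commute[of "eigenfun j" "eigenfun k"]
    by (cases j k rule: linorder_cases) (auto simp: fock_inner_self)
qed

lemma inj_eigenfun: "inj eigenfun"
  by (rule injI) (metis eigenfun_orthonormal zero_neq_one)

lemma orthonormal_family_eigenfun: "orthonormal_family K eigenfun"
  by (simp add: orthonormal_family_def eigenfun_orthonormal)

lemma energy_le_eigenval:
  assumes "g \<in> fock_space" "\<And>j. j < n \<Longrightarrow> fock_inner g (eigenfun j) = 0"
  shows "energy g \<le> eigenval n * gnorm2 g"
  using eigenfun_aux[of n] assms by (auto simp: fock_perp_def eigenset_eq)

lemma eigenval_pos: "eigenval n > 0"
proof -
  have "eigenfun n \<noteq> 0" using eigenfun_orthonormal[of n n] by auto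
  then show ?thesis unfolding eigenval_def by (intro energy_pos) auto
qed

text \<open>The maximiser under more orthogonality constraints also competes in the problem with
  fewer.\<close>

lemma eigenval_antimono: "antimono eigenval"
proof (rule decseq_SucI)
  fix n
  have "energy (eigenfun (Suc n)) \<le> eigenval n * gnorm2 (eigenfun (Suc n))"
    by (rule energy_le_eigenval) (auto simp: eigenfun_orthonormal)
  then show "eigenval (Suc n) \<le> eigenval n"
    using eigenfun_aux[of "Suc n"] by (simp add: eigenval_def[of "Suc n"])
qed

text \<open>On the orthogonal complement of the earlier eigenfunctions the form
  \<open>\<lambda>\<^sub>n \<parallel>f\<parallel>\<^sup>2 - energy f\<close> is nonnegative and vanishes at \<open>eigenfun n\<close>, hence so does its polar form.\<close>

lemma eigenfun_perp_eq:
  assumes g: "g \<in> fock_perp (eigenset n)"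
  shows "fock_inner (restr \<Omega> (eigenfun n)) g = eigenval n * fock_inner (eigenfun n) g"
proof -
  define f where "f = eigenfun n"
  have f: "f \<in> fock_perp (eigenset n)" "gnorm2 f = 1" using eigenfun_aux[of n] by (auto simp: f_def)
  have SF: "eigenset n \<subseteq> fock_space" by (auto simp: eigenset_eq)
  have L: "f \<in> gauss_L2" "g \<in> gauss_L2" using f g by (auto simp: fock_perp_def)
  define x where "x = eigenval n * fock_inner f g - fock_inner (restr \<Omega> f) g"
  have "0 \<le> t\<^sup>2 * ((norm x)\<^sup>2 * (eigenval n * gnorm2 g - energy g)) - 2 * t * (norm x)\<^sup>2" for t :: real
  proof -
    define c where "c = of_real t * x"
    have "f - c \<odot> g \<in> fock_perp (eigenset n)" by (intro fock_perp_diff_scale SF f g)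
    then have "0 \<le> eigenval n * gnorm2 (f - c \<odot> g) - energy (f - c \<odot> g)"
      using eigenfun_aux[of n] by simp
    also have "energy (f - c \<odot> g) = energy f + (norm c)\<^sup>2 * energy g - 2 * Re (cnj c * fock_inner (restr \<Omega> f) g)"
      unfolding energy_def restr_diff restr_scale
      by (subst gnorm2_diff_scale) (use L in \<open>auto simp: fock_inner_restr2\<close>)
    also have "gnorm2 (f - c \<odot> g) = gnorm2 f + (norm c)\<^sup>2 * gnorm2 g - 2 * Re (cnj c * fock_inner f g)"
      by (rule gnorm2_diff_scale[OF L])
    also have "energy f = eigenval n" by (simp add: f_def eigenval_def)
    finally have "0 \<le> (norm c)\<^sup>2 * (eigenval n * gnorm2 g - energy g) - 2 * Re (cnj c * x)"
      using f(2) by (simp add: x_def algebra_simps)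
    also have "cnj c * x = of_real (t * (norm x)\<^sup>2)"
      unfolding c_def using complex_norm_square[of x] by (simp add: mult_ac)
    finally show ?thesis unfolding Re_complex_of_real by (simp add: c_def norm_mult power_mult_distrib mult_ac)
  qed
  then have "(norm x)\<^sup>2 = 0" by (rule quadratic_nonneg_imp_zero)
  then show ?thesis by (simp add: x_def f_def)
qed

text \<open>Extends \<open>eigenfun_perp_eq\<close> to all test functions. The missing directions
  are the earlier eigenfunctions, where self-adjointness and the induction hypothesis make both
  sides vanish.\<close>

lemma eigenfun_eq:
  assumes "g \<in> fock_space"
  shows "fock_inner (restr \<Omega> (eigenfun n)) g = eigenval n * fock_inner (eigenfun n) g"
  using assms
proof (induction n arbitrary: g rule: less_induct)
  case (less n)
  have early: "fock_inner (restr \<Omega> (eigenfun n)) (eigenfun j) = eigenval n * fock_inner (eigenfun n) (eigenfun j)" if "j < n" for j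
  proof -
    have "fock_inner (restr \<Omega> (eigenfun n)) (eigenfun j) = cnj (fock_inner (restr \<Omega> (eigenfun j)) (eigenfun n))"
      by (metis fock_inner_commute fock_inner_restr)
    also have "\<dots> = 0" using less.IH[OF that, of "eigenfun n"] that by (simp add: eigenfun_orthonormal)
    finally show ?thesis using that by (simp add: eigenfun_orthonormal)
  qed
  define s where "s = (\<Sum>e\<in>eigenset n. fock_inner g e \<odot> e)"
  have sF: "s \<in> fock_space" unfolding s_def by (auto simp: eigenset_eq)
  have p: "g - s \<in> fock_perp (eigenset n)"
    unfolding s_def using eigenfun_aux[of n] by (intro fock_perp_residual finite_eigenset less.prems) auto
  have "fock_inner (restr \<Omega> (eigenfun n)) s = eigenval n * fock_inner (eigenfun n) s"
  proof -
    have "fock_inner (restr \<Omega> (eigenfun n)) s = (\<Sum>e\<in>eigenset n. fock_inner (restr \<Omega> (eigenfun n)) (fock_inner g e \<odot> e))"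
      unfolding s_def by (rule fock_inner_sum_right) (auto simp: eigenset_eq)
    also have "\<dots> = (\<Sum>e\<in>eigenset n. eigenval n * fock_inner (eigenfun n) (fock_inner g e \<odot> e))"
      by (intro sum.cong refl) (auto simp: fock_inner_scale_right eigenset_eq early)
    also have "\<dots> = eigenval n * fock_inner (eigenfun n) s"
      unfolding s_def sum_distrib_left[symmetric]
      by (subst fock_inner_sum_right) (auto simp: eigenset_eq)
    finally show ?thesis .
  qed
  moreover have "fock_inner (restr \<Omega> (eigenfun n)) (g - s) = eigenval n * fock_inner (eigenfun n) (g - s)"
    by (rule eigenfun_perp_eq[OF p])
  moreover have "fock_inner u g = fock_inner u s + fock_inner u (g - s)" if "u \<in> gauss_L2" for u
    using that less.prems sF by (simp add: fock_inner_diff_right)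
  ultimately show ?case by (simp add: distrib_left)
qed

lemma eigenval_sum_le: "(\<Sum>k<K. eigenval k) \<le> fock_const * measure lebesgue \<Omega>"
  unfolding eigenval_def energy_def
  by (rule bessel_restr_sum_le[OF orthonormal_imp_bessel[OF orthonormal_family_eigenfun] _ \<Omega>_sets \<Omega>_finite]) simp

text \<open>For a nonincreasing sequence, bounded partial sums force decay of order 1/n.\<close>

lemma eigenval_le: "eigenval n \<le> fock_const * measure lebesgue \<Omega> / real (Suc n)"
proof -
  have "real (Suc n) * eigenval n = (\<Sum>k<Suc n. eigenval n)" by simp
  also have "\<dots> \<le> (\<Sum>k<Suc n. eigenval k)"
    using eigenval_antimono by (intro sum_mono) (auto simp: antimono_def)
  also have "\<dots> \<le> fock_const * measure lebesgue \<Omega>" by (rule eigenval_sum_le)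
  finally show ?thesis by (simp add: pos_le_divide_eq mult.commute del: of_nat_Suc)
qed

lemma eigenval_tendsto_0: "eigenval \<longlonglongrightarrow> 0"
proof (rule tendsto_sandwich[OF _ _ tendsto_const])
  show "(\<lambda>n. fock_const * measure lebesgue \<Omega> / real (Suc n)) \<longlonglongrightarrow> 0"
    by (rule LIMSEQ_Suc[OF lim_const_over_n])
qed (auto intro!: always_eventually less_imp_le[OF eigenval_pos] eigenval_le simp del: of_nat_Suc)

lemma finite_eigenval_eq: "\<mu> \<noteq> 0 \<Longrightarrow> finite {k. complex_of_real (eigenval k) = \<mu>}"
proof (rule ccontr)
  assume m: "\<mu> \<noteq> 0" and inf: "infinite {k. complex_of_real (eigenval k) = \<mu>}"
  have "(\<lambda>k. complex_of_real (eigenval k)) \<longlonglongrightarrow> of_real 0" by (intro tendsto_of_real eigenval_tendsto_0)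
  then have "\<forall>\<^sub>F k in sequentially. complex_of_real (eigenval k) \<noteq> \<mu>"
    using m by (intro tendsto_imp_eventually_ne) auto
  then obtain N where N: "\<And>k. k \<ge> N \<Longrightarrow> complex_of_real (eigenval k) \<noteq> \<mu>" by (auto simp: eventually_sequentially)
  have "k < N" if "complex_of_real (eigenval k) = \<mu>" for k
    using N[of k] that by (meson not_le)
  then have "{k. complex_of_real (eigenval k) = \<mu>} \<subseteq> {..<N}" by blast
  with inf show False using finite_subset by blast
qed

section \<open>Eigenspaces and the eigenvalue list\<close>

lemma toeplitz_eq: "toeplitz \<Omega> f = fock_proj (restr \<Omega> f)"
  by (simp add: toeplitz_def restr_def)

text \<open>The weak form of the eigenvalue equation: tested against the Fock space, the projection
  disappears.\<close>

lemma eigenspace_iff: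
  "f \<in> fock_eigenspace (toeplitz \<Omega>) \<mu> \<longleftrightarrow>
     f \<in> fock_space \<and> (\<forall>g\<in>fock_space. fock_inner (restr \<Omega> f) g = \<mu> * fock_inner f g)"
proof (cases "f \<in> fock_space")
  case True
  then have L: "restr \<Omega> f \<in> gauss_L2" by auto
  have "fock_proj (restr \<Omega> f) = \<mu> \<odot> f \<longleftrightarrow> (\<forall>g\<in>fock_space. fock_inner (restr \<Omega> f) g = fock_inner (\<mu> \<odot> f) g)"
    using fock_inner_proj[OF L] fock_proj_eqI[OF L, of "\<mu> \<odot> f"] True by auto
  then show ?thesis using True by (simp add: fock_eigenspace_def toeplitz_eq fock_inner_scale_left)
qed (simp add: fock_eigenspace_def)

lemma eigenfun_in_eigenspace: "eigenfun n \<in> fock_eigenspace (toeplitz \<Omega>) (of_real (eigenval n))"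
  by (simp add: eigenspace_iff eigenfun_eq)

text \<open>For the inclusion from left to right, subtract from an eigenvector its part in the span.
  The rest is orthogonal to every eigenfunction, also to those with other eigenvalues, so its energy
  is at most \<open>eigenval n\<close> times its squared norm for every \<open>n\<close>. As the
  eigenvalues tend to 0, \<open>energy_pos\<close> makes it zero.\<close>

lemma eigenspace_eq_span:
  assumes "\<mu> \<noteq> 0"
  shows "fock_eigenspace (toeplitz \<Omega>) \<mu> = cfun.span (eigenfun ` {k. complex_of_real (eigenval k) = \<mu>})"
    (is "?E = cfun.span (eigenfun ` ?J)")
proof
  have "cfun.subspace ?E"
    unfolding cfun.subspace_def
  proof (intro conjI ballI allI)
    show "0 \<in> ?E" by (simp add: eigenspace_iff) (simp add: restr_def zero_fun_def fock_inner_def)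
    show "f + g \<in> ?E" if "f \<in> ?E" "g \<in> ?E" for f g
      using that by (auto simp: eigenspace_iff restr_add fock_inner_add_left algebra_simps)
    show "c \<odot> f \<in> ?E" if "f \<in> ?E" for c f
      using that by (auto simp: eigenspace_iff restr_scale fock_inner_scale_left)
  qed
  then show "cfun.span (eigenfun ` ?J) \<subseteq> ?E"
    using eigenfun_in_eigenspace by (intro cfun.span_minimal) auto
  show "?E \<subseteq> cfun.span (eigenfun ` ?J)"
  proof
    fix f assume fE: "f \<in> ?E"
    then have f: "f \<in> fock_space" "\<And>g. g \<in> fock_space \<Longrightarrow> fock_inner (restr \<Omega> f) g = \<mu> * fock_inner f g"
      by (auto simp: eigenspace_iff)
    define S where "S = eigenfun ` ?J"
    have S: "orthonormal_set S" "finite S"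
      using finite_eigenval_eq[OF assms]
      by (auto simp: S_def orthonormal_set_def eigenfun_orthonormal inj_eq[OF inj_eigenfun])
    define s where "s = (\<Sum>e\<in>S. fock_inner f e \<odot> e)"
    have sF: "s \<in> fock_space" unfolding s_def by (auto simp: S_def)
    have p: "f - s \<in> fock_perp S" unfolding s_def by (rule fock_perp_residual[OF S f(1)])
    have orth: "fock_inner (f - s) (eigenfun k) = 0" for k
    proof (cases "k \<in> ?J")
      case True
      then show ?thesis using p by (auto simp: fock_perp_def S_def)
    next
      case False
      have "\<mu> * fock_inner f (eigenfun k) = fock_inner (restr \<Omega> f) (eigenfun k)" using f(2) by simp
      also have "\<dots> = cnj (fock_inner (restr \<Omega> (eigenfun k)) f)"
        by (metis fock_inner_commute fock_inner_restr)
      also have "\<dots> = eigenval k * fock_inner f (eigenfun k)"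
        using fock_inner_commute[of f "eigenfun k"] by (simp add: eigenfun_eq[OF f(1)])
      finally have "fock_inner f (eigenfun k) = 0" using False by auto
      moreover have "fock_inner s (eigenfun k) = (\<Sum>e\<in>S. fock_inner f e * fock_inner e (eigenfun k))"
        unfolding s_def by (subst fock_inner_sum_left) (auto simp: S_def fock_inner_scale_left)
      moreover have "(\<Sum>e\<in>S. fock_inner f e * fock_inner e (eigenfun k)) = 0"
        using False by (intro sum.neutral) (auto simp: S_def eigenfun_orthonormal)
      ultimately show ?thesis using f sF by (simp add: fock_inner_diff_left)
    qed
    have "energy (f - s) \<le> 0"
    proof (rule LIMSEQ_le_const)
      show "(\<lambda>n. eigenval n * gnorm2 (f - s)) \<longlonglongrightarrow> 0"
        using tendsto_mult_right[OF eigenval_tendsto_0, of "gnorm2 (f - s)"] by simp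
      show "\<exists>N. \<forall>n\<ge>N. energy (f - s) \<le> eigenval n * gnorm2 (f - s)"
        using f sF orth by (auto intro!: energy_le_eigenval)
    qed
    then have "f - s = 0" using energy_pos[of "f - s"] f sF by fastforce
    then have "f = s" by simp
    also have "s \<in> cfun.span S" unfolding s_def by (intro cfun.span_sum cfun.span_scale cfun.span_base)
    finally show "f \<in> cfun.span (eigenfun ` ?J)" by (simp add: S_def)
  qed
qed

lemma independent_eigenfun: "finite J \<Longrightarrow> cfun.independent (eigenfun ` J)"
proof (subst cfun.dependent_finite, simp, safe)
  fix u n assume s: "(\<Sum>v\<in>eigenfun ` J. u v \<odot> v) = 0" and J: "finite J" "n \<in> J" and u: "u (eigenfun n) \<noteq> 0"
  have "0 = fock_inner (\<Sum>v\<in>eigenfun ` J. u v \<odot> v) (eigenfun n)" by (simp add: s)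
  also have "\<dots> = (\<Sum>v\<in>eigenfun ` J. u v * fock_inner v (eigenfun n))"
    by (subst fock_inner_sum_left) (auto simp: fock_inner_scale_left)
  also have "\<dots> = (\<Sum>k\<in>J. if k = n then u (eigenfun n) else 0)"
    by (subst sum.reindex[OF inj_on_subset[OF inj_eigenfun]]) (auto simp: eigenfun_orthonormal intro!: sum.cong)
  also have "\<dots> = u (eigenfun n)" using J by (simp add: sum.delta)
  finally show False using u by simp
qed

lemma dim_eigenspace:
  assumes "\<mu> \<noteq> 0"
  shows "cfun.dim (fock_eigenspace (toeplitz \<Omega>) \<mu>) = card {k. complex_of_real (eigenval k) = \<mu>}"
proof -
  have "cfun.dim (fock_eigenspace (toeplitz \<Omega>) \<mu>) = card (eigenfun ` {k. complex_of_real (eigenval k) = \<mu>})"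
    unfolding eigenspace_eq_span[OF assms]
    by (intro cfun.dim_eq_card independent_eigenfun finite_eigenval_eq assms) (simp add: cfun.span_span)
  also have "\<dots> = card {k. complex_of_real (eigenval k) = \<mu>}"
    by (intro card_image inj_on_subset[OF inj_eigenfun]) auto
  finally show ?thesis .
qed

lemma eigenvalue_list_eigenval: "eigenvalue_list (toeplitz \<Omega>) eigenval"
proof -
  have "eigenfun k \<noteq> 0" for k using eigenfun_orthonormal[of k k] by auto
  then show ?thesis
    using eigenval_antimono eigenfun_in_eigenspace dim_eigenspace
    unfolding eigenvalue_list_def by metis
qed

text \<open>Excludes 0 from every list. The multiplicity condition of
  \<open>eigenvalue_list\<close>, which concerns nonzero values, then governs all entries.\<close>

lemma eigenvalue_pos:
  assumes "f \<in> fock_eigenspace (toeplitz \<Omega>) (complex_of_real x)" "f \<noteq> 0"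
  shows "x > 0"
proof -
  have f: "f \<in> fock_space" "fock_inner (restr \<Omega> f) f = of_real x * fock_inner f f"
    using assms by (auto simp: eigenspace_iff)
  have "energy f = Re (fock_inner (restr \<Omega> f) f)" by (simp add: energy_def gnorm2_restr)
  also have "\<dots> = x * gnorm2 f" unfolding f(2) by (simp add: fock_inner_self)
  finally have "x * gnorm2 f > 0" using energy_pos[OF f(1) assms(2)] by simp
  then show ?thesis using gnorm2_nonneg[of f] by (auto simp: zero_less_mult_iff)
qed

text \<open>Compare the lists at the first index \<open>k\<close> where they differ. The larger
  value at \<open>k\<close> can occur in the other list only before \<open>k\<close>, where both
  agree, so it is counted at least once less there.\<close>

lemma eigenvalue_list_unique:
  assumes l: "eigenvalue_list (toeplitz \<Omega>) l"
  shows "l = eigenval"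
proof (rule ccontr)
  assume "l \<noteq> eigenval"
  then have "\<exists>k. l k \<noteq> eigenval k" by auto
  define k where "k = (LEAST k. l k \<noteq> eigenval k)"
  have k: "l k \<noteq> eigenval k" "\<And>i. i < k \<Longrightarrow> l i = eigenval i"
    unfolding k_def using LeastI_ex[OF \<open>\<exists>k. _\<close>] not_less_Least by blast+
  have lpos: "l i > 0" for i using l eigenvalue_pos unfolding eigenvalue_list_def by blast
  have count: "card {i. l i = x} = card {i. eigenval i = x}" if "x \<noteq> 0" for x :: real
  proof -
    have "card {i. m i = x} = cfun.dim (fock_eigenspace (toeplitz \<Omega>) (of_real x))"
      if m: "eigenvalue_list (toeplitz \<Omega>) m" for m
    proof -
      from m have "\<forall>\<mu>. \<mu> \<noteq> 0 \<longrightarrow> card {i. complex_of_real (m i) = \<mu>} = cfun.dim (fock_eigenspace (toeplitz \<Omega>) \<mu>)"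
        by (simp add: eigenvalue_list_def)
      from this[rule_format, of "of_real x"] \<open>x \<noteq> 0\<close> show ?thesis by simp
    qed
    from this[OF l] this[OF eigenvalue_list_eigenval] show ?thesis by simp
  qed
  have fin: "finite {i. eigenval i = x}" if "x \<noteq> 0" for x :: real
    using finite_eigenval_eq[of "of_real x"] that by simp
  have main: False
    if ab: "antimono a" "antimono b" "\<And>i. i < k \<Longrightarrow> a i = b i" "a k > b k" "a k > 0"
      and c: "card {i. a i = a k} = card {i. b i = a k}" and f: "finite {i. a i = a k}" for a b :: "nat \<Rightarrow> real"
  proof -
    have "{i. b i = a k} \<subseteq> {i. a i = a k} - {k}"
    proof
      fix i assume "i \<in> {i. b i = a k}"
      then have i: "b i = a k" by simp
      have "i < k"
      proof (rule ccontr)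
        assume "\<not> i < k"
        then have "b i \<le> b k" using ab(2) by (auto simp: antimono_def)
        with i ab(4) show False by simp
      qed
      with i ab(3) show "i \<in> {i. a i = a k} - {k}" by auto
    qed
    then have "card {i. b i = a k} \<le> card ({i. a i = a k} - {k})"
      using f by (intro card_mono) auto
    also have "\<dots> < card {i. a i = a k}"
      using f by (intro psubset_card_mono) auto
    finally show False using c by simp
  qed
  have am: "antimono l" using l by (simp add: eigenvalue_list_def)
  show False
  proof (cases "l k > eigenval k")
    case True
    have "l k \<noteq> 0" using lpos[of k] by simp
    \<comment> \<open>Nothing says yet that \<open>l\<close> tends to 0. Infinitely many repetitions
      would have \<open>card\<close> 0 by default, so the value would be missing from
      \<open>eigenval\<close> and its eigenspace would be trivial, whereas each entry of a list has
      an eigenfunction.\<close>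
    have "finite {i. l i = l k}"
    proof (rule ccontr)
      assume "infinite {i. l i = l k}"
      then have "card {i. eigenval i = l k} = 0" using count[OF \<open>l k \<noteq> 0\<close>] by simp
      then have none: "{i. eigenval i = l k} = {}" using fin[OF \<open>l k \<noteq> 0\<close>] by simp
      have "fock_eigenspace (toeplitz \<Omega>) (of_real (l k)) = {0}"
        using none \<open>l k \<noteq> 0\<close> by (subst eigenspace_eq_span) auto
      then show False using l unfolding eigenvalue_list_def by blast
    qed
    then show False using main[of l eigenval] am eigenval_antimono k True lpos count[OF \<open>l k \<noteq> 0\<close>] by auto
  next
    case False
    have "eigenval k \<noteq> 0" using eigenval_pos[of k] by simp
    then show False
      using main[of eigenval l] am eigenval_antimono k False eigenval_pos count fin by auto
  qed
qed

lemma toeplitz_eigenvalue_eq: "toeplitz_eigenvalue (Suc k) \<Omega> = eigenval k"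
proof -
  have "(THE l. eigenvalue_list (toeplitz \<Omega>) l) = eigenval"
    using eigenvalue_list_eigenval eigenvalue_list_unique by (rule the_equality)
  then show ?thesis by (simp add: toeplitz_eigenvalue_def)
qed

lemma sum_toeplitz_eigenvalue: "(\<Sum>k=1..K. toeplitz_eigenvalue k \<Omega>) = (\<Sum>k<K. eigenval k)"
proof -
  have "(\<Sum>k=1..K. toeplitz_eigenvalue k \<Omega>) = (\<Sum>k<K. toeplitz_eigenvalue (Suc k) \<Omega>)"
    by (rule sum.reindex_bij_witness[of _ Suc "\<lambda>k. k - 1"]) auto
  then show ?thesis by (simp add: toeplitz_eigenvalue_eq)
qed

end

subsection \<open>Ky Fan's principle\<close>

lemma orthonormal_residual:
  assumes u: "orthonormal_family K u" and h: "h \<in> gauss_L2"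
  defines "s \<equiv> (\<Sum>i<K. fock_inner h (u i) \<odot> u i)"
  shows orthonormal_residual_perp: "j < K \<Longrightarrow> fock_inner (h - s) (u j) = 0"
    and gnorm2_orthonormal_residual: "gnorm2 (h - s) = gnorm2 h - (\<Sum>i<K. (norm (fock_inner h (u i)))\<^sup>2)"
proof -
  have L: "\<And>i. i < K \<Longrightarrow> u i \<in> gauss_L2" using u by (simp add: orthonormal_family_def)
  then have sL: "s \<in> gauss_L2" unfolding s_def by (intro gauss_L2_sum gauss_L2_scale) auto
  show "fock_inner (h - s) (u j) = 0" if j: "j < K"
  proof -
    have "fock_inner s (u j) = (\<Sum>i<K. fock_inner h (u i) * fock_inner (u i) (u j))"
      unfolding s_def using L j by (subst fock_inner_sum_left) (auto simp: fock_inner_scale_left)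
    also have "\<dots> = (\<Sum>i<K. if i = j then fock_inner h (u j) else 0)"
      using u j by (intro sum.cong refl) (auto simp: orthonormal_family_def)
    also have "\<dots> = fock_inner h (u j)" using j by (simp add: sum.delta)
    finally show ?thesis using h sL L[OF j] by (simp add: fock_inner_diff_left)
  qed
  have "fock_inner h s = (\<Sum>i<K. fock_inner h (u i) * cnj (fock_inner h (u i)))"
    unfolding s_def using L h
    by (subst fock_inner_sum_right) (auto simp: fock_inner_scale_right mult.commute)
  also have "\<dots> = of_real (\<Sum>i<K. (norm (fock_inner h (u i)))\<^sup>2)"
    by (simp only: of_real_sum complex_norm_square)
  finally have hs: "Re (fock_inner h s) = (\<Sum>i<K. (norm (fock_inner h (u i)))\<^sup>2)"
    by (simp only: Re_complex_of_real)
  have "gnorm2 s = (\<Sum>i<K. (norm (fock_inner h (u i)))\<^sup>2)"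
    unfolding s_def by (rule gnorm2_orthonormal_sum[OF u])
  with hs show "gnorm2 (h - s) = gnorm2 h - (\<Sum>i<K. (norm (fock_inner h (u i)))\<^sup>2)"
    by (simp add: gnorm2_diff[OF h sL])
qed

definition eigenvalue_sum :: "nat \<Rightarrow> complex set \<Rightarrow> real" where
  "eigenvalue_sum K \<Omega> = (\<Sum>k=1..K. toeplitz_eigenvalue k \<Omega>)"

context localization
begin

text \<open>A truncated spectral theorem: the span of the first \<open>K\<close> eigenfunctions is
  invariant, so there is no cross term with the residual \<open>p\<close>, whose energy is
  controlled by maximality of \<open>eigenval K\<close>.\<close>

lemma energy_spectral_bound:
  assumes h: "h \<in> fock_space"
  shows "energy h \<le> (\<Sum>i<K. eigenval i * (norm (fock_inner h (eigenfun i)))\<^sup>2)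
     + eigenval K * (gnorm2 h - (\<Sum>i<K. (norm (fock_inner h (eigenfun i)))\<^sup>2))"
proof -
  define s where "s = (\<Sum>i<K. fock_inner h (eigenfun i) \<odot> eigenfun i)"
  define p where "p = h - s"
  have hL: "h \<in> gauss_L2" using h by simp
  have sF: "s \<in> fock_space" unfolding s_def by (intro fock_sum fock_scale) auto
  have pF: "p \<in> fock_space" unfolding p_def using h sF by auto
  have p_perp: "fock_inner p (eigenfun j) = 0" if "j < K" for j
    using orthonormal_residual_perp[OF orthonormal_family_eigenfun hL that] by (simp add: p_def s_def)
  have p_norm: "gnorm2 p = gnorm2 h - (\<Sum>i<K. (norm (fock_inner h (eigenfun i)))\<^sup>2)"
    using gnorm2_orthonormal_residual[OF orthonormal_family_eigenfun hL] by (simp add: p_def s_def)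
  have form: "fock_inner (restr \<Omega> s) g = (\<Sum>i<K. fock_inner h (eigenfun i) * eigenval i * fock_inner (eigenfun i) g)"
    if g: "g \<in> fock_space" for g
  proof -
    have "fock_inner (restr \<Omega> s) g = fock_inner s (restr \<Omega> g)" by (rule fock_inner_restr)
    also have "\<dots> = (\<Sum>i<K. fock_inner (fock_inner h (eigenfun i) \<odot> eigenfun i) (restr \<Omega> g))"
      unfolding s_def using g by (intro fock_inner_sum_left gauss_L2_scale) auto
    also have "\<dots> = (\<Sum>i<K. fock_inner h (eigenfun i) * eigenval i * fock_inner (eigenfun i) g)"
    proof (intro sum.cong refl)
      fix i
      have "fock_inner (eigenfun i) (restr \<Omega> g) = eigenval i * fock_inner (eigenfun i) g"
        by (simp add: fock_inner_restr[symmetric] eigenfun_eq[OF g])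
      then show "fock_inner (fock_inner h (eigenfun i) \<odot> eigenfun i) (restr \<Omega> g)
         = fock_inner h (eigenfun i) * eigenval i * fock_inner (eigenfun i) g"
        by (simp add: fock_inner_scale_left)
    qed
    finally show ?thesis .
  qed
  have "fock_inner (restr \<Omega> s) p = 0"
    unfolding form[OF pF]
  proof (intro sum.neutral ballI)
    fix i assume "i \<in> {..<K}"
    then show "fock_inner h (eigenfun i) * eigenval i * fock_inner (eigenfun i) p = 0"
      using p_perp[of i] fock_inner_commute[of "eigenfun i" p] by simp
  qed
  moreover have "energy s = (\<Sum>i<K. eigenval i * (norm (fock_inner h (eigenfun i)))\<^sup>2)"
  proof -
    have "fock_inner h (eigenfun i) * eigenval i * fock_inner (eigenfun i) s
       = of_real (eigenval i * (norm (fock_inner h (eigenfun i)))\<^sup>2)" if "i < K" for i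
    proof -
      have "fock_inner s (eigenfun i) = fock_inner h (eigenfun i)"
        using p_perp[OF that] hL sF by (simp add: p_def fock_inner_diff_left)
      then have "fock_inner (eigenfun i) s = cnj (fock_inner h (eigenfun i))"
        using fock_inner_commute[of "eigenfun i" s] by simp
      then show ?thesis using complex_norm_square[of "fock_inner h (eigenfun i)"] by (simp add: mult_ac)
    qed
    then have "fock_inner (restr \<Omega> s) s = of_real (\<Sum>i<K. eigenval i * (norm (fock_inner h (eigenfun i)))\<^sup>2)"
      unfolding form[OF sF] of_real_sum by (intro sum.cong) auto
    then show ?thesis by (simp only: energy_def gnorm2_restr Re_complex_of_real)
  qed
  moreover have "energy h = energy s + energy p + 2 * Re (fock_inner (restr \<Omega> s) p)"
  proof -
    have "h = s + p" by (simp add: p_def)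
    then have "restr \<Omega> h = restr \<Omega> s + restr \<Omega> p" by (simp add: restr_add)
    then show ?thesis
      using gnorm2_add[of "restr \<Omega> s" "restr \<Omega> p"] sF pF by (simp add: energy_def fock_inner_restr2)
  qed
  moreover have "energy p \<le> eigenval K * gnorm2 p"
    by (rule energy_le_eigenval[OF pF p_perp])
  ultimately show ?thesis by (simp add: p_norm)
qed

lemma Ky_Fan_primal:
  assumes "bessel_family K \<phi>" "\<And>k. k < K \<Longrightarrow> \<phi> k \<in> fock_space"
  shows "(\<Sum>k<K. gnorm2 (restr \<Omega> (\<phi> k))) \<le> (\<Sum>i<K. eigenval i)"
\<comment> \<open>Eigenvalues are numbered from 0 here, so \<open>eigenval K\<close> is the first
  one left out of the sum.\<close>
proof (rule Ky_Fan_bound[where \<mu> = "eigenval K" and a = "\<lambda>k i. (norm (fock_inner (\<phi> k) (eigenfun i)))\<^sup>2"])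
  fix k assume k: "k < K"
  have "eigenval K * (gnorm2 (\<phi> k) - x) \<le> eigenval K * (1 - x)" for x
    using bessel_gnorm2_le_1[OF assms(1) k] less_imp_le[OF eigenval_pos[of K]] by (intro mult_left_mono) auto
  then show "gnorm2 (restr \<Omega> (\<phi> k)) \<le> (\<Sum>i<K. eigenval i * (norm (fock_inner (\<phi> k) (eigenfun i)))\<^sup>2)
     + eigenval K * (1 - (\<Sum>i<K. (norm (fock_inner (\<phi> k) (eigenfun i)))\<^sup>2))"
    using energy_spectral_bound[OF assms(2)[OF k], of K] unfolding energy_def by (meson add_left_mono order_trans)
next
  show "(\<Sum>k<K. (norm (fock_inner (\<phi> k) (eigenfun i)))\<^sup>2) \<le> 1" for i
    using bessel_inner_le[OF assms(1), of "eigenfun i"] eigenfun_aux[of i] by simp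
  show "eigenval K \<le> eigenval i" if "i < K" for i
    using eigenval_antimono that by (auto simp: antimono_def)
qed

section \<open>The dual form\<close>

text \<open>Restriction to \<open>\<Omega>\<close>, as a map from the Fock space to L2 of
  \<open>\<Omega>\<close>, has the projection as its adjoint, and adjoint times restriction is the
  Toeplitz operator. These functions are the other half of its singular value decomposition, with
  singular values \<open>sqrt (eigenval i)\<close>.\<close>

definition dual_eigenfun :: "nat \<Rightarrow> complex \<Rightarrow> complex" where
  "dual_eigenfun i = of_real (1 / sqrt (eigenval i)) \<odot> restr \<Omega> (eigenfun i)"

lemma dual_eigenfun_L2 [intro, simp]: "dual_eigenfun i \<in> gauss_L2"
  unfolding dual_eigenfun_def by (intro gauss_L2_scale) auto

lemma restr_dual_eigenfun: "restr \<Omega> (dual_eigenfun i) = dual_eigenfun i"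
  by (simp add: dual_eigenfun_def restr_scale restr_restr)

lemma fock_inner_dual_eigenfun:
  assumes "g \<in> fock_space"
  shows "fock_inner (dual_eigenfun i) g = of_real (sqrt (eigenval i)) * fock_inner (eigenfun i) g"
proof -
  have "eigenval i > 0" by (rule eigenval_pos)
  then have "complex_of_real (1 / sqrt (eigenval i)) * of_real (eigenval i) = of_real (sqrt (eigenval i))"
    unfolding of_real_mult[symmetric] by (simp add: real_div_sqrt)
  then show ?thesis
    unfolding dual_eigenfun_def fock_inner_scale_left eigenfun_eq[OF assms] by (simp only: mult.assoc[symmetric])
qed

lemma orthonormal_family_dual_eigenfun: "orthonormal_family K dual_eigenfun"
proof -
  have "fock_inner (dual_eigenfun i) (dual_eigenfun j) = (if i = j then 1 else 0)" for i j
  proof -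
    have "fock_inner (dual_eigenfun i) (dual_eigenfun j)
       = of_real (1 / sqrt (eigenval j)) * fock_inner (dual_eigenfun i) (restr \<Omega> (eigenfun j))"
      by (simp add: dual_eigenfun_def[of j] fock_inner_scale_right)
    also have "fock_inner (dual_eigenfun i) (restr \<Omega> (eigenfun j)) = fock_inner (dual_eigenfun i) (eigenfun j)"
      by (metis fock_inner_restr restr_dual_eigenfun)
    also have "\<dots> = of_real (sqrt (eigenval i)) * (if i = j then 1 else 0)"
      by (simp add: fock_inner_dual_eigenfun eigenfun_orthonormal)
    finally show ?thesis using eigenval_pos[of i] by auto
  qed
  then show ?thesis by (simp add: orthonormal_family_def)
qed

lemma fock_proj_dual_eigenfun: "fock_proj (dual_eigenfun i) = of_real (sqrt (eigenval i)) \<odot> eigenfun i"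
  by (rule fock_proj_eqI) (auto simp: fock_inner_dual_eigenfun fock_inner_scale_left)

lemma gnorm2_fock_proj_dual_eigenfun: "gnorm2 (fock_proj (dual_eigenfun i)) = eigenval i"
  using eigenfun_aux[of i] eigenval_pos[of i] by (simp add: fock_proj_dual_eigenfun)

lemma fock_inner_dual_eigenfun_right:
  assumes "v \<in> gauss_L2" "restr \<Omega> v = v"
  shows "fock_inner (fock_proj v) (eigenfun i) = of_real (sqrt (eigenval i)) * fock_inner v (dual_eigenfun i)"
proof -
  have "fock_inner v (dual_eigenfun i) = of_real (1 / sqrt (eigenval i)) * fock_inner v (eigenfun i)"
    unfolding dual_eigenfun_def fock_inner_scale_right by (metis assms(2) complex_cnj_complex_of_real fock_inner_restr)
  then show ?thesis using assms(1) eigenval_pos[of i] by (simp add: fock_inner_proj)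
qed

text \<open>Let \<open>p\<close> be the residual of the projection of \<open>v\<close> and
  \<open>w\<close> that of \<open>v\<close> itself. Since
  \<open>fock_inner p p = fock_inner w p\<close> and \<open>w\<close> lives on
  \<open>\<Omega>\<close>, Cauchy-Schwarz and the energy bound for \<open>p\<close> give
  \<open>gnorm2 p \<le> eigenval K * gnorm2 w\<close>, so the spectral data of the primal side
  suffice.\<close>

lemma projection_spectral_bound:
  assumes v: "v \<in> gauss_L2" "restr \<Omega> v = v"
  shows "gnorm2 (fock_proj v) \<le> (\<Sum>i<K. eigenval i * (norm (fock_inner v (dual_eigenfun i)))\<^sup>2)
     + eigenval K * (gnorm2 v - (\<Sum>i<K. (norm (fock_inner v (dual_eigenfun i)))\<^sup>2))"
proof -
  define g where "g = fock_proj v"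
  define p where "p = g - (\<Sum>i<K. fock_inner g (eigenfun i) \<odot> eigenfun i)"
  define w where "w = v - (\<Sum>i<K. fock_inner v (dual_eigenfun i) \<odot> dual_eigenfun i)"
  have g: "g \<in> fock_space" "g \<in> gauss_L2" using v by (auto simp: g_def)
  have sF: "(\<Sum>i<K. fock_inner g (eigenfun i) \<odot> eigenfun i) \<in> fock_space"
    by (intro fock_sum fock_scale) auto
  have pF: "p \<in> fock_space" unfolding p_def using g sF by auto
  have tL: "(\<Sum>i<K. fock_inner v (dual_eigenfun i) \<odot> dual_eigenfun i) \<in> gauss_L2"
    by (intro gauss_L2_sum gauss_L2_scale) auto
  have wL: "w \<in> gauss_L2" unfolding w_def using v tL by auto
  have p_perp: "fock_inner p (eigenfun j) = 0" if "j < K" for j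
    using orthonormal_residual_perp[OF orthonormal_family_eigenfun g(2) that] by (simp add: p_def)
  have p_norm: "gnorm2 p = gnorm2 g - (\<Sum>i<K. (norm (fock_inner g (eigenfun i)))\<^sup>2)"
    using gnorm2_orthonormal_residual[OF orthonormal_family_eigenfun g(2)] by (simp add: p_def)
  have w_norm: "gnorm2 w = gnorm2 v - (\<Sum>i<K. (norm (fock_inner v (dual_eigenfun i)))\<^sup>2)"
    using gnorm2_orthonormal_residual[OF orthonormal_family_dual_eigenfun v(1)] by (simp add: w_def)
  have "fock_inner (\<Sum>i<K. fock_inner v (dual_eigenfun i) \<odot> dual_eigenfun i) p = 0"
  proof -
    have "fock_inner (\<Sum>i<K. fock_inner v (dual_eigenfun i) \<odot> dual_eigenfun i) p
      = (\<Sum>i<K. fock_inner v (dual_eigenfun i) * (of_real (sqrt (eigenval i)) * fock_inner (eigenfun i) p))"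
      using pF by (subst fock_inner_sum_left)
        (auto simp: fock_inner_scale_left fock_inner_dual_eigenfun)
    also have "\<dots> = 0"
    proof (intro sum.neutral ballI)
      fix i assume "i \<in> {..<K}"
      then show "fock_inner v (dual_eigenfun i) * (of_real (sqrt (eigenval i)) * fock_inner (eigenfun i) p) = 0"
        using p_perp[of i] fock_inner_commute[of "eigenfun i" p] by simp
    qed
    finally show ?thesis .
  qed
  then have vw: "fock_inner v p = fock_inner w p"
    using v tL pF by (simp add: w_def fock_inner_diff_left)
  have "fock_inner (\<Sum>i<K. fock_inner g (eigenfun i) \<odot> eigenfun i) p = 0"
  proof -
    have "fock_inner (\<Sum>i<K. fock_inner g (eigenfun i) \<odot> eigenfun i) p
      = (\<Sum>i<K. fock_inner g (eigenfun i) * fock_inner (eigenfun i) p)"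
      using pF by (subst fock_inner_sum_left) (auto simp: fock_inner_scale_left)
    also have "\<dots> = 0"
    proof (intro sum.neutral ballI)
      fix i assume "i \<in> {..<K}"
      then show "fock_inner g (eigenfun i) * fock_inner (eigenfun i) p = 0"
        using p_perp[of i] fock_inner_commute[of "eigenfun i" p] by simp
    qed
    finally show ?thesis .
  qed
  then have "fock_inner p p = fock_inner g p"
    using g sF pF by (simp add: p_def[of] fock_inner_diff_left)
  also have "\<dots> = fock_inner v p" using v pF by (simp add: g_def fock_inner_proj)
  finally have pp: "fock_inner p p = fock_inner w p" using vw by simp
  have rw: "restr \<Omega> w = w"
  proof
    fix z
    have "z \<notin> \<Omega> \<Longrightarrow> v z = 0" using fun_cong[OF v(2), of z] by (simp add: restr_def)
    moreover have "z \<notin> \<Omega> \<Longrightarrow> dual_eigenfun i z = 0" for i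
      using fun_cong[OF restr_dual_eigenfun[of i], of z] by (simp add: restr_def)
    ultimately show "restr \<Omega> w z = w z"
      by (auto simp: restr_def w_def sum_fun_apply indicator_def)
  qed
  have "fock_inner w p = fock_inner w (restr \<Omega> p)" using fock_inner_restr[of \<Omega> w p] rw by simp
  then have "fock_inner w (restr \<Omega> p) = of_real (gnorm2 p)"
    using pp by (simp add: fock_inner_self)
  then have "(gnorm2 p)\<^sup>2 = (norm (fock_inner w (restr \<Omega> p)))\<^sup>2" by simp
  also have "\<dots> \<le> gnorm2 w * gnorm2 (restr \<Omega> p)"
    using wL pF by (intro fock_inner_Cauchy_Schwarz) auto
  also have "\<dots> \<le> gnorm2 w * (eigenval K * gnorm2 p)"
    using energy_le_eigenval[OF pF p_perp] by (intro mult_left_mono) (auto simp: energy_def)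
  finally have "gnorm2 p * gnorm2 p \<le> (eigenval K * gnorm2 w) * gnorm2 p"
    by (simp add: power2_eq_square mult_ac)
  then have "gnorm2 p \<le> eigenval K * gnorm2 w"
    using gnorm2_nonneg[of p] less_imp_le[OF eigenval_pos[of K]] by (cases "gnorm2 p = 0") auto
  moreover have "(norm (fock_inner g (eigenfun i)))\<^sup>2 = eigenval i * (norm (fock_inner v (dual_eigenfun i)))\<^sup>2" for i
    unfolding g_def fock_inner_dual_eigenfun_right[OF v] using eigenval_pos[of i]
    by (simp add: norm_mult power_mult_distrib)
  ultimately show ?thesis using p_norm w_norm by (simp add: g_def)
qed

lemma Ky_Fan_dual:
  assumes "bessel_family K v" "\<And>k. k < K \<Longrightarrow> restr \<Omega> (v k) = v k"
  shows "(\<Sum>k<K. gnorm2 (fock_proj (v k))) \<le> (\<Sum>i<K. eigenval i)"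
proof (rule Ky_Fan_bound[where \<mu> = "eigenval K" and a = "\<lambda>k i. (norm (fock_inner (v k) (dual_eigenfun i)))\<^sup>2"])
  fix k assume k: "k < K"
  have L: "v k \<in> gauss_L2" using assms(1) k by (simp add: bessel_family_def)
  have "eigenval K * (gnorm2 (v k) - x) \<le> eigenval K * (1 - x)" for x
    using bessel_gnorm2_le_1[OF assms(1) k] less_imp_le[OF eigenval_pos[of K]] by (intro mult_left_mono) auto
  then show "gnorm2 (fock_proj (v k)) \<le> (\<Sum>i<K. eigenval i * (norm (fock_inner (v k) (dual_eigenfun i)))\<^sup>2)
     + eigenval K * (1 - (\<Sum>i<K. (norm (fock_inner (v k) (dual_eigenfun i)))\<^sup>2))"
    using projection_spectral_bound[OF L assms(2)[OF k], of K] by (meson add_left_mono order_trans)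
next
  show "(\<Sum>k<K. (norm (fock_inner (v k) (dual_eigenfun i)))\<^sup>2) \<le> 1" for i
    using bessel_inner_le[OF assms(1), of "dual_eigenfun i"]
      bessel_gnorm2_le_1[OF orthonormal_imp_bessel[OF orthonormal_family_dual_eigenfun], of i "Suc i"] by simp
  show "eigenval K \<le> eigenval i" if "i < K" for i
    using eigenval_antimono that by (auto simp: antimono_def)
qed

lemma eigenvalue_sum_eq: "eigenvalue_sum K \<Omega> = (\<Sum>i<K. eigenval i)"
  unfolding eigenvalue_sum_def by (rule sum_toeplitz_eigenvalue)

lemma eigenvalue_sum_primal:
  "bessel_family K \<phi> \<Longrightarrow> (\<And>k. k < K \<Longrightarrow> \<phi> k \<in> fock_space) \<Longrightarrow>
     (\<Sum>k<K. gnorm2 (restr \<Omega> (\<phi> k))) \<le> eigenvalue_sum K \<Omega>"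
  unfolding eigenvalue_sum_eq by (rule Ky_Fan_primal) auto

lemma eigenvalue_sum_dual:
  "bessel_family K v \<Longrightarrow> (\<And>k. k < K \<Longrightarrow> restr \<Omega> (v k) = v k) \<Longrightarrow>
     (\<Sum>k<K. gnorm2 (fock_proj (v k))) \<le> eigenvalue_sum K \<Omega>"
  unfolding eigenvalue_sum_eq by (rule Ky_Fan_dual) auto

lemma eigenvalue_sum_primal_attained:
  "\<exists>\<phi>. orthonormal_family K \<phi> \<and> (\<forall>k. \<phi> k \<in> fock_space) \<and> (\<Sum>k<K. gnorm2 (restr \<Omega> (\<phi> k))) = eigenvalue_sum K \<Omega>"
  by (rule exI[of _ eigenfun])
     (simp add: orthonormal_family_eigenfun eigenvalue_sum_eq eigenval_def energy_def)

lemma eigenvalue_sum_dual_attained: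
  "\<exists>v. orthonormal_family K v \<and> (\<forall>k. restr \<Omega> (v k) = v k) \<and> (\<Sum>k<K. gnorm2 (fock_proj (v k))) = eigenvalue_sum K \<Omega>"
  by (rule exI[of _ dual_eigenfun])
     (simp add: orthonormal_family_dual_eigenfun eigenvalue_sum_eq restr_dual_eigenfun gnorm2_fock_proj_dual_eigenfun)

lemma eigenvalue_sum_le: "eigenvalue_sum K \<Omega> \<le> fock_const * measure lebesgue \<Omega>"
  unfolding eigenvalue_sum_eq by (rule eigenval_sum_le)

lemma eigenvalue_sum_pos: "K \<ge> 1 \<Longrightarrow> eigenvalue_sum K \<Omega> > 0"
  unfolding eigenvalue_sum_eq using eigenval_pos by (intro sum_pos) (auto simp: lessThan_empty_iff)

end

subsection \<open>Moving distant pieces\<close>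

text \<open>Near-locality of the projection, by compactness. Otherwise the projections would
  converge along a subsequence to some \<open>h\<close>. Testing against \<open>h\<close> involves
  \<open>h\<close> only far out, where it has little mass, so \<open>h = 0\<close>; but then the
  masses on the fixed disc tend to 0.\<close>

lemma fock_proj_localised:
  assumes \<epsilon>: "\<epsilon> > 0"
  shows "\<exists>D. \<forall>v\<in>gauss_L2. gnorm2 v \<le> 1 \<longrightarrow> restr (cball 0 D) v = 0 \<longrightarrow> gnorm2 (restr (cball 0 r) (fock_proj v)) \<le> \<epsilon>"
proof (rule ccontr)
  assume "\<not> ?thesis"
  then have "\<forall>n::nat. \<exists>v. v \<in> gauss_L2 \<and> gnorm2 v \<le> 1 \<and> restr (cball 0 (real n)) v = 0 \<and> gnorm2 (restr (cball 0 r) (fock_proj v)) > \<epsilon>"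
    by (meson not_le)
  then obtain v where v: "\<And>n. v n \<in> gauss_L2" "\<And>n. gnorm2 (v n) \<le> 1" "\<And>n::nat. restr (cball 0 (real n)) (v n) = 0"
    "\<And>n. gnorm2 (restr (cball 0 r) (fock_proj (v n))) > \<epsilon>"
    by metis
  define g where "g n = fock_proj (v n)" for n
  have gF: "g n \<in> fock_space" for n using v by (simp add: g_def)
  have gb: "gnorm2 (g n) \<le> 1" for n
    unfolding g_def using gnorm2_fock_proj_le[OF v(1)[of n]] v(2)[of n] by linarith
  obtain h \<rho> where h: "h \<in> fock_space" "gnorm2 h \<le> 1" "strict_mono (\<rho> :: nat \<Rightarrow> nat)" "\<And>z. (\<lambda>n. g (\<rho> n) z) \<longlonglongrightarrow> h z"
    using fock_bounded_subsequence[of g 1, OF gF gb] by blast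
  have "(\<lambda>n. fock_inner (g (\<rho> n)) h) \<longlonglongrightarrow> fock_inner h h"
    using h by (intro fock_tendsto_inner[of "\<lambda>n. g (\<rho> n)" 1] gF gb) auto
  moreover have "(\<lambda>n. fock_inner (g (\<rho> n)) h) \<longlonglongrightarrow> 0"
  proof (rule tendsto_norm_zero_cancel, rule tendsto_sandwich[OF _ _ tendsto_const])
    show "(\<lambda>n. sqrt (gnorm2 (restr (- cball 0 (real (\<rho> n))) h))) \<longlonglongrightarrow> 0"
      using tendsto_real_sqrt[OF LIMSEQ_subseq_LIMSEQ[OF gnorm2_tail_tendsto_0[of h] h(3)]] h(1)
      by (simp add: comp_def)
    have "norm (fock_inner (g n) h) \<le> sqrt (gnorm2 (restr (- cball 0 (real n)) h))" for n
    proof -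
      have L: "restr (- cball 0 (real n)) h \<in> gauss_L2" using h(1) by (intro restr_L2) (auto intro!: borel_open)
      have "v n = restr (- cball 0 (real n)) (v n)"
      proof
        fix z show "v n z = restr (- cball 0 (real n)) (v n) z"
          using fun_cong[OF v(3)[of n], of z] by (auto simp: restr_def indicator_def)
      qed
      then have "fock_inner (g n) h = fock_inner (v n) (restr (- cball 0 (real n)) h)"
        using fock_inner_restr[of "- cball 0 (real n)" "v n" h] v(1) h(1) by (simp add: g_def fock_inner_proj)
      then have "(norm (fock_inner (g n) h))\<^sup>2 \<le> gnorm2 (v n) * gnorm2 (restr (- cball 0 (real n)) h)"
        using fock_inner_Cauchy_Schwarz[OF v(1) L] by simp
      also have "\<dots> \<le> 1 * gnorm2 (restr (- cball 0 (real n)) h)"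
        using v(2) by (intro mult_right_mono) auto
      finally show ?thesis by (intro real_le_rsqrt) simp
    qed
    then show "\<forall>\<^sub>F n in sequentially. norm (fock_inner (g (\<rho> n)) h) \<le> sqrt (gnorm2 (restr (- cball 0 (real (\<rho> n))) h))"
      by simp
  qed simp
  ultimately have "fock_inner h h = 0" by (rule LIMSEQ_unique)
  then have h0: "h = 0" using h(1) fock_zero_iff by (simp add: fock_inner_self)
  have fin: "emeasure lebesgue (cball (0::complex) r) < \<infinity>"
    using emeasure_lborel_cball_finite[of "0::complex" r] by simp
  have "(\<lambda>n. gnorm2 (restr (cball 0 r) (g (\<rho> n)))) \<longlonglongrightarrow> gnorm2 (restr (cball 0 r) h)"
    by (rule fock_tendsto_restr[of "\<lambda>n. g (\<rho> n)" 1, OF gF gb h(1,2,4) _ fin]) simp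
  moreover have "gnorm2 (restr (cball 0 r) h) = 0" by (simp add: h0 gnorm2_def restr_def)
  ultimately have "\<epsilon> \<le> 0"
    using v(4) by (intro LIMSEQ_le_const) (auto simp: g_def intro!: less_imp_le)
  with \<epsilon> show False by simp
qed

lemma restr_sum: "restr A (\<Sum>i\<in>I. f i) = (\<Sum>i\<in>I. restr A (f i))"
  by (auto simp: restr_def fun_eq_iff sum_fun_apply sum_distrib_left)

lemma mem_translation_iff: "z \<in> (+) a ` A \<longleftrightarrow> z - a \<in> (A :: complex set)"
proof
  assume "z - a \<in> A"
  then have "a + (z - a) \<in> (+) a ` A" by (rule imageI)
  then show "z \<in> (+) a ` A" by simp
qed auto

text \<open>Weyl translation makes the distance \<open>D\<close> independent of the centre, which
  matters because the sets to be split can lie anywhere.\<close>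

lemma fock_proj_localised_at:
  assumes D: "\<forall>v\<in>gauss_L2. gnorm2 v \<le> 1 \<longrightarrow> restr (cball 0 D) v = 0 \<longrightarrow> gnorm2 (restr (cball 0 r) (fock_proj v)) \<le> \<epsilon>"
    and v: "v \<in> gauss_L2" "gnorm2 v \<le> 1" "restr (cball p D) v = 0"
  shows "gnorm2 (restr (cball p r) (fock_proj v)) \<le> \<epsilon>"
proof -
  have c: "cball 0 R = (+) (- p) ` cball p R" for R
    by (metis add.left_inverse cball_translation)
  have "restr (cball 0 D) (weyl (- p) v) = weyl (- p) (restr (cball p D) v)"
    unfolding c[of D] by (rule restr_weyl)
  also have "\<dots> = 0" by (simp add: v(3) weyl_def zero_fun_def)
  finally have "gnorm2 (restr (cball 0 r) (fock_proj (weyl (- p) v))) \<le> \<epsilon>"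
    using D v by (simp add: gnorm2_weyl weyl_L2)
  also have "restr (cball 0 r) (fock_proj (weyl (- p) v)) = weyl (- p) (restr (cball p r) (fock_proj v))"
    unfolding c[of r] fock_proj_weyl[OF v(1)] by (rule restr_weyl)
  also have "gnorm2 \<dots> = gnorm2 (restr (cball p r) (fock_proj v))"
    using v by (intro gnorm2_weyl restr_L2) auto
  finally show ?thesis .
qed

definition admissible :: "real \<Rightarrow> complex set set" where
  "admissible s = {\<Omega>. \<Omega> \<in> sets lebesgue \<and> emeasure lebesgue \<Omega> = ennreal s}"

lemma admissible_localization: "s > 0 \<Longrightarrow> \<Omega> \<in> admissible s \<Longrightarrow> localization \<Omega>"
  by (simp add: localization_def admissible_def)

lemma emeasure_lebesgue_translation: "emeasure lebesgue ((+) a ` A) = emeasure lebesgue (A :: complex set)"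
  and sets_lebesgue_translation: "A \<in> sets lebesgue \<Longrightarrow> (+) a ` A \<in> sets (lebesgue :: complex measure)"
  using emeasure_lebesgue_affine[of 1 a A] lebesgue_sets_translation[of A a]
  by (simp_all add: image_def add.commute)

lemma fock_inner_restr_disjoint:
  assumes "A \<inter> B = {}"
  shows "fock_inner (restr A f) (restr B g) = 0"
proof -
  have "fock_inner (restr A f) (restr B g) = fock_inner f (restr (A \<inter> B) g)"
    by (simp add: fock_inner_restr restr_restr)
  then show ?thesis using assms by (simp add: restr_def fock_inner_def)
qed

text \<open>In the dual picture a near optimal family on \<open>\<Omega>\<close> splits as
  \<open>a k + b k\<close>; after the move both \<open>weyl q (a k) + b k\<close> and \<open>weyl q (a k) - b k\<close> are admissible, and by the
  parallelogram law their energies average to the sum of the energies of the pieces.\<close>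

lemma eigenvalue_sum_move:
  assumes s: "s > 0" and \<epsilon>: "\<epsilon> > 0"
  shows "\<exists>D. \<forall>\<Omega>\<in>admissible s. \<forall>p q.
     (\<Omega> - cball p r) \<inter> cball p D = {} \<longrightarrow> (+) q ` (\<Omega> \<inter> cball p r) \<inter> (\<Omega> - cball p r) = {} \<longrightarrow>
     (+) q ` (\<Omega> \<inter> cball p r) \<union> (\<Omega> - cball p r) \<in> admissible s \<and>
     eigenvalue_sum K \<Omega> - \<epsilon> \<le> eigenvalue_sum K ((+) q ` (\<Omega> \<inter> cball p r) \<union> (\<Omega> - cball p r))"
proof -
  \<comment> \<open>Each index loses at most \<open>2 * sqrt \<delta>\<close>, so the total loss is
    at most \<open>\<epsilon>\<close>. The added 1 keeps the denominator positive for
    \<open>K = 0\<close>.\<close>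
  define \<delta> where "\<delta> = (\<epsilon> / (2 * real K + 1))\<^sup>2"
  have \<delta>: "\<delta> > 0" "sqrt \<delta> = \<epsilon> / (2 * real K + 1)" using \<epsilon> by (auto simp: \<delta>_def)
  obtain D where D: "\<forall>v\<in>gauss_L2. gnorm2 v \<le> 1 \<longrightarrow> restr (cball 0 D) v = 0 \<longrightarrow> gnorm2 (restr (cball 0 r) (fock_proj v)) \<le> \<delta>"
    using fock_proj_localised[OF \<delta>(1)] by blast
  show ?thesis
  proof (intro exI[of _ D] ballI allI impI)
    fix \<Omega> p q
    assume \<Omega>: "\<Omega> \<in> admissible s"
    define A where "A = \<Omega> \<inter> cball p r"
    define B where "B = \<Omega> - cball p r"
    define A' where "A' = (+) q ` A"
    assume far: "(\<Omega> - cball p r) \<inter> cball p D = {}" and disj: "(+) q ` (\<Omega> \<inter> cball p r) \<inter> (\<Omega> - cball p r) = {}"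
    have AB: "A \<inter> B = {}" "\<Omega> = A \<union> B" by (auto simp: A_def B_def)
    have A'B: "A' \<inter> B = {}" using disj by (simp add: A'_def A_def B_def)
    have BD: "B \<inter> cball p D = {}" using far by (simp add: B_def)
    have sets: "\<Omega> \<in> sets lebesgue" "A \<in> sets lebesgue" "B \<in> sets lebesgue" "A' \<in> sets lebesgue"
      using \<Omega> by (auto simp: admissible_def A_def B_def A'_def intro!: sets_lebesgue_translation)
    have "emeasure lebesgue (A' \<union> B) = emeasure lebesgue A' + emeasure lebesgue B"
      using sets A'B by (intro plus_emeasure[symmetric]) auto
    also have "\<dots> = emeasure lebesgue A + emeasure lebesgue B"
      by (simp only: A'_def emeasure_lebesgue_translation)
    also have "\<dots> = emeasure lebesgue \<Omega>"
      unfolding AB(2) using sets AB(1) by (intro plus_emeasure) auto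
    finally have \<Omega>': "A' \<union> B \<in> admissible s" using \<Omega> sets by (simp add: admissible_def)
    interpret \<Omega>: localization \<Omega> by (rule admissible_localization[OF s \<Omega>])
    interpret \<Omega>': localization "A' \<union> B" by (rule admissible_localization[OF s \<Omega>'])
    obtain v where v: "orthonormal_family K v" "\<And>k. restr \<Omega> (v k) = v k"
      "(\<Sum>k<K. gnorm2 (fock_proj (v k))) = eigenvalue_sum K \<Omega>"
      using \<Omega>.eigenvalue_sum_dual_attained[of K] by blast
    have vL: "v k \<in> gauss_L2" if "k < K" for k using v(1) that by (simp add: orthonormal_family_def)
    define a where "a k = restr A (v k)" for k
    define b where "b k = restr B (v k)" for k
    have abL: "a k \<in> gauss_L2" "b k \<in> gauss_L2" if "k < K" for k
      using vL[OF that] sets by (auto simp: a_def b_def)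
    have vab: "v k = a k + b k" for k
    proof
      fix z show "v k z = (a k + b k) z"
        using fun_cong[OF v(2)[of k], of z] AB
        by (cases "z \<in> A"; cases "z \<in> B") (auto simp: a_def b_def restr_def)
    qed
    have one: "gnorm2 (v k) \<le> 1" if "k < K" for k
      using bessel_gnorm2_le_1[OF orthonormal_imp_bessel[OF v(1)] that] .
    have bessel: "bessel_family K (\<lambda>k. weyl q (a k) + c \<odot> b k)" if c: "norm c = 1" for c
      unfolding bessel_family_def
    proof (intro conjI allI impI)
      show "weyl q (a k) + c \<odot> b k \<in> gauss_L2" if "k < K" for k
        using abL[OF that] by auto
      fix x :: "nat \<Rightarrow> complex"
      define V where "V = (\<Sum>k<K. x k \<odot> v k)"
      have VL: "V \<in> gauss_L2" unfolding V_def by (intro gauss_L2_sum gauss_L2_scale vL) auto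
      have aw: "weyl q (a k) = restr A' (weyl q (v k))" for k
        by (simp add: A'_def a_def restr_weyl)
      \<comment> \<open>Every combination is assembled from the parts of the single function
        \<open>V\<close> on \<open>A\<close> and \<open>B\<close>. Since both \<open>A\<close>,
        \<open>B\<close> and \<open>A'\<close>, \<open>B\<close> are disjoint, moving a part or
        changing a sign does not affect the squared norm.\<close>
      have eq: "(\<Sum>k<K. x k \<odot> (weyl q (a k) + c \<odot> b k)) = restr A' (weyl q V) + restr B (c \<odot> V)"
        by (simp add: aw b_def V_def weyl_sum weyl_scale restr_sum restr_scale cfun.scale_right_distrib
            sum.distrib cfun.scale_sum_right mult.commute)
      have "gnorm2 (\<Sum>k<K. x k \<odot> (weyl q (a k) + c \<odot> b k)) = gnorm2 (restr A' (weyl q V) + restr B (c \<odot> V))"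
        by (simp only: eq)
      also have "\<dots> = gnorm2 (restr A' (weyl q V)) + gnorm2 (restr B (c \<odot> V))"
        using VL sets by (subst gnorm2_add) (auto simp: fock_inner_restr_disjoint[OF A'B])
      also have "gnorm2 (restr A' (weyl q V)) = gnorm2 (restr A V)"
        unfolding A'_def restr_weyl using VL sets by (intro gnorm2_weyl) auto
      also have "gnorm2 (restr B (c \<odot> V)) = gnorm2 (restr B V)" using c by (simp add: restr_scale)
      also have "gnorm2 (restr A V) + gnorm2 (restr B V) = gnorm2 (restr A V + restr B V)"
        using VL sets by (subst gnorm2_add) (auto simp: fock_inner_restr_disjoint[OF AB(1)])
      also have "restr A V + restr B V = restr \<Omega> V"
        using AB by (auto simp: restr_def fun_eq_iff indicator_def)
      also have "gnorm2 (restr \<Omega> V) \<le> gnorm2 V" using VL sets by (intro gnorm2_restr_le)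
      also have "gnorm2 V = (\<Sum>k<K. (norm (x k))\<^sup>2)" unfolding V_def by (rule gnorm2_orthonormal_sum[OF v(1)])
      finally show "gnorm2 (\<Sum>k<K. x k \<odot> (weyl q (a k) + c \<odot> b k)) \<le> (\<Sum>k<K. (norm (x k))\<^sup>2)" .
    qed
    have supp: "restr (A' \<union> B) (weyl q (a k) + c \<odot> b k) = weyl q (a k) + c \<odot> b k" for k c
    proof -
      have "weyl q (a k) = restr A' (weyl q (v k))" by (simp add: A'_def a_def restr_weyl)
      then show ?thesis by (auto simp: b_def restr_def fun_eq_iff indicator_def)
    qed
    have dual: "(\<Sum>k<K. gnorm2 (fock_proj (weyl q (a k) + c \<odot> b k))) \<le> eigenvalue_sum K (A' \<union> B)" if "norm c = 1" for c
      by (rule \<Omega>'.eigenvalue_sum_dual[OF bessel[OF that] supp])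
    have pieces: "gnorm2 (fock_proj (weyl q (a k) + 1 \<odot> b k)) + gnorm2 (fock_proj (weyl q (a k) + (-1) \<odot> b k))
       = 2 * (gnorm2 (fock_proj (a k)) + gnorm2 (fock_proj (b k)))" if k: "k < K" for k
    proof -
      have e: "weyl q (a k) + 1 \<odot> b k = weyl q (a k) + b k" "weyl q (a k) + (-1) \<odot> b k = weyl q (a k) - b k"
        by (auto simp: fun_eq_iff)
      have P: "fock_proj (weyl q (a k) + b k) = weyl q (fock_proj (a k)) + fock_proj (b k)"
         "fock_proj (weyl q (a k) - b k) = weyl q (fock_proj (a k)) - fock_proj (b k)"
        using abL[OF k] by (simp_all add: fock_proj_add fock_proj_diff fock_proj_weyl weyl_L2)
      have F: "weyl q (fock_proj (a k)) \<in> gauss_L2" "fock_proj (b k) \<in> gauss_L2"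
        using abL[OF k] by (auto intro!: weyl_L2)
      show ?thesis unfolding e P gnorm2_add[OF F] gnorm2_diff[OF F]
        using abL[OF k] by (simp add: gnorm2_weyl)
    qed
    have cross: "gnorm2 (fock_proj (v k)) \<le> gnorm2 (fock_proj (a k)) + gnorm2 (fock_proj (b k)) + 2 * sqrt \<delta>" if k: "k < K" for k
    proof -
      have "restr (cball p D) (b k) = 0"
        using BD unfolding b_def restr_restr by (auto simp: restr_def fun_eq_iff indicator_def)
      moreover have "gnorm2 (b k) \<le> 1"
        unfolding b_def using gnorm2_restr_le[OF vL[OF k] sets(3)] one[OF k] by linarith
      ultimately have small: "gnorm2 (restr (cball p r) (fock_proj (b k))) \<le> \<delta>"
        using fock_proj_localised_at[OF D] abL[OF k] by blast
      have a1: "gnorm2 (a k) \<le> 1"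
        unfolding a_def using gnorm2_restr_le[OF vL[OF k] sets(2)] one[OF k] by linarith
      \<comment> \<open>As \<open>a k\<close> lives on the disc, its interaction with
        \<open>b k\<close> involves the projection of \<open>b k\<close> on that disc only, which is
        small because \<open>b k\<close> is supported far away.\<close>
      have "a k = restr (cball p r) (a k)" unfolding a_def restr_restr A_def by (simp add: Int_left_commute Int_commute)
      then have "fock_inner (fock_proj (a k)) (fock_proj (b k)) = fock_inner (a k) (restr (cball p r) (fock_proj (b k)))"
        using abL[OF k] fock_inner_restr[of "cball p r" "a k" "fock_proj (b k)"] by (simp add: fock_inner_proj)
      then have "(norm (fock_inner (fock_proj (a k)) (fock_proj (b k))))\<^sup>2 \<le> gnorm2 (a k) * gnorm2 (restr (cball p r) (fock_proj (b k)))"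
        using abL[OF k] by (simp add: fock_inner_Cauchy_Schwarz restr_L2)
      also have "\<dots> \<le> 1 * \<delta>" using a1 small by (intro mult_mono) auto
      finally have "norm (fock_inner (fock_proj (a k)) (fock_proj (b k))) \<le> sqrt \<delta>"
        by (intro real_le_rsqrt) simp
      then have "Re (fock_inner (fock_proj (a k)) (fock_proj (b k))) \<le> sqrt \<delta>"
        using complex_Re_le_cmod order_trans by blast
      moreover have "gnorm2 (fock_proj (v k)) = gnorm2 (fock_proj (a k)) + gnorm2 (fock_proj (b k)) + 2 * Re (fock_inner (fock_proj (a k)) (fock_proj (b k)))"
        unfolding vab[of k] using abL[OF k] by (simp add: fock_proj_add gnorm2_add)
      ultimately show ?thesis by simp
    qed
    have "eigenvalue_sum K \<Omega> \<le> (\<Sum>k<K. gnorm2 (fock_proj (a k)) + gnorm2 (fock_proj (b k)) + 2 * sqrt \<delta>)"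
      unfolding v(3)[symmetric] by (intro sum_mono cross) simp
    also have "\<dots> = (\<Sum>k<K. gnorm2 (fock_proj (a k)) + gnorm2 (fock_proj (b k))) + 2 * real K * sqrt \<delta>"
      by (simp add: sum.distrib)
    also have "2 * real K * sqrt \<delta> \<le> \<epsilon>"
      using \<epsilon> by (simp add: \<delta>(2) field_simps)
    also have "(\<Sum>k<K. gnorm2 (fock_proj (a k)) + gnorm2 (fock_proj (b k))) \<le> eigenvalue_sum K (A' \<union> B)"
    proof -
      have "2 * (\<Sum>k<K. gnorm2 (fock_proj (a k)) + gnorm2 (fock_proj (b k)))
         = (\<Sum>k<K. gnorm2 (fock_proj (weyl q (a k) + 1 \<odot> b k)) + gnorm2 (fock_proj (weyl q (a k) + (-1) \<odot> b k)))"
        unfolding sum_distrib_left by (intro sum.cong refl pieces[symmetric]) simp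
      also have "\<dots> \<le> eigenvalue_sum K (A' \<union> B) + eigenvalue_sum K (A' \<union> B)"
        unfolding sum.distrib by (intro add_mono dual) auto
      finally show ?thesis by simp
    qed
    finally have "eigenvalue_sum K \<Omega> - \<epsilon> \<le> eigenvalue_sum K (A' \<union> B)" by simp
    with \<Omega>' show "(+) q ` (\<Omega> \<inter> cball p r) \<union> (\<Omega> - cball p r) \<in> admissible s \<and>
        eigenvalue_sum K \<Omega> - \<epsilon> \<le> eigenvalue_sum K ((+) q ` (\<Omega> \<inter> cball p r) \<union> (\<Omega> - cball p r))"
      by (simp add: A'_def A_def B_def)
  qed
qed

text \<open>Weyl operators turn an optimal family for \<open>\<Omega>\<close> into a competitor for
  the translate. The reverse inequality is the case of \<open>- a\<close>.\<close>

lemma eigenvalue_sum_translation: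
  assumes s: "s > 0" and \<Omega>: "\<Omega> \<in> admissible s"
  shows "(+) a ` \<Omega> \<in> admissible s" "eigenvalue_sum K \<Omega> \<le> eigenvalue_sum K ((+) a ` \<Omega>)"
proof -
  show \<Omega>': "(+) a ` \<Omega> \<in> admissible s"
    using \<Omega> by (simp add: admissible_def emeasure_lebesgue_translation sets_lebesgue_translation)
  interpret \<Omega>: localization \<Omega> by (rule admissible_localization[OF s \<Omega>])
  interpret \<Omega>': localization "(+) a ` \<Omega>" by (rule admissible_localization[OF s \<Omega>'])
  obtain \<phi> where \<phi>: "orthonormal_family K \<phi>" "\<And>k. \<phi> k \<in> fock_space"
    "(\<Sum>k<K. gnorm2 (restr \<Omega> (\<phi> k))) = eigenvalue_sum K \<Omega>"
    using \<Omega>.eigenvalue_sum_primal_attained[of K] by blast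
  have "orthonormal_family K (\<lambda>k. weyl a (\<phi> k))"
    using \<phi>(1,2) by (simp add: orthonormal_family_def fock_inner_weyl weyl_L2)
  then have "(\<Sum>k<K. gnorm2 (restr ((+) a ` \<Omega>) (weyl a (\<phi> k)))) \<le> eigenvalue_sum K ((+) a ` \<Omega>)"
    using \<phi>(2) by (intro \<Omega>'.eigenvalue_sum_primal orthonormal_imp_bessel weyl_fock) auto
  also have "(\<Sum>k<K. gnorm2 (restr ((+) a ` \<Omega>) (weyl a (\<phi> k)))) = eigenvalue_sum K \<Omega>"
    unfolding \<phi>(3)[symmetric] restr_weyl using \<phi>(2) by (intro sum.cong refl gnorm2_weyl) auto
  finally show "eigenvalue_sum K \<Omega> \<le> eigenvalue_sum K ((+) a ` \<Omega>)" .
qed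

subsection \<open>Rearrangement of sets of given measure\<close>

lemma measure_lebesgue_cball: "r \<ge> 0 \<Longrightarrow> measure lebesgue (cball (c::complex) r) = pi * r\<^sup>2"
  by (simp add: content_cball unit_ball_vol_2)

lemma emeasure_lebesgue_cball_finite: "emeasure lebesgue (cball (c::complex) r) < \<infinity>"
  using emeasure_lborel_cball_finite[of c r] by simp

text \<open>Intermediate value theorem for the measure of the part of \<open>A\<close> in a growing
  disc, a Lipschitz function because annuli have area \<open>pi * (y\<^sup>2 - x\<^sup>2)\<close>.
  Continuity of measure from below supplies a large enough disc even if \<open>A\<close> has
  infinite measure.\<close>

lemma exists_subset_of_measure:
  fixes A :: "complex set"
  assumes A: "A \<in> sets lebesgue" and a: "0 \<le> a" "ennreal a \<le> emeasure lebesgue A"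
  shows "\<exists>B\<in>sets lebesgue. B \<subseteq> A \<and> emeasure lebesgue B = ennreal a"
proof (cases "emeasure lebesgue A = ennreal a")
  case False
  then have lt: "ennreal a < emeasure lebesgue A" using a by simp
  define F where "F r = measure lebesgue (A \<inter> cball 0 r)" for r
  have lm: "A \<inter> cball 0 r \<in> lmeasurable" for r
    using fmeasurable_Int_fmeasurable[OF lmeasurable_cball A, of 0 r] by (simp add: Int_commute)
  have em: "emeasure lebesgue (A \<inter> cball 0 r) = ennreal (F r)" for r
    unfolding F_def using lm[of r] by (simp add: emeasure_eq_measure2)
  have "(\<lambda>n. emeasure lebesgue (A \<inter> cball 0 (real n))) \<longlonglongrightarrow> emeasure lebesgue (\<Union>n. A \<inter> cball 0 (real n))"
    by (rule Lim_emeasure_incseq) (use A in \<open>auto simp: incseq_def intro!: sets.Int\<close>)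
  also have "(\<Union>n. A \<inter> cball 0 (real n)) = A"
    by (auto intro: real_arch_simple)
  finally have "\<forall>\<^sub>F n in sequentially. ennreal a < emeasure lebesgue (A \<inter> cball 0 (real n))"
    using lt by (rule order_tendstoD)
  then obtain n :: nat where "ennreal a < emeasure lebesgue (A \<inter> cball 0 (real n))"
    by (auto simp: eventually_sequentially)
  then have n: "a \<le> F (real n)" using a by (simp add: em ennreal_less_iff)
  have "F 0 \<le> measure lebesgue (cball (0::complex) 0)"
    unfolding F_def by (intro measure_mono_fmeasurable lmeasurable_cball Int_lower2 fmeasurableD lm)
  then have F0: "F 0 \<le> a" using a measure_lebesgue_cball[of 0 0] by simp
  have step: "\<bar>F y - F x\<bar> \<le> 2 * pi * real n * (y - x)" if xy: "0 \<le> x" "x \<le> y" "y \<le> real n" for x y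
  proof -
    have 1: "F x \<le> F y"
      unfolding F_def using xy lm by (intro measure_mono_fmeasurable) (auto intro: fmeasurableD)
    have 2: "F y - F x = measure lebesgue (A \<inter> cball 0 y - A \<inter> cball 0 x)"
      unfolding F_def using xy lm by (intro measurable_measure_Diff[symmetric]) (auto intro: fmeasurableD)
    have 3: "measure lebesgue (A \<inter> cball 0 y - A \<inter> cball 0 x) \<le> measure lebesgue (cball (0::complex) y - cball 0 x)"
      by (intro measure_mono_fmeasurable fmeasurable_Diff lmeasurable_cball sets.Diff fmeasurableD[OF lm]) auto
    have 4: "measure lebesgue (cball (0::complex) y - cball 0 x) = measure lebesgue (cball (0::complex) y) - measure lebesgue (cball (0::complex) x)"
      using xy by (intro measurable_measure_Diff) auto
    have "pi * y\<^sup>2 - pi * x\<^sup>2 = pi * (y + x) * (y - x)" by (simp add: power2_eq_square algebra_simps)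
    also have "\<dots> \<le> pi * (2 * real n) * (y - x)"
      using xy by (intro mult_right_mono mult_left_mono) auto
    finally have "F y - F x \<le> pi * (2 * real n) * (y - x)"
      using 2 3 4 measure_lebesgue_cball[of y 0] measure_lebesgue_cball[of x 0] xy by linarith
    with 1 show ?thesis by (simp add: mult_ac)
  qed
  have "(2 * pi * real n)-lipschitz_on {0..real n} F"
  proof (rule lipschitz_onI)
    fix x y assume "x \<in> {0..real n}" "y \<in> {0..real n}"
    then show "dist (F x) (F y) \<le> 2 * pi * real n * dist x y"
      using step[of x y] step[of y x] by (cases "x \<le> y") (auto simp: dist_real_def abs_minus_commute)
  qed simp
  then have "continuous_on {0..real n} F" by (rule lipschitz_on_continuous_on)
  then obtain x where "F x = a" using IVT'[of F 0 a "real n"] F0 n by auto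
  then show ?thesis using em[of x] A by (intro bexI[of _ "A \<inter> cball 0 x"]) auto
qed (use A in auto)

text \<open>Subtract \<open>t\<close> from \<open>u\<close>. As both sets have measure
  \<open>s\<close>, both integrals drop by the same amount, and then the integrand is nonpositive on
  the part given up and nonnegative on the part gained.\<close>

lemma admissible_integral_exchange:
  fixes u :: "complex \<Rightarrow> real"
  assumes s: "s > 0" and \<Omega>: "\<Omega> \<in> admissible s" "\<Omega>' \<in> admissible s" and u: "integrable lebesgue u"
    and ge: "\<And>z. z \<in> \<Omega>' - \<Omega> \<Longrightarrow> t \<le> u z" and le: "\<And>z. z \<in> \<Omega> - \<Omega>' \<Longrightarrow> u z \<le> t"
  shows "(LINT z:\<Omega>|lebesgue. u z) \<le> (LINT z:\<Omega>'|lebesgue. u z)"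
proof -
  have i: "set_integrable lebesgue A u" "set_integrable lebesgue A (\<lambda>_. t)"
    "(LINT z:A|lebesgue. t) = t * s" if "A \<in> admissible s" for A
  proof -
    have A: "A \<in> sets lebesgue" "emeasure lebesgue A = ennreal s" using that by (auto simp: admissible_def)
    show "set_integrable lebesgue A u"
      unfolding set_integrable_def by (rule integrable_mult_indicator[OF A(1) u])
    have "emeasure lebesgue A < \<infinity>" unfolding A(2) by simp
    then show "set_integrable lebesgue A (\<lambda>_. t)"
      unfolding set_integrable_def by (intro integrable_scaleR_left integrable_real_indicator A(1))
    have "measure lebesgue A = s" using A s by (simp add: measure_def)
    then show "(LINT z:A|lebesgue. t) = t * s"
      using A by (simp add: set_lebesgue_integral_def mult.commute)
  qed
  have "(LINT z:\<Omega>|lebesgue. u z) - t * s = (LINT z:\<Omega>|lebesgue. u z - t)"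
    using i[OF \<Omega>(1)] by simp
  also have "\<dots> \<le> (LINT z:\<Omega>'|lebesgue. u z - t)"
    unfolding set_lebesgue_integral_def
  proof (rule integral_mono)
    show "integrable lebesgue (\<lambda>z. indicat_real \<Omega> z *\<^sub>R (u z - t))" "integrable lebesgue (\<lambda>z. indicat_real \<Omega>' z *\<^sub>R (u z - t))"
      using set_integral_diff(1)[OF i(1,2)[OF \<Omega>(1)]] set_integral_diff(1)[OF i(1,2)[OF \<Omega>(2)]]
      by (simp_all add: set_integrable_def)
    show "indicat_real \<Omega> z *\<^sub>R (u z - t) \<le> indicat_real \<Omega>' z *\<^sub>R (u z - t)" for z
      using ge[of z] le[of z] by (auto simp: indicator_def)
  qed
  also have "\<dots> = (LINT z:\<Omega>'|lebesgue. u z) - t * s"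
    using i[OF \<Omega>(2)] by simp
  finally show ?thesis by simp
qed

text \<open>The maximiser consists of everything above the critical level \<open>\<tau>\<close> and
  a piece of the level set itself. The level set may have positive measure and must then be divided
  to reach the measure \<open>s\<close> exactly.\<close>

lemma bathtub:
  fixes u :: "complex \<Rightarrow> real"
  assumes s: "s > 0" and u: "integrable lebesgue u" and nn: "\<And>z. u z \<ge> 0"
    and B: "B \<in> sets lebesgue" "emeasure lebesgue B < \<infinity>" "ennreal s \<le> emeasure lebesgue B"
  shows "\<exists>\<Omega>\<in>admissible s. \<forall>\<Omega>'\<in>admissible s. \<Omega>' \<subseteq> B \<longrightarrow> (LINT z:\<Omega>'|lebesgue. u z) \<le> (LINT z:\<Omega>|lebesgue. u z)"
proof -
  have um [measurable]: "u \<in> borel_measurable lebesgue" using u by auto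
  define L where "L t = B \<inter> {z. u z > t}" for t
  define F where "F t = emeasure lebesgue (L t)" for t
  have Ls: "L t \<in> sets lebesgue" for t
  proof -
    have "{z \<in> space lebesgue. u z > t} \<in> sets lebesgue" by measurable
    then show ?thesis using B unfolding L_def by auto
  qed
  have Lmono: "t \<le> t' \<Longrightarrow> L t' \<subseteq> L t" for t t' by (auto simp: L_def)
  have Fmono: "t \<le> t' \<Longrightarrow> F t' \<le> F t" for t t'
    unfolding F_def by (intro emeasure_mono Lmono Ls)
  have Ffin: "F t \<noteq> \<infinity>" for t
  proof -
    have "F t \<le> emeasure lebesgue B" unfolding F_def using B by (intro emeasure_mono) (auto simp: L_def)
    then show ?thesis using B(2) by (auto simp: less_top top_unique)
  qed
  define T where "T = {t. 0 \<le> t \<and> F t \<le> ennreal s}"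
  have "(\<lambda>n. F (real n)) \<longlonglongrightarrow> emeasure lebesgue (\<Inter>n. L (real n))"
    unfolding F_def
    by (rule Lim_emeasure_decseq) (use Ls Ffin in \<open>auto simp: decseq_def L_def F_def\<close>)
  also have "(\<Inter>n. L (real n)) = {}"
  proof -
    have "\<exists>n. z \<notin> L (real n)" for z
      using real_arch_simple[of "u z"] by (auto simp: L_def not_less)
    then show ?thesis by auto
  qed
  finally have "\<forall>\<^sub>F n in sequentially. F (real n) < ennreal s"
    using s by (intro order_tendstoD) auto
  then obtain n where "F (real n) < ennreal s" by (auto simp: eventually_sequentially)
  then have "real n \<in> T" by (simp add: T_def less_imp_le)
  then have Tne: "T \<noteq> {}" by blast
  have Tbdd: "bdd_below T" by (auto simp: T_def intro!: bdd_belowI[of _ 0])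
  define \<tau> where "\<tau> = Inf T"
  have \<tau>0: "\<tau> \<ge> 0" unfolding \<tau>_def using Tne by (intro cInf_greatest) (auto simp: T_def)
  have above: "F t \<le> ennreal s" if gt: "t > \<tau>" for t
  proof -
    obtain t' where "t' \<in> T" "t' < t" using gt cInf_less_iff[OF Tne Tbdd, of t] unfolding \<tau>_def by blast
    then show ?thesis using Fmono[of t' t] by (auto simp: T_def)
  qed
  have below: "ennreal s < F t" if "0 \<le> t" "t < \<tau>" for t
  proof (rule ccontr)
    assume "\<not> ?thesis"
    then have "t \<in> T" using that by (simp add: T_def)
    then have "\<tau> \<le> t" unfolding \<tau>_def using Tbdd by (rule cInf_lower)
    with that show False by simp
  qed
  have F\<tau>: "F \<tau> \<le> ennreal s"
  proof (rule LIMSEQ_le_const2)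
    have "(\<lambda>n. F (\<tau> + 1 / real (Suc n))) \<longlonglongrightarrow> emeasure lebesgue (\<Union>n. L (\<tau> + 1 / real (Suc n)))"
      unfolding F_def
    proof (rule Lim_emeasure_incseq)
      show "range (\<lambda>n. L (\<tau> + 1 / real (Suc n))) \<subseteq> sets lebesgue" using Ls by blast
      show "incseq (\<lambda>n. L (\<tau> + 1 / real (Suc n)))"
        unfolding incseq_def by (intro allI impI Lmono add_left_mono divide_left_mono) auto
    qed
    also have "(\<Union>n. L (\<tau> + 1 / real (Suc n))) = L \<tau>"
    proof (intro equalityI subsetI)
      fix z assume z: "z \<in> L \<tau>"
      then obtain n where "1 / real (Suc n) < u z - \<tau>"
        using nat_approx_posE[of "u z - \<tau>"] by (auto simp: L_def)
      then show "z \<in> (\<Union>n. L (\<tau> + 1 / real (Suc n)))" using z by (auto simp: L_def intro!: exI[of _ n])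
    next
      fix z assume "z \<in> (\<Union>n. L (\<tau> + 1 / real (Suc n)))"
      then obtain n where "z \<in> L (\<tau> + 1 / real (Suc n))" by blast
      then show "z \<in> L \<tau>" using Lmono[of \<tau> "\<tau> + 1 / real (Suc n)"] by auto
    qed
    finally show "(\<lambda>n. F (\<tau> + 1 / real (Suc n))) \<longlonglongrightarrow> F \<tau>" by (simp add: F_def)
    show "\<exists>N. \<forall>n\<ge>N. F (\<tau> + 1 / real (Suc n)) \<le> ennreal s"
      by (intro exI[of _ 0] allI impI above) simp
  qed
  define E where "E = B \<inter> {z. u z = \<tau>}"
  have Es: "E \<in> sets lebesgue"
  proof -
    have "{z \<in> space lebesgue. u z = \<tau>} \<in> sets lebesgue" by measurable
    then show ?thesis using B unfolding E_def by auto
  qed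
  have LE: "L \<tau> \<inter> E = {}" by (auto simp: L_def E_def)
  have ge: "ennreal s \<le> emeasure lebesgue (L \<tau> \<union> E)"
  \<comment> \<open>Level 0 cannot be approached from smaller nonnegative levels; there
    \<open>u \<ge> 0\<close> makes the two sets exhaust \<open>B\<close>.\<close>
  proof (cases "\<tau> = 0")
    case True
    then have "L \<tau> \<union> E = B" using nn by (auto simp: L_def E_def order_le_less)
    then show ?thesis using B by simp
  next
    case False
    then have pos: "\<tau> > 0" using \<tau>0 by simp
    define x where "x n = \<tau> - \<tau> / real (Suc n)" for n
    have x: "0 \<le> x n" "x n < \<tau>" for n using pos by (auto simp: x_def field_simps)
    have xm: "x m \<le> x n" if "m \<le> n" for m n
      unfolding x_def using pos that by (intro diff_left_mono divide_left_mono) auto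
    have "(\<lambda>n. F (x n)) \<longlonglongrightarrow> emeasure lebesgue (\<Inter>n. L (x n))"
      unfolding F_def
      by (rule Lim_emeasure_decseq) (use Ls Ffin xm Lmono in \<open>auto simp: decseq_def F_def\<close>)
    also have "(\<Inter>n. L (x n)) = L \<tau> \<union> E"
    proof (intro equalityI subsetI)
      fix z assume z: "z \<in> (\<Inter>n. L (x n))"
      have "\<tau> \<le> u z"
      proof (rule LIMSEQ_le_const2)
        show "x \<longlonglongrightarrow> \<tau>"
          using tendsto_diff[OF tendsto_const LIMSEQ_Suc[OF lim_const_over_n[of \<tau>]], of \<tau>] by (simp add: x_def[abs_def])
        show "\<exists>N. \<forall>n\<ge>N. x n \<le> u z" using z by (auto simp: L_def intro: less_imp_le)
      qed
      then show "z \<in> L \<tau> \<union> E" using z by (auto simp: L_def E_def)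
    next
      fix z assume "z \<in> L \<tau> \<union> E"
      then have "z \<in> B" "\<tau> \<le> u z" by (auto simp: L_def E_def)
      then show "z \<in> (\<Inter>n. L (x n))" using x(2) by (auto simp: L_def intro: less_le_trans)
    qed
    finally show ?thesis
      using below[OF x] by (intro LIMSEQ_le_const) (auto intro: less_imp_le)
  qed
  define a where "a = s - enn2real (F \<tau>)"
  have Fr: "F \<tau> = ennreal (enn2real (F \<tau>))" using Ffin[of \<tau>] by (simp add: less_top)
  have a0: "a \<ge> 0"
  proof -
    have "enn2real (F \<tau>) \<le> s" using F\<tau> s by (subst (asm) Fr) (simp add: ennreal_le_iff)
    then show ?thesis by (simp add: a_def)
  qed
  have sa: "ennreal s = F \<tau> + ennreal a"
    using a0 by (subst Fr) (simp add: a_def ennreal_plus[symmetric] del: ennreal_plus)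
  have "emeasure lebesgue (L \<tau> \<union> E) = F \<tau> + emeasure lebesgue E"
    unfolding F_def using Ls Es LE by (intro plus_emeasure[symmetric]) auto
  with ge sa have "ennreal a \<le> emeasure lebesgue E"
    using Ffin[of \<tau>] by (simp add: ennreal_add_left_cancel_le)
  then obtain C where C: "C \<in> sets lebesgue" "C \<subseteq> E" "emeasure lebesgue C = ennreal a"
    using exists_subset_of_measure[OF Es a0] by blast
  define \<Omega> where "\<Omega> = L \<tau> \<union> C"
  have "emeasure lebesgue \<Omega> = F \<tau> + emeasure lebesgue C"
    unfolding F_def \<Omega>_def using Ls C LE by (intro plus_emeasure[symmetric]) auto
  then have \<Omega>: "\<Omega> \<in> admissible s" using C Ls sa by (simp add: admissible_def \<Omega>_def)
  show ?thesis
  proof (intro bexI[OF _ \<Omega>] ballI impI)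
    fix \<Omega>' assume \<Omega>': "\<Omega>' \<in> admissible s" "\<Omega>' \<subseteq> B"
    show "(LINT z:\<Omega>'|lebesgue. u z) \<le> (LINT z:\<Omega>|lebesgue. u z)"
    proof (rule admissible_integral_exchange[OF s \<Omega>'(1) \<Omega> u, of \<tau>])
      show "\<tau> \<le> u z" if "z \<in> \<Omega> - \<Omega>'" for z using that C(2) by (auto simp: \<Omega>_def L_def E_def)
      show "u z \<le> \<tau>" if "z \<in> \<Omega>' - \<Omega>" for z using that \<Omega>'(2) by (auto simp: \<Omega>_def L_def)
    qed
  qed
qed

subsection \<open>Compactness within a disc\<close>

definition fock_density :: "nat \<Rightarrow> (nat \<Rightarrow> complex \<Rightarrow> complex) \<Rightarrow> complex \<Rightarrow> real" where
  "fock_density K \<phi> z = (\<Sum>k<K. wsq (\<phi> k) z)"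

lemma fock_density_nonneg: "fock_density K \<phi> z \<ge> 0"
  by (simp add: fock_density_def sum_nonneg)

lemma integrable_fock_density:
  "(\<And>k. k < K \<Longrightarrow> \<phi> k \<in> gauss_L2) \<Longrightarrow> integrable lebesgue (fock_density K \<phi>)"
  unfolding fock_density_def[abs_def] by (intro Bochner_Integration.integrable_sum gauss_L2_integrable) auto

lemma sum_gnorm2_restr:
  assumes "\<And>k. k < K \<Longrightarrow> \<phi> k \<in> gauss_L2" "A \<in> sets lebesgue"
  shows "(\<Sum>k<K. gnorm2 (restr A (\<phi> k))) = (LINT z:A|lebesgue. fock_density K \<phi> z)"
proof -
  have "(LINT z:A|lebesgue. fock_density K \<phi> z) = (LINT z|lebesgue. (\<Sum>k<K. indicator A z *\<^sub>R (wsq (\<phi> k) z)))"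
    by (simp add: set_lebesgue_integral_def fock_density_def sum_distrib_left)
  also have "\<dots> = (\<Sum>k<K. LINT z|lebesgue. indicator A z *\<^sub>R (wsq (\<phi> k) z))"
    using assms by (intro Bochner_Integration.integral_sum integrable_mult_indicator gauss_L2_integrable) auto
  finally show ?thesis by (simp add: gnorm2_restr_set_integral set_lebesgue_integral_def)
qed

lemma fock_common_subsequence:
  fixes \<phi> :: "nat \<Rightarrow> nat \<Rightarrow> complex \<Rightarrow> complex"
  assumes "\<And>n k. k < K \<Longrightarrow> \<phi> n k \<in> fock_space" "\<And>n k. k < K \<Longrightarrow> gnorm2 (\<phi> n k) \<le> B"
  shows "\<exists>\<psi> r. strict_mono (r :: nat \<Rightarrow> nat) \<and> (\<forall>k<K. \<psi> k \<in> fock_space \<and> gnorm2 (\<psi> k) \<le> B \<and>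
     (\<forall>z. (\<lambda>n. \<phi> (r n) k z) \<longlonglongrightarrow> \<psi> k z))"
  using assms
proof (induction K)
  case 0
  show ?case by (intro exI[of _ "\<lambda>_. 0"] exI[of _ id]) (simp add: strict_mono_def)
next
  case (Suc K)
  then obtain \<psi> r where r: "strict_mono (r :: nat \<Rightarrow> nat)" "\<And>k. k < K \<Longrightarrow> \<psi> k \<in> fock_space"
    "\<And>k. k < K \<Longrightarrow> gnorm2 (\<psi> k) \<le> B" "\<And>k z. k < K \<Longrightarrow> (\<lambda>n. \<phi> (r n) k z) \<longlonglongrightarrow> \<psi> k z"
    by (metis less_SucI)
  obtain h \<rho> where h: "h \<in> fock_space" "gnorm2 h \<le> B" "strict_mono (\<rho> :: nat \<Rightarrow> nat)"
    "\<And>z. (\<lambda>n. \<phi> (r (\<rho> n)) K z) \<longlonglongrightarrow> h z"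
    using fock_bounded_subsequence[of "\<lambda>n. \<phi> (r n) K" B] Suc.prems by blast
  have "(\<lambda>n. \<phi> (r (\<rho> n)) k z) \<longlonglongrightarrow> \<psi> k z" if "k < K" for k z
    using LIMSEQ_subseq_LIMSEQ[OF r(4)[OF that] h(3)] by (simp add: comp_def)
  then show ?case
    using r h by (intro exI[of _ "\<psi>(K := h)"] exI[of _ "r \<circ> \<rho>"])
      (auto simp: less_Suc_eq intro: strict_mono_o[OF r(1) h(3), unfolded comp_def])
qed

text \<open>The error depends on \<open>B\<close> alone. The sets \<open>A\<close> vary along the
  maximising sequence, so the estimate has to be uniform in them.\<close>

lemma gnorm2_restr_diff_le:
  assumes f: "f \<in> gauss_L2" "g \<in> gauss_L2" "gnorm2 g \<le> 1" and A: "A \<in> sets lebesgue" "B \<in> sets lebesgue" "A \<subseteq> B"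
    and \<delta>: "gnorm2 (restr B (f - g)) \<le> \<delta>"
  shows "gnorm2 (restr A f) \<le> gnorm2 (restr A g) + \<delta> + 2 * sqrt \<delta>"
proof -
  define x where "x = restr A (f - g)"
  define y where "y = restr A g"
  have L: "x \<in> gauss_L2" "y \<in> gauss_L2" using f A by (auto simp: x_def y_def)
  have "restr A f = x + y" by (simp add: x_def y_def restr_diff)
  then have "gnorm2 (restr A f) = gnorm2 x + gnorm2 y + 2 * Re (fock_inner x y)"
    using gnorm2_add[OF L] by simp
  moreover have x: "gnorm2 x \<le> \<delta>"
    unfolding x_def using gnorm2_restr_mono[of "f - g" A B] f A \<delta> by (auto intro: order_trans)
  moreover have "Re (fock_inner x y) \<le> sqrt \<delta>"
  proof -
    have y1: "gnorm2 y \<le> 1" unfolding y_def using gnorm2_restr_le[OF f(2) A(1)] f(3) by linarith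
    have "(norm (fock_inner x y))\<^sup>2 \<le> gnorm2 x * gnorm2 y" by (rule fock_inner_Cauchy_Schwarz[OF L])
    also have "\<dots> \<le> \<delta> * 1" using x y1 order_trans[OF gnorm2_nonneg x] by (intro mult_mono) auto
    finally have "norm (fock_inner x y) \<le> sqrt \<delta>" by (intro real_le_rsqrt) simp
    then show ?thesis using complex_Re_le_cmod order_trans by blast
  qed
  ultimately show ?thesis by (simp add: y_def)
qed

lemma admissible_nonempty: "s > 0 \<Longrightarrow> \<exists>\<Omega>. \<Omega> \<in> admissible s"
proof -
  assume s: "s > 0"
  have U: "UNIV \<in> sets (lebesgue :: complex measure)" by simp
  have "ennreal s \<le> emeasure lebesgue (UNIV :: complex set)" by simp
  from exists_subset_of_measure[OF U less_imp_le[OF s] this] show ?thesis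
    unfolding admissible_def by blast
qed

lemma eigenvalue_sum_bdd: "s > 0 \<Longrightarrow> \<Omega> \<in> admissible s \<Longrightarrow> eigenvalue_sum K \<Omega> \<le> fock_const * s"
  using localization.eigenvalue_sum_le[OF admissible_localization, of s \<Omega> K]
  by (auto simp: admissible_def measure_def)

text \<open>Near optimal eigenfunctions converge pointwise along a subsequence; optimising the set against the
  limit density then does at least as well.\<close>

lemma eigenvalue_sum_maximiser_in_ball:
  assumes s: "s > 0"
  shows "\<exists>\<Omega>\<in>admissible s. \<forall>\<Omega>'\<in>admissible s. \<Omega>' \<subseteq> cball 0 R \<longrightarrow> eigenvalue_sum K \<Omega>' \<le> eigenvalue_sum K \<Omega>"
proof (cases "\<exists>\<Omega>\<in>admissible s. \<Omega> \<subseteq> cball 0 R")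
  \<comment> \<open>The disc has no admissible subset, the comparison is vacuous, and any admissible
    set will do.\<close>
  case False
  then show ?thesis using admissible_nonempty[OF s] by blast
next
  case True
  define B where "B = cball (0::complex) R"
  have B: "B \<in> sets lebesgue" "emeasure lebesgue B < \<infinity>"
    unfolding B_def using emeasure_lebesgue_cball_finite by auto
  define \<A> where "\<A> = {\<Omega> \<in> admissible s. \<Omega> \<subseteq> B}"
  have ne: "\<A> \<noteq> {}" using True by (auto simp: \<A>_def B_def)
  then obtain \<Omega>0 where "\<Omega>0 \<in> admissible s" "\<Omega>0 \<subseteq> B" by (auto simp: \<A>_def)
  then have sB: "ennreal s \<le> emeasure lebesgue B"
    using emeasure_mono[of \<Omega>0 B lebesgue] B by (simp add: admissible_def)
  define X where "X = (SUP \<Omega>\<in>\<A>. eigenvalue_sum K \<Omega>)"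
  have bdd: "bdd_above (eigenvalue_sum K ` \<A>)"
    by (rule bdd_aboveI2[of _ _ "fock_const * s"]) (auto simp: \<A>_def intro: eigenvalue_sum_bdd[OF s])
  have "\<exists>\<Omega>\<in>\<A>. X - 1 / real (Suc n) < eigenvalue_sum K \<Omega>" for n
    using less_cSUP_iff[OF ne bdd, of "X - 1 / real (Suc n)"] by (simp add: X_def)
  then obtain \<Omega> where \<Omega>: "\<And>n. \<Omega> n \<in> \<A>" "\<And>n. X - 1 / real (Suc n) < eigenvalue_sum K (\<Omega> n)" by metis
  have \<Omega>a: "\<Omega> n \<in> admissible s" "\<Omega> n \<subseteq> B" "\<Omega> n \<in> sets lebesgue" for n
    using \<Omega>(1)[of n] by (auto simp: \<A>_def admissible_def)
  have "\<forall>n. \<exists>\<phi>. orthonormal_family K \<phi> \<and> (\<forall>k. \<phi> k \<in> fock_space) \<and>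
      (\<Sum>k<K. gnorm2 (restr (\<Omega> n) (\<phi> k))) = eigenvalue_sum K (\<Omega> n)"
    using localization.eigenvalue_sum_primal_attained[OF admissible_localization[OF s \<Omega>a(1)]] by blast
  then obtain \<phi> where \<phi>: "\<And>n. orthonormal_family K (\<phi> n)" "\<And>n k. \<phi> n k \<in> fock_space"
    "\<And>n. (\<Sum>k<K. gnorm2 (restr (\<Omega> n) (\<phi> n k))) = eigenvalue_sum K (\<Omega> n)"
    by metis
  have \<phi>1: "gnorm2 (\<phi> n k) \<le> 1" if "k < K" for n k
    by (rule bessel_gnorm2_le_1[OF orthonormal_imp_bessel[OF \<phi>(1)] that])
  have ex: "\<exists>\<psi> r. strict_mono (r :: nat \<Rightarrow> nat) \<and> (\<forall>k<K. \<psi> k \<in> fock_space \<and> gnorm2 (\<psi> k) \<le> 1 \<and>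
     (\<forall>z. (\<lambda>n. \<phi> (r n) k z) \<longlonglongrightarrow> \<psi> k z))"
    by (rule fock_common_subsequence) (use \<phi>(2) \<phi>1 in auto)
  obtain \<psi> r where r: "strict_mono (r :: nat \<Rightarrow> nat)" and \<psi>all: "\<forall>k<K. \<psi> k \<in> fock_space \<and> gnorm2 (\<psi> k) \<le> 1 \<and>
     (\<forall>z. (\<lambda>n. \<phi> (r n) k z) \<longlonglongrightarrow> \<psi> k z)"
    using ex by blast
  have \<psi>: "\<psi> k \<in> fock_space" "gnorm2 (\<psi> k) \<le> 1" "(\<lambda>n. \<phi> (r n) k z) \<longlonglongrightarrow> \<psi> k z" if "k < K" for k z
    using \<psi>all that by blast+
  have \<psi>L: "\<psi> k \<in> gauss_L2" if "k < K" for k using \<psi>(1)[OF that] by simp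
  \<comment> \<open>Mass may escape in the limit and orthonormality may be lost. The Gram bound
    survives, by Fatou's lemma for every linear combination.\<close>
  have bessel: "bessel_family K \<psi>"
    unfolding bessel_family_def
  proof (intro conjI allI impI \<psi>L)
    fix c :: "nat \<Rightarrow> complex"
    show "gnorm2 (\<Sum>k<K. c k \<odot> \<psi> k) \<le> (\<Sum>k<K. (norm (c k))\<^sup>2)"
    proof (rule gnorm2_Fatou(2)[where f = "\<lambda>n. \<Sum>k<K. c k \<odot> \<phi> (r n) k"])
      show "(\<Sum>k<K. c k \<odot> \<phi> (r n) k) \<in> gauss_L2" for n
        using \<phi>(2) by (intro gauss_L2_sum gauss_L2_scale) auto
      show "(\<lambda>n. (\<Sum>k<K. c k \<odot> \<phi> (r n) k) z) \<longlonglongrightarrow> (\<Sum>k<K. c k \<odot> \<psi> k) z" for z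
        unfolding sum_fun_apply cscale_apply using \<psi>(3) by (intro tendsto_intros) auto
      show "\<forall>\<^sub>F n in sequentially. gnorm2 (\<Sum>k<K. c k \<odot> \<phi> (r n) k) \<le> (\<Sum>k<K. (norm (c k))\<^sup>2)"
        by (simp add: gnorm2_orthonormal_sum[OF \<phi>(1)])
    qed
  qed
  have "\<exists>\<Omega>\<in>admissible s. \<forall>\<Omega>'\<in>admissible s. \<Omega>' \<subseteq> B \<longrightarrow>
      (LINT z:\<Omega>'|lebesgue. fock_density K \<psi> z) \<le> (LINT z:\<Omega>|lebesgue. fock_density K \<psi> z)"
    by (rule bathtub[OF s _ fock_density_nonneg B sB]) (intro integrable_fock_density \<psi>L)
  then obtain \<Omega>m where \<Omega>m: "\<Omega>m \<in> admissible s" "\<forall>\<Omega>'\<in>admissible s. \<Omega>' \<subseteq> B \<longrightarrow>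
      (LINT z:\<Omega>'|lebesgue. fock_density K \<psi> z) \<le> (LINT z:\<Omega>m|lebesgue. fock_density K \<psi> z)"
    by (elim bexE)
  have \<Omega>ms: "\<Omega>m \<in> sets lebesgue" using \<Omega>m(1) by (simp add: admissible_def)
  define \<delta> where "\<delta> n k = gnorm2 (restr B (\<phi> (r n) k - \<psi> k))" for n k
  have \<delta>: "(\<lambda>n. \<delta> n k) \<longlonglongrightarrow> 0" if "k < K" for k
    unfolding \<delta>_def by (rule fock_tendsto_restr_diff[of "\<lambda>n. \<phi> (r n) k" 1])
      (use \<phi>(2) \<phi>1 \<psi> B that in auto)
  have upper: "eigenvalue_sum K (\<Omega> (r n)) \<le> eigenvalue_sum K \<Omega>m + (\<Sum>k<K. \<delta> n k + 2 * sqrt (\<delta> n k))" for n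
  proof -
    have "eigenvalue_sum K (\<Omega> (r n)) \<le> (\<Sum>k<K. gnorm2 (restr (\<Omega> (r n)) (\<psi> k)) + (\<delta> n k + 2 * sqrt (\<delta> n k)))"
      unfolding \<phi>(3)[symmetric]
    proof (rule sum_mono)
      fix k assume "k \<in> {..<K}"
      then have k: "k < K" by simp
      have "gnorm2 (restr (\<Omega> (r n)) (\<phi> (r n) k)) \<le> gnorm2 (restr (\<Omega> (r n)) (\<psi> k)) + \<delta> n k + 2 * sqrt (\<delta> n k)"
        by (rule gnorm2_restr_diff_le[where B=B])
          (use \<phi>(2) \<psi>L[OF k] \<psi>(2)[OF k] \<Omega>a B in \<open>auto simp: \<delta>_def\<close>)
      then show "gnorm2 (restr (\<Omega> (r n)) (\<phi> (r n) k)) \<le> gnorm2 (restr (\<Omega> (r n)) (\<psi> k)) + (\<delta> n k + 2 * sqrt (\<delta> n k))"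
        by simp
    qed
    also have "\<dots> = (LINT z:\<Omega> (r n)|lebesgue. fock_density K \<psi> z) + (\<Sum>k<K. \<delta> n k + 2 * sqrt (\<delta> n k))"
      using sum_gnorm2_restr[OF \<psi>L \<Omega>a(3)[of "r n"]] by (simp add: sum.distrib)
    also have "(LINT z:\<Omega> (r n)|lebesgue. fock_density K \<psi> z) \<le> (LINT z:\<Omega>m|lebesgue. fock_density K \<psi> z)"
      by (rule \<Omega>m(2)[rule_format, OF \<Omega>a(1,2)])
    also have "(LINT z:\<Omega>m|lebesgue. fock_density K \<psi> z) = (\<Sum>k<K. gnorm2 (restr \<Omega>m (\<psi> k)))"
      using sum_gnorm2_restr[OF \<psi>L \<Omega>ms] by simp
    also have "\<dots> \<le> eigenvalue_sum K \<Omega>m"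
      using localization.eigenvalue_sum_primal[OF admissible_localization[OF s \<Omega>m(1)] bessel \<psi>(1)] .
    finally show ?thesis by simp
  qed
  have "X \<le> eigenvalue_sum K \<Omega>m"
  proof (rule LIMSEQ_le)
    have "(\<lambda>n. 1 / real (Suc (r n))) \<longlonglongrightarrow> 0"
      using LIMSEQ_subseq_LIMSEQ[OF LIMSEQ_Suc[OF lim_1_over_n] r] by (simp add: comp_def)
    then show "(\<lambda>n. X - 1 / real (Suc (r n))) \<longlonglongrightarrow> X"
      using tendsto_diff[OF tendsto_const, of _ 0 sequentially X] by simp
    have "(\<lambda>n. eigenvalue_sum K \<Omega>m + (\<Sum>k<K. \<delta> n k + 2 * sqrt (\<delta> n k)))
       \<longlonglongrightarrow> eigenvalue_sum K \<Omega>m + (\<Sum>k<K. 0 + 2 * sqrt 0)"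
      using \<delta> by (intro tendsto_intros) auto
    then show "(\<lambda>n. eigenvalue_sum K \<Omega>m + (\<Sum>k<K. \<delta> n k + 2 * sqrt (\<delta> n k))) \<longlonglongrightarrow> eigenvalue_sum K \<Omega>m" by simp
    show "\<exists>N. \<forall>n\<ge>N. X - 1 / real (Suc (r n)) \<le> eigenvalue_sum K \<Omega>m + (\<Sum>k<K. \<delta> n k + 2 * sqrt (\<delta> n k))"
      using \<Omega>(2) upper by (meson less_imp_le order_trans)
  qed
  moreover have "eigenvalue_sum K \<Omega>' \<le> X" if "\<Omega>' \<in> admissible s" "\<Omega>' \<subseteq> cball 0 R" for \<Omega>'
    unfolding X_def by (rule cSUP_upper[OF _ bdd]) (use that in \<open>auto simp: \<A>_def B_def\<close>)
  ultimately show ?thesis using \<Omega>m(1) by (meson order_trans)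
qed

subsection \<open>Superlevel sets\<close>

text \<open>Counterexamples for the levels \<open>1 / real (Suc n)\<close> converge along a
  subsequence to some nonzero \<open>g\<close>. Its nonzero set has infinite measure, and each of
  its points eventually lies in the superlevel sets, so Fatou's lemma for indicators contradicts the
  bound \<open>s\<close>.\<close>

lemma fock_superlevel_large_at_0:
  assumes c: "c > 0"
  shows "\<exists>t>0. \<forall>f\<in>fock_space. gnorm2 f \<le> 1 \<longrightarrow> c \<le> (norm (f 0))\<^sup>2 \<longrightarrow>
    ennreal s \<le> emeasure lebesgue {z. t \<le> wsq f z}"
proof (rule ccontr)
  assume neg: "\<not> ?thesis"
  have small: "\<exists>f\<in>fock_space. gnorm2 f \<le> 1 \<and> c \<le> (norm (f 0))\<^sup>2 \<and>
    emeasure lebesgue {z. t \<le> wsq f z} < ennreal s" if "t > 0" for t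
    using neg that by (meson not_le)
  have ex: "\<exists>f. f \<in> fock_space \<and> gnorm2 f \<le> 1 \<and> c \<le> (norm (f 0))\<^sup>2 \<and>
    emeasure lebesgue {z. 1 / real (Suc n) \<le> wsq f z} < ennreal s" for n :: nat
    using small[of "1 / real (Suc n)", unfolded Bex_def] by simp
  have "\<exists>f. \<forall>n::nat. f n \<in> fock_space \<and> gnorm2 (f n) \<le> 1 \<and> c \<le> (norm (f n 0))\<^sup>2 \<and>
    emeasure lebesgue {z. 1 / real (Suc n) \<le> wsq (f n) z} < ennreal s"
    by (intro choice allI ex)
  then obtain f where fall: "\<forall>n::nat. f n \<in> fock_space \<and> gnorm2 (f n) \<le> 1 \<and> c \<le> (norm (f n 0))\<^sup>2 \<and>
    emeasure lebesgue {z. 1 / real (Suc n) \<le> wsq (f n) z} < ennreal s" ..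
  then have f: "f n \<in> fock_space" "gnorm2 (f n) \<le> 1" "c \<le> (norm (f n 0))\<^sup>2"
    "emeasure lebesgue {z. 1 / real (Suc n) \<le> wsq (f n) z} < ennreal s" for n
    by blast+
  obtain g r where g: "g \<in> fock_space" "gnorm2 g \<le> 1" "strict_mono (r :: nat \<Rightarrow> nat)" "\<And>z. (\<lambda>n. f (r n) z) \<longlonglongrightarrow> g z"
    using fock_bounded_subsequence[of f 1, OF f(1,2)] by blast
  have "c \<le> (norm (g 0))\<^sup>2"
  proof (rule LIMSEQ_le_const)
    show "(\<lambda>n. (norm (f (r n) 0))\<^sup>2) \<longlonglongrightarrow> (norm (g 0))\<^sup>2" by (intro tendsto_intros g)
    show "\<exists>N. \<forall>n\<ge>N. c \<le> (norm (f (r n) 0))\<^sup>2" using f(3) by blast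
  qed
  then have g0: "g \<noteq> 0" using c by auto
  define S where "S n = {z. 1 / real (Suc n) \<le> wsq (f n) z}" for n
  define Z where "Z = {z. g z \<noteq> 0}"
  have cg: "continuous_on UNIV g" by (rule continuous_on_fock[OF g(1)])
  have Z_sets: "Z \<in> sets lebesgue"
  proof -
    have "open Z" unfolding Z_def by (intro open_Collect_neq cg continuous_intros)
    then show ?thesis by auto
  qed
  have S_sets: "S n \<in> sets lebesgue" for n
  proof -
    have "closed (S n)" unfolding S_def
      by (intro closed_Collect_le continuous_intros continuous_on_fock[OF f(1)] continuous_gauss_weight)
    then show ?thesis by auto
  qed
  have nZ_sets: "- Z \<in> sets lebesgue"
    using sets.compl_sets[OF Z_sets] by (simp add: Compl_eq_Diff_UNIV)
  \<comment> \<open>The zero set of \<open>g\<close> is null: a part of positive measure in some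
    disc would be a localization domain on which \<open>g\<close> has no energy. The discs provide
    the finite measure required by the locale.\<close>
  have Z_inf: "emeasure lebesgue Z = \<infinity>"
  proof (rule ccontr)
    assume "emeasure lebesgue Z \<noteq> \<infinity>"
    then have "emeasure lebesgue Z < \<infinity>" by (simp add: less_top)
    have "emeasure lebesgue (- Z) > 0"
    proof (rule ccontr)
      assume "\<not> ?thesis"
      then have "emeasure lebesgue (Z \<union> - Z) = emeasure lebesgue Z"
        using Z_sets nZ_sets by (subst plus_emeasure[symmetric]) auto
      with \<open>emeasure lebesgue Z < \<infinity>\<close> show False by simp
    qed
    moreover have "emeasure lebesgue (- Z \<inter> cball 0 R) = 0" for R
    proof (rule ccontr)
      assume nz: "\<not> ?thesis"
      have "localization (- Z \<inter> cball 0 R)"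
      proof
        show "- Z \<inter> cball 0 R \<in> sets lebesgue" using nZ_sets by auto
        show "0 < emeasure lebesgue (- Z \<inter> cball 0 R)" using nz not_gr_zero by blast
        have "emeasure lebesgue (- Z \<inter> cball 0 R) \<le> emeasure lebesgue (cball (0::complex) R)"
          by (intro emeasure_mono) auto
        then show "emeasure lebesgue (- Z \<inter> cball 0 R) < \<infinity>"
          using emeasure_lebesgue_cball_finite[of 0 R] by (rule le_less_trans)
      qed
      then have "localization.energy (- Z \<inter> cball 0 R) g > 0"
        by (rule localization.energy_pos[OF _ g(1) g0])
      moreover have "restr (- Z \<inter> cball 0 R) g = 0" by (auto simp: restr_def fun_eq_iff Z_def indicator_def)
      ultimately show False
        using \<open>localization (- Z \<inter> cball 0 R)\<close> by (simp add: localization.energy_def gnorm2_def)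
    qed
    then have "emeasure lebesgue (\<Union>n. - Z \<inter> cball 0 (real n)) = 0"
      by (intro emeasure_UN_eq_0) (use nZ_sets in auto)
    moreover have "(\<Union>n. - Z \<inter> cball 0 (real n)) = - Z" by (auto intro: real_arch_simple)
    ultimately show False by simp
  qed
  have "emeasure lebesgue Z = (\<integral>\<^sup>+z. indicator Z z \<partial>lebesgue)" using Z_sets by simp
  also have "\<dots> \<le> (\<integral>\<^sup>+z. liminf (\<lambda>n. indicator (S (r n)) z) \<partial>lebesgue)"
  proof (rule nn_integral_mono)
    fix z
    show "indicator Z z \<le> liminf (\<lambda>n. indicator (S (r n)) z :: ennreal)"
    proof (cases "z \<in> Z")
      case True
      have "(\<lambda>n. wsq (f (r n)) z - 1 / real (Suc (r n))) \<longlonglongrightarrow> wsq g z - 0"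
        using LIMSEQ_subseq_LIMSEQ[OF LIMSEQ_Suc[OF lim_1_over_n] g(3)]
        by (intro tendsto_intros g(4)) (simp add: comp_def)
      moreover have "0 < wsq g z - 0" using True by (simp add: Z_def)
      ultimately have "\<forall>\<^sub>F n in sequentially. 0 < wsq (f (r n)) z - 1 / real (Suc (r n))"
        by (rule order_tendstoD)
      then have "\<forall>\<^sub>F n in sequentially. (1::ennreal) \<le> indicator (S (r n)) z"
        by eventually_elim (simp add: S_def)
      then have "1 \<le> liminf (\<lambda>n. indicator (S (r n)) z :: ennreal)" by (rule Liminf_bounded)
      then show ?thesis using True by simp
    qed simp
  qed
  also have "\<dots> \<le> liminf (\<lambda>n. \<integral>\<^sup>+z. indicator (S (r n)) z \<partial>lebesgue)"
    by (intro nn_integral_liminf borel_measurable_indicator S_sets)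
  also have "\<dots> = liminf (\<lambda>n. emeasure lebesgue (S (r n)))" using S_sets by simp
  also have "\<dots> \<le> limsup (\<lambda>n. emeasure lebesgue (S (r n)))" by (rule Liminf_le_Limsup) simp
  also have "\<dots> \<le> ennreal s"
    by (intro Limsup_bounded always_eventually allI less_imp_le f(4)[folded S_def])
  finally show False using Z_inf by (simp add: top_unique)
qed

text \<open>A Weyl operator takes \<open>p\<close> to 0 and only translates the superlevel sets, so
  one level \<open>t\<close> serves all points.\<close>

lemma fock_superlevel_large:
  assumes c: "c > 0"
  shows "\<exists>t>0. \<forall>f\<in>fock_space. \<forall>p. gnorm2 f \<le> 1 \<longrightarrow> c \<le> (norm (f p))\<^sup>2 * gauss_weight p \<longrightarrow>
    ennreal s \<le> emeasure lebesgue {z. t \<le> wsq f z}"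
proof -
  obtain t where t: "t > 0" "\<And>f. f \<in> fock_space \<Longrightarrow> gnorm2 f \<le> 1 \<Longrightarrow> c \<le> (norm (f 0))\<^sup>2 \<Longrightarrow>
    ennreal s \<le> emeasure lebesgue {z. t \<le> wsq f z}"
    using fock_superlevel_large_at_0[OF c, of s] by blast
  show ?thesis
  proof (intro exI[of _ t] conjI ballI allI impI t(1))
    fix f p assume f: "f \<in> fock_space" "gnorm2 f \<le> 1" "c \<le> (norm (f p))\<^sup>2 * gauss_weight p"
    have "(norm (weyl (- p) f 0))\<^sup>2 = (norm (f p))\<^sup>2 * gauss_weight p"
      using weyl_norm_weight[of "- p" f 0] by (simp add: gauss_weight_def)
    then have "ennreal s \<le> emeasure lebesgue {z. t \<le> wsq (weyl (- p) f) z}"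
      using f by (intro t(2)) (auto simp: gnorm2_weyl)
    also have "{z. t \<le> wsq (weyl (- p) f) z} = (+) (- p) ` {z. t \<le> wsq f z}"
      unfolding set_eq_iff mem_translation_iff by (simp add: weyl_norm_weight)
    also have "emeasure lebesgue \<dots> = emeasure lebesgue {z. t \<le> wsq f z}"
      by (rule emeasure_lebesgue_translation)
    finally show "ennreal s \<le> emeasure lebesgue {z. t \<le> wsq f z}" .
  qed
qed

lemma sum_gnorm2_restr_disjoint:
  assumes "finite Q" "\<And>p. p \<in> Q \<Longrightarrow> A p \<in> sets lebesgue" "f \<in> gauss_L2"
    and "\<And>p q. p \<in> Q \<Longrightarrow> q \<in> Q \<Longrightarrow> p \<noteq> q \<Longrightarrow> A p \<inter> A q = {}"
  shows "(\<Sum>p\<in>Q. gnorm2 (restr (A p) f)) = gnorm2 (restr (\<Union>p\<in>Q. A p) f)"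
  using assms
proof (induction Q rule: finite_induct)
  case empty
  show ?case by (simp add: restr_def gnorm2_def)
next
  case (insert p Q)
  have U: "(\<Union>q\<in>Q. A q) \<in> sets lebesgue" using insert by auto
  have d: "A p \<inter> (\<Union>q\<in>Q. A q) = {}" using insert.hyps insert.prems(3) by blast
  have "restr (\<Union>q\<in>insert p Q. A q) f = restr (A p) f + restr (\<Union>q\<in>Q. A q) f"
    using d by (auto simp: restr_def fun_eq_iff indicator_def)
  moreover have "gnorm2 (restr (A p) f + restr (\<Union>q\<in>Q. A q) f) = gnorm2 (restr (A p) f) + gnorm2 (restr (\<Union>q\<in>Q. A q) f)"
    using insert.prems U by (subst gnorm2_add) (auto simp: fock_inner_restr_disjoint[OF d])
  moreover have "(\<Sum>q\<in>insert p Q. gnorm2 (restr (A q) f)) = gnorm2 (restr (A p) f) + gnorm2 (restr (\<Union>q\<in>Q. A q) f)"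
    using insert by simp
  ultimately show ?case by (simp only:)
qed

text \<open>Points more than 4 apart have disjoint discs of radius 2. By the local evaluation bound
  each disc holds at least \<open>t / fock_const\<close> of the total mass, which is at most
  \<open>K\<close>.\<close>

lemma superlevel_packing:
  assumes \<phi>: "bessel_family K \<phi>" "\<And>k. k < K \<Longrightarrow> \<phi> k \<in> fock_space" and t: "t > 0"
    and Q: "finite Q" "\<And>p. p \<in> Q \<Longrightarrow> t \<le> fock_density K \<phi> p"
      "\<And>p q. p \<in> Q \<Longrightarrow> q \<in> Q \<Longrightarrow> p \<noteq> q \<Longrightarrow> dist p q > 4"
  shows "real (card Q) \<le> fock_const * real K / t"
proof -
  have L: "\<phi> k \<in> gauss_L2" if "k < K" for k using \<phi>(2)[OF that] by simp
  have disj: "cball p 2 \<inter> cball q 2 = {}" if "p \<in> Q" "q \<in> Q" "p \<noteq> q" for p q :: complex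
  proof (rule ccontr)
    assume "cball p 2 \<inter> cball q 2 \<noteq> {}"
    then obtain z where "z \<in> cball p 2 \<inter> cball q 2" by blast
    then have "dist p z \<le> 2" "dist q z \<le> 2" by auto
    then have "dist p q \<le> 4" using dist_triangle[of p q z] by (simp add: dist_commute)
    with Q(3)[OF that] show False by simp
  qed
  have "real (card Q) * t = (\<Sum>p\<in>Q. t)" by simp
  also have "\<dots> \<le> (\<Sum>p\<in>Q. fock_density K \<phi> p)" by (intro sum_mono Q(2))
  also have "\<dots> \<le> (\<Sum>p\<in>Q. \<Sum>k<K. fock_const * gnorm2 (restr (cball p 2) (\<phi> k)))"
    unfolding fock_density_def by (intro sum_mono fock_square_le_local \<phi>(2)) simp
  also have "\<dots> = fock_const * (\<Sum>k<K. \<Sum>p\<in>Q. gnorm2 (restr (cball p 2) (\<phi> k)))"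
    by (subst sum.swap) (simp add: sum_distrib_left)
  also have "\<dots> \<le> fock_const * (\<Sum>k<K. 1)"
  proof (intro mult_left_mono sum_mono)
    fix k assume "k \<in> {..<K}"
    then have k: "k < K" by simp
    have "(\<Sum>p\<in>Q. gnorm2 (restr (cball p 2) (\<phi> k))) = gnorm2 (restr (\<Union>p\<in>Q. cball p 2) (\<phi> k))"
      by (rule sum_gnorm2_restr_disjoint[OF Q(1) _ L[OF k] disj]) auto
    also have "\<dots> \<le> gnorm2 (\<phi> k)"
      using Q(1) by (intro gnorm2_restr_le L[OF k]) auto
    also have "\<dots> \<le> 1" by (rule bessel_gnorm2_le_1[OF \<phi>(1) k])
    finally show "(\<Sum>p\<in>Q. gnorm2 (restr (cball p 2) (\<phi> k))) \<le> 1" .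
  qed (use fock_const_pos in auto)
  finally show ?thesis using t by (simp add: pos_le_divide_eq)
qed

text \<open>The centres form a separated subset of largest cardinality: a point of the superlevel
  set left uncovered could be added to it.\<close>

lemma superlevel_covering:
  assumes \<phi>: "bessel_family K \<phi>" "\<And>k. k < K \<Longrightarrow> \<phi> k \<in> fock_space" and t: "t > 0"
    and N: "fock_const * real K / t \<le> real N"
  shows "\<exists>P. finite P \<and> card P \<le> N \<and> {z. t \<le> fock_density K \<phi> z} \<subseteq> (\<Union>p\<in>P. cball p 4)"
proof -
  define sep where "sep Q \<longleftrightarrow> finite Q \<and> Q \<subseteq> {z. t \<le> fock_density K \<phi> z} \<and> (\<forall>p\<in>Q. \<forall>q\<in>Q. p \<noteq> q \<longrightarrow> dist p q > 4)"
    for Q :: "complex set"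
  have bound: "card Q \<le> N" if "sep Q" for Q
  proof -
    have "real (card Q) \<le> fock_const * real K / t"
      using that by (intro superlevel_packing[OF \<phi> t]) (auto simp: sep_def)
    with N show ?thesis by linarith
  qed
  have "sep {}" by (simp add: sep_def)
  then have "\<exists>Q. sep Q \<and> (\<forall>Q'. sep Q' \<longrightarrow> card Q' \<le> card Q)"
    using bound by (intro ex_has_greatest_nat[where b = "Suc N"]) (auto simp: less_Suc_eq_le)
  then obtain Q where Q: "sep Q" "\<And>Q'. sep Q' \<Longrightarrow> card Q' \<le> card Q" by blast
  have "\<exists>q\<in>Q. z \<in> cball q 4" if z: "t \<le> fock_density K \<phi> z" for z
  proof (rule ccontr)
    assume "\<not> ?thesis"
    then have far: "\<forall>q\<in>Q. dist q z > 4" by (auto simp: not_le)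
    then have "z \<notin> Q" by auto
    have "sep (insert z Q)" using Q(1) far z by (auto simp: sep_def dist_commute)
    then have "card (insert z Q) \<le> card Q" by (rule Q(2))
    with \<open>z \<notin> Q\<close> Q(1) show False by (simp add: sep_def)
  qed
  then show ?thesis using Q(1) bound[OF Q(1)] by (intro exI[of _ Q]) (auto simp: sep_def)
qed

text \<open>Bounding the number of discs instead of fixing it makes the notion monotone in
  \<open>N\<close>, so merging discs simply lowers the count.\<close>

definition clustered :: "nat \<Rightarrow> real \<Rightarrow> complex set \<Rightarrow> bool" where
  "clustered N r \<Omega> \<longleftrightarrow> (\<exists>P. finite P \<and> card P \<le> N \<and> \<Omega> \<subseteq> (\<Union>p\<in>P. cball p r))"

subsection \<open>Existence of a maximiser\<close>

text \<open>The mean of the density over \<open>\<Omega>\<close> is at least \<open>m / s\<close>,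
  so somewhere it reaches half of that and some \<open>\<phi> k\<close> is large there. The
  superlevel set \<open>S\<close> then has room for measure \<open>s\<close>, and the part of
  \<open>\<Omega>\<close> below level \<open>t\<close> can be exchanged for points of
  \<open>S\<close>. Both \<open>t\<close> and \<open>N\<close> depend on \<open>s\<close>,
  \<open>m\<close> and \<open>K\<close> only.\<close>

lemma eigenvalue_sum_clustered:
  assumes s: "s > 0" and m: "m > 0"
  shows "\<exists>N. \<forall>\<Omega>\<in>admissible s. m \<le> eigenvalue_sum K \<Omega> \<longrightarrow>
     (\<exists>\<Omega>'\<in>admissible s. clustered N 4 \<Omega>' \<and> eigenvalue_sum K \<Omega> \<le> eigenvalue_sum K \<Omega>')"
proof -
  \<comment> \<open>The share of one function in the density \<open>m / (2 * s)\<close>. Dividing by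
    \<open>K + 1\<close> instead of \<open>K\<close> makes the contradiction below strict.\<close>
  define c where "c = m / (2 * s * (real K + 1))"
  have c: "c > 0" using s m by (simp add: c_def)
  obtain t where t: "t > 0" and level: "\<And>f p. f \<in> fock_space \<Longrightarrow> gnorm2 f \<le> 1 \<Longrightarrow> c \<le> (norm (f p))\<^sup>2 * gauss_weight p \<Longrightarrow>
    ennreal s \<le> emeasure lebesgue {z. t \<le> wsq f z}"
    using fock_superlevel_large[OF c, of s] by blast
  obtain N :: nat where N: "fock_const * real K / t \<le> real N" using real_arch_simple by blast
  show ?thesis
  proof (intro exI[of _ N] ballI impI)
    fix \<Omega> assume \<Omega>: "\<Omega> \<in> admissible s" and ge: "m \<le> eigenvalue_sum K \<Omega>"
    have \<Omega>s: "\<Omega> \<in> sets lebesgue" "emeasure lebesgue \<Omega> = ennreal s" using \<Omega> by (auto simp: admissible_def)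
    interpret localization \<Omega> by (rule admissible_localization[OF s \<Omega>])
    obtain \<phi> where \<phi>: "orthonormal_family K \<phi>" "\<And>k. \<phi> k \<in> fock_space"
      "(\<Sum>k<K. gnorm2 (restr \<Omega> (\<phi> k))) = eigenvalue_sum K \<Omega>"
      using eigenvalue_sum_primal_attained[of K] by blast
    have bessel: "bessel_family K \<phi>" by (rule orthonormal_imp_bessel[OF \<phi>(1)])
    have L: "\<phi> k \<in> gauss_L2" for k using \<phi>(2)[of k] by simp
    define u where "u = fock_density K \<phi>"
    have ui: "integrable lebesgue u" unfolding u_def by (intro integrable_fock_density L)
    have energy: "(LINT z:A|lebesgue. u z) = (\<Sum>k<K. gnorm2 (restr A (\<phi> k)))" if "A \<in> sets lebesgue" for A
      unfolding u_def using sum_gnorm2_restr[OF L that] by simp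
    have "\<exists>p\<in>\<Omega>. m / (2 * s) \<le> u p"
    proof (rule ccontr)
      assume "\<not> ?thesis"
      then have less: "u p \<le> m / (2 * s)" if "p \<in> \<Omega>" for p using that by force
      have "(LINT z:\<Omega>|lebesgue. u z) \<le> (LINT z:\<Omega>|lebesgue. m / (2 * s))"
      proof (rule set_integral_mono[OF _ _ less])
        show "set_integrable lebesgue \<Omega> u"
          unfolding set_integrable_def by (rule integrable_mult_indicator[OF \<Omega>s(1) ui])
        show "set_integrable lebesgue \<Omega> (\<lambda>_. m / (2 * s))"
          unfolding set_integrable_def by (intro integrable_scaleR_left integrable_real_indicator \<Omega>_sets \<Omega>_finite)
      qed
      also have "\<dots> = m / (2 * s) * measure lebesgue \<Omega>"
        using \<Omega>s by (simp add: set_lebesgue_integral_def mult.commute)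
      also have "measure lebesgue \<Omega> = s" using \<Omega>s(2) s by (simp add: measure_def)
      finally have "eigenvalue_sum K \<Omega> \<le> m / 2" using energy[OF \<Omega>s(1)] \<phi>(3) s by simp
      with ge m show False by simp
    qed
    then obtain p where p: "m / (2 * s) \<le> u p" by blast
    have "\<exists>k<K. c \<le> (norm (\<phi> k p))\<^sup>2 * gauss_weight p"
    proof (rule ccontr)
      assume "\<not> ?thesis"
      then have "u p \<le> (\<Sum>k<K. c)" unfolding u_def fock_density_def by (intro sum_mono) (auto simp: not_le)
      also have "\<dots> = real K * c" by simp
      also have "\<dots> < (real K + 1) * c" using c by (simp add: distrib_right)
      also have "\<dots> = m / (2 * s)"
      proof -
        have "x * (m / (2 * s * x)) = m / (2 * s)" if "x > 0" for x :: real using that by simp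
        from this[of "real K + 1"] show ?thesis by (simp add: c_def)
      qed
      finally show False using p by simp
    qed
    then obtain k where k: "k < K" "c \<le> (norm (\<phi> k p))\<^sup>2 * gauss_weight p" by blast
    define S where "S = {z. t \<le> u z}"
    have S_sets: "S \<in> sets lebesgue"
    proof -
      have "closed S" unfolding S_def u_def fock_density_def
        by (intro closed_Collect_le continuous_intros continuous_on_fock[OF \<phi>(2)] continuous_gauss_weight)
      then show ?thesis by auto
    qed
    have "ennreal s \<le> emeasure lebesgue {z. t \<le> wsq (\<phi> k) z}"
      by (rule level[OF \<phi>(2) bessel_gnorm2_le_1[OF bessel k(1)] k(2)])
    also have "\<dots> \<le> emeasure lebesgue S"
    proof (rule emeasure_mono[OF _ S_sets])
      have "wsq (\<phi> k) z \<le> u z" for z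
        unfolding u_def fock_density_def using k(1) by (intro member_le_sum) auto
      then show "{z. t \<le> wsq (\<phi> k) z} \<subseteq> S" by (auto simp: S_def intro: order_trans)
    qed
    finally have Ss: "ennreal s \<le> emeasure lebesgue S" .
    \<comment> \<open>Keeping \<open>\<Omega> \<inter> S\<close> ensures that only points with
      \<open>u < t\<close> are given up and only points with \<open>t \<le> u\<close> are gained, as
      \<open>admissible_integral_exchange\<close> requires.\<close>
    have sub: "\<exists>\<Omega>'\<in>admissible s. \<Omega> \<inter> S \<subseteq> \<Omega>' \<and> \<Omega>' \<subseteq> S"
    proof -
      define a where "a = measure lebesgue (\<Omega> - S)"
      define b where "b = measure lebesgue (\<Omega> \<inter> S)"
      have fin: "\<Omega> \<in> lmeasurable" using \<Omega>s by (intro fmeasurableI) auto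
      have fm: "\<Omega> - S \<in> lmeasurable" "\<Omega> \<inter> S \<in> lmeasurable"
        using fin S_sets by (auto intro: fmeasurable_Diff fmeasurable_Int_fmeasurable)
      have e: "emeasure lebesgue (\<Omega> - S) = ennreal a" "emeasure lebesgue (\<Omega> \<inter> S) = ennreal b"
        by (simp_all only: a_def b_def emeasure_eq_measure2[OF fm(1)] emeasure_eq_measure2[OF fm(2)])
      have "ennreal s = emeasure lebesgue ((\<Omega> \<inter> S) \<union> (\<Omega> - S))" using \<Omega>s(2) by (simp add: Int_Diff_Un)
      also have "\<dots> = emeasure lebesgue (\<Omega> \<inter> S) + emeasure lebesgue (\<Omega> - S)"
        using \<Omega>s S_sets by (intro plus_emeasure[symmetric]) auto
      finally have sab: "ennreal s = ennreal b + ennreal a" by (simp only: e)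
      have "emeasure lebesgue S = emeasure lebesgue ((\<Omega> \<inter> S) \<union> (S - \<Omega>))" by (intro arg_cong[where f="emeasure lebesgue"]) auto
      also have "\<dots> = emeasure lebesgue (\<Omega> \<inter> S) + emeasure lebesgue (S - \<Omega>)"
        using \<Omega>s S_sets by (intro plus_emeasure[symmetric]) auto
      finally have "ennreal b + ennreal a \<le> ennreal b + emeasure lebesgue (S - \<Omega>)" using Ss by (simp only: e sab)
      then have "ennreal a \<le> emeasure lebesgue (S - \<Omega>)" by (simp add: ennreal_add_left_cancel_le)
      then obtain C where C: "C \<in> sets lebesgue" "C \<subseteq> S - \<Omega>" "emeasure lebesgue C = ennreal a"
        using exists_subset_of_measure[of "S - \<Omega>" a] \<Omega>s S_sets by (auto simp: a_def)
      have "emeasure lebesgue ((\<Omega> \<inter> S) \<union> C) = emeasure lebesgue (\<Omega> \<inter> S) + emeasure lebesgue C"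
        using \<Omega>s S_sets C by (intro plus_emeasure[symmetric]) auto
      then have "(\<Omega> \<inter> S) \<union> C \<in> admissible s"
        using \<Omega>s S_sets C e sab by (simp add: admissible_def)
      then show ?thesis using C by blast
    qed
    then obtain \<Omega>' where \<Omega>': "\<Omega>' \<in> admissible s" "\<Omega> \<inter> S \<subseteq> \<Omega>'" "\<Omega>' \<subseteq> S" by blast
    have "eigenvalue_sum K \<Omega> = (LINT z:\<Omega>|lebesgue. u z)" using energy[OF \<Omega>s(1)] \<phi>(3) by simp
    also have "\<dots> \<le> (LINT z:\<Omega>'|lebesgue. u z)"
      by (rule admissible_integral_exchange[OF s \<Omega> \<Omega>'(1) ui, of t]) (use \<Omega>' in \<open>auto simp: S_def\<close>)
    also have "\<dots> = (\<Sum>k<K. gnorm2 (restr \<Omega>' (\<phi> k)))"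
      using \<Omega>'(1) by (intro energy) (simp add: admissible_def)
    also have "\<dots> \<le> eigenvalue_sum K \<Omega>'"
      by (rule localization.eigenvalue_sum_primal[OF admissible_localization[OF s \<Omega>'(1)] bessel \<phi>(2)])
    finally have le: "eigenvalue_sum K \<Omega> \<le> eigenvalue_sum K \<Omega>'" .
    have "clustered N 4 \<Omega>'"
      unfolding clustered_def using superlevel_covering[OF bessel \<phi>(2) t N] \<Omega>'(3)
      unfolding S_def u_def by (meson order_trans)
    with \<Omega>'(1) le show "\<exists>\<Omega>'\<in>admissible s. clustered N 4 \<Omega>' \<and> eigenvalue_sum K \<Omega> \<le> eigenvalue_sum K \<Omega>'"
      by blast
  qed
qed

text \<open>Induction on the number of balls: either two centres are close and their balls merge into a larger one,
  or one ball is far from all the others and is moved next to the rightmost of them.\<close>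

lemma eigenvalue_sum_maximiser_clustered:
  assumes s: "s > 0" and r: "r > 0"
  shows "\<exists>\<Omega>\<in>admissible s. \<forall>\<Omega>'\<in>admissible s. clustered (Suc N) r \<Omega>' \<longrightarrow> eigenvalue_sum K \<Omega>' \<le> eigenvalue_sum K \<Omega>"
  using r
proof (induction N arbitrary: r)
  case 0
  obtain \<Omega> where \<Omega>: "\<Omega> \<in> admissible s" "\<And>\<Omega>'. \<Omega>' \<in> admissible s \<Longrightarrow> \<Omega>' \<subseteq> cball 0 r \<Longrightarrow> eigenvalue_sum K \<Omega>' \<le> eigenvalue_sum K \<Omega>"
    using eigenvalue_sum_maximiser_in_ball[OF s, of r K] by blast
  have "eigenvalue_sum K \<Omega>' \<le> eigenvalue_sum K \<Omega>" if \<Omega>': "\<Omega>' \<in> admissible s" "clustered (Suc 0) r \<Omega>'" for \<Omega>'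
  proof -
    obtain P where P: "finite P" "card P \<le> 1" "\<Omega>' \<subseteq> (\<Union>p\<in>P. cball p r)"
      using \<Omega>'(2) by (auto simp: clustered_def)
    have "\<Omega>' \<noteq> {}" using \<Omega>'(1) s by (auto simp: admissible_def)
    then have "P \<noteq> {}" using P(3) by auto
    then have "card P = 1" using P(1,2) by (metis card_gt_0_iff le_antisym Suc_leI One_nat_def)
    then obtain p where "P = {p}" by (auto simp: card_1_singleton_iff)
    then have "\<Omega>' \<subseteq> cball p r" using P(3) by simp
    then have "(+) (- p) ` \<Omega>' \<subseteq> cball 0 r" by (auto simp: dist_norm norm_minus_commute)
    then have "eigenvalue_sum K ((+) (- p) ` \<Omega>') \<le> eigenvalue_sum K \<Omega>"
      by (intro \<Omega>(2) eigenvalue_sum_translation(1)[OF s \<Omega>'(1)])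
    then show ?thesis using eigenvalue_sum_translation(2)[OF s \<Omega>'(1), of K "- p"] by linarith
  qed
  then show ?case using \<Omega>(1) by blast
next
  case (Suc N)
  show ?case
  proof (rule ccontr)
    assume neg: "\<not> ?case"
    have better: "\<exists>\<Omega>'\<in>admissible s. clustered (Suc (Suc N)) r \<Omega>' \<and> eigenvalue_sum K \<Omega> < eigenvalue_sum K \<Omega>'"
      if "\<Omega> \<in> admissible s" for \<Omega>
      using neg that by (meson not_le)
    \<comment> \<open>A disc of radius \<open>r\<close> whose centre is moved to distance
      \<open>4 * r\<close> from another centre fits into the disc of radius \<open>5 * r\<close>
      around the latter.\<close>
    obtain \<Omega>5 where \<Omega>5: "\<Omega>5 \<in> admissible s" "\<And>\<Omega>'. \<Omega>' \<in> admissible s \<Longrightarrow> clustered (Suc N) (5 * r) \<Omega>' \<Longrightarrow> eigenvalue_sum K \<Omega>' \<le> eigenvalue_sum K \<Omega>5"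
      using Suc.IH[of "5 * r"] Suc.prems by auto
    obtain \<Omega>1 where \<Omega>1: "\<Omega>1 \<in> admissible s" "eigenvalue_sum K \<Omega>5 < eigenvalue_sum K \<Omega>1"
      using better[OF \<Omega>5(1)] by blast
    \<comment> \<open>The gap over the best set with one disc fewer. It is fixed before
      \<open>D\<close>, so one move at this cost suffices for the contradiction.\<close>
    define \<epsilon> where "\<epsilon> = eigenvalue_sum K \<Omega>1 - eigenvalue_sum K \<Omega>5"
    have \<epsilon>: "\<epsilon> > 0" using \<Omega>1 by (simp add: \<epsilon>_def)
    obtain D where D: "\<And>\<Omega> p q. \<Omega> \<in> admissible s \<Longrightarrow> (\<Omega> - cball p r) \<inter> cball p D = {} \<Longrightarrow>
       (+) q ` (\<Omega> \<inter> cball p r) \<inter> (\<Omega> - cball p r) = {} \<Longrightarrow>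
       (+) q ` (\<Omega> \<inter> cball p r) \<union> (\<Omega> - cball p r) \<in> admissible s \<and>
       eigenvalue_sum K \<Omega> - \<epsilon> \<le> eigenvalue_sum K ((+) q ` (\<Omega> \<inter> cball p r) \<union> (\<Omega> - cball p r))"
      using eigenvalue_sum_move[OF s \<epsilon>, of r K] by metis
    \<comment> \<open>\<open>D\<close> may be negative, hence the maximum. The added
      \<open>r\<close> passes from distances between centres to distances from points of the other
      discs.\<close>
    define D' where "D' = max 0 D + r"
    have D': "D' > 0" using Suc.prems by (simp add: D'_def)
    obtain \<Omega>6 where \<Omega>6: "\<Omega>6 \<in> admissible s" "\<And>\<Omega>'. \<Omega>' \<in> admissible s \<Longrightarrow> clustered (Suc N) (r + D') \<Omega>' \<Longrightarrow> eigenvalue_sum K \<Omega>' \<le> eigenvalue_sum K \<Omega>6"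
      using Suc.IH[of "r + D'"] Suc.prems D' by auto
    \<comment> \<open>The better of \<open>\<Omega>6\<close> and \<open>\<Omega>1\<close>: a set
      that beats both can neither have two centres close together nor fall to the level of
      \<open>\<Omega>5\<close> by a single move.\<close>
    obtain \<Omega>7 where \<Omega>7: "\<Omega>7 \<in> admissible s" "eigenvalue_sum K \<Omega>6 \<le> eigenvalue_sum K \<Omega>7" "eigenvalue_sum K \<Omega>1 \<le> eigenvalue_sum K \<Omega>7"
      using \<Omega>6(1) \<Omega>1(1) by (metis linear order_refl)
    obtain \<Omega> where \<Omega>: "\<Omega> \<in> admissible s" "clustered (Suc (Suc N)) r \<Omega>" "eigenvalue_sum K \<Omega>7 < eigenvalue_sum K \<Omega>"
      using better[OF \<Omega>7(1)] by blast
    have not_merged: "\<not> clustered (Suc N) (r + D') \<Omega>" using \<Omega>6(2)[OF \<Omega>(1)] \<Omega>(3) \<Omega>7(2) by linarith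
    obtain P where P: "finite P" "card P \<le> Suc (Suc N)" "\<Omega> \<subseteq> (\<Union>p\<in>P. cball p r)"
      using \<Omega>(2) by (auto simp: clustered_def)
    have grow: "cball x r \<subseteq> cball x (r + D')" for x :: complex using D' by (intro subset_cball) simp
    have "card P = Suc (Suc N)"
    proof (rule ccontr)
      assume "card P \<noteq> Suc (Suc N)"
      moreover have "\<Omega> \<subseteq> (\<Union>p\<in>P. cball p (r + D'))" using P(3) grow by blast
      ultimately have "clustered (Suc N) (r + D') \<Omega>" using P unfolding clustered_def by (intro exI[of _ P]) auto
      with not_merged show False by contradiction
    qed
    then obtain p Q where pQ: "P = insert p Q" "p \<notin> Q" "card Q = Suc N" by (metis card_Suc_eq)
    have Q: "finite Q" "Q \<noteq> {}" using pQ P(1) by auto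
    have far: "dist p q > D'" if q: "q \<in> Q" for q
    proof (rule ccontr)
      assume "\<not> dist p q > D'"
      then have pq: "dist q p \<le> D'" by (simp add: dist_commute)
      have "cball p r \<subseteq> cball q (r + D')"
      proof
        fix z assume "z \<in> cball p r"
        then show "z \<in> cball q (r + D')" using pq dist_triangle[of q z p] by simp
      qed
      then have "\<Omega> \<subseteq> (\<Union>x\<in>Q. cball x (r + D'))" using P(3) q grow unfolding pQ(1) by blast
      then have "clustered (Suc N) (r + D') \<Omega>" using Q(1) pQ(3) unfolding clustered_def by (intro exI[of _ Q]) auto
      with not_merged show False by contradiction
    qed
    have rest: "\<exists>q\<in>Q. z \<in> cball q r" if "z \<in> \<Omega> - cball p r" for z
      using that P(3) unfolding pQ(1) by blast
    have apart: "(\<Omega> - cball p r) \<inter> cball p D = {}"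
    proof (rule ccontr)
      assume "\<not> ?thesis"
      then obtain z where "z \<in> (\<Omega> - cball p r) \<inter> cball p D" by blast
      then have z: "z \<in> \<Omega> - cball p r" "dist p z \<le> D" by auto
      obtain q where q: "q \<in> Q" "dist q z \<le> r" using rest[OF z(1)] by auto
      have "dist p q \<le> dist p z + dist q z" by (metis dist_commute dist_triangle)
      then have "dist p q \<le> D'" using z(2) q(2) by (simp add: D'_def)
      with far[OF q(1)] show False by simp
    qed
    have "\<exists>m\<in>Q. \<forall>q\<in>Q. Re q \<le> Re m"
    proof -
      have "Max (Re ` Q) \<in> Re ` Q" using Q by (intro Max_in) auto
      then obtain m where "m \<in> Q" "Re m = Max (Re ` Q)" by (metis imageE)
      then show ?thesis using Q by (metis Max_ge finite_imageI imageI)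
    qed
    then obtain m where m: "m \<in> Q" "\<And>q. q \<in> Q \<Longrightarrow> Re q \<le> Re m" by blast
    \<comment> \<open>The disc around \<open>p\<close> is recentred \<open>4 * r\<close> to the
      right of the rightmost remaining centre; comparing real parts shows that it misses all the
      remaining discs.\<close>
    define b where "b = m + of_real (4 * r) - p"
    have moved: "dist (m + of_real (4 * r)) z \<le> r" if "z \<in> (+) b ` (\<Omega> \<inter> cball p r)" for z
    proof -
      obtain y where y: "dist p y \<le> r" "z = b + y" using \<open>z \<in> _\<close> by auto
      have "m + of_real (4 * r) - z = p - y" by (simp add: y(2) b_def)
      with y(1) show ?thesis by (simp add: dist_norm)
    qed
    have disj: "(+) b ` (\<Omega> \<inter> cball p r) \<inter> (\<Omega> - cball p r) = {}"
    proof (rule ccontr)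
      assume "\<not> ?thesis"
      then obtain z where z: "z \<in> (+) b ` (\<Omega> \<inter> cball p r)" "z \<in> \<Omega> - cball p r" by blast
      obtain q where q: "q \<in> Q" "dist q z \<le> r" using rest[OF z(2)] by auto
      have "Re (m + of_real (4 * r)) - Re z \<le> r"
        using moved[OF z(1)] abs_Re_le_cmod[of "m + of_real (4 * r) - z"] by (simp add: dist_norm)
      moreover have "Re z - Re q \<le> r"
        using q(2) abs_Re_le_cmod[of "q - z"] by (simp add: dist_norm)
      ultimately show False using m(2)[OF q(1)] Suc.prems by simp
    qed
    define \<Omega>' where "\<Omega>' = (+) b ` (\<Omega> \<inter> cball p r) \<union> (\<Omega> - cball p r)"
    have \<Omega>': "\<Omega>' \<in> admissible s" "eigenvalue_sum K \<Omega> - \<epsilon> \<le> eigenvalue_sum K \<Omega>'"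
      unfolding \<Omega>'_def using D[OF \<Omega>(1) apart disj] by blast+
    have "\<Omega>' \<subseteq> (\<Union>q\<in>Q. cball q (5 * r))"
    proof
      fix z assume "z \<in> \<Omega>'"
      then consider "z \<in> (+) b ` (\<Omega> \<inter> cball p r)" | "z \<in> \<Omega> - cball p r" unfolding \<Omega>'_def by blast
      then show "z \<in> (\<Union>q\<in>Q. cball q (5 * r))"
      proof cases
        case 1
        have "dist m (m + of_real (4 * r)) = 4 * r" using Suc.prems by (simp add: dist_norm)
        then have "dist m z \<le> 5 * r" using moved[OF 1] dist_triangle[of m z "m + of_real (4 * r)"] by linarith
        then show ?thesis using m(1) by auto
      next
        case 2
        then obtain q where "q \<in> Q" "dist q z \<le> r" using rest by auto
        then show ?thesis using Suc.prems by (intro UN_I[of q]) auto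
      qed
    qed
    then have "clustered (Suc N) (5 * r) \<Omega>'" using Q(1) pQ(3) unfolding clustered_def by (intro exI[of _ Q]) auto
    then have "eigenvalue_sum K \<Omega>' \<le> eigenvalue_sum K \<Omega>5" by (rule \<Omega>5(2)[OF \<Omega>'(1)])
    \<comment> \<open>As \<open>\<Omega>\<close> strictly beats \<open>\<Omega>1\<close>, the moved
      set, after losing at most \<open>\<epsilon>\<close>, still strictly beats
      \<open>\<Omega>5\<close>.\<close>
    with \<Omega>'(2) \<Omega>(3) \<Omega>7(3) show False by (simp add: \<epsilon>_def)
  qed
qed

text \<open>The threshold for clustering is the value of an arbitrary admissible set, positive
  because \<open>K \<ge> 1\<close>. Sets below it are dominated by that set, sets above it by
  clustered ones with a common number of discs.\<close>

lemma eigenvalue_sum_maximiser: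
  assumes s: "s > 0" and K: "K \<ge> 1"
  shows "\<exists>\<Omega>\<in>admissible s. \<forall>\<Omega>'\<in>admissible s. eigenvalue_sum K \<Omega>' \<le> eigenvalue_sum K \<Omega>"
proof -
  obtain \<Omega>0 where \<Omega>0: "\<Omega>0 \<in> admissible s" using admissible_nonempty[OF s] by blast
  have m: "eigenvalue_sum K \<Omega>0 > 0"
    by (rule localization.eigenvalue_sum_pos[OF admissible_localization[OF s \<Omega>0] K])
  obtain N where N: "\<And>\<Omega>. \<Omega> \<in> admissible s \<Longrightarrow> eigenvalue_sum K \<Omega>0 \<le> eigenvalue_sum K \<Omega> \<Longrightarrow>
      \<exists>\<Omega>'\<in>admissible s. clustered N 4 \<Omega>' \<and> eigenvalue_sum K \<Omega> \<le> eigenvalue_sum K \<Omega>'"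
    using eigenvalue_sum_clustered[OF s m, of K] by blast
  obtain \<Omega>m where \<Omega>m: "\<Omega>m \<in> admissible s"
    "\<And>\<Omega>'. \<Omega>' \<in> admissible s \<Longrightarrow> clustered (Suc N) 4 \<Omega>' \<Longrightarrow> eigenvalue_sum K \<Omega>' \<le> eigenvalue_sum K \<Omega>m"
    using eigenvalue_sum_maximiser_clustered[OF s, of 4 N K] by auto
  have weaken: "clustered N 4 \<Omega>' \<Longrightarrow> clustered (Suc N) 4 \<Omega>'" for \<Omega>'
    unfolding clustered_def by (meson le_Suc_eq)
  have le: "eigenvalue_sum K \<Omega> \<le> eigenvalue_sum K \<Omega>m" if "\<Omega> \<in> admissible s" "eigenvalue_sum K \<Omega>0 \<le> eigenvalue_sum K \<Omega>" for \<Omega>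
    using N[OF that] \<Omega>m(2) weaken by (meson order_trans)
  have "eigenvalue_sum K \<Omega> \<le> eigenvalue_sum K \<Omega>m" if "\<Omega> \<in> admissible s" for \<Omega>
    using le[OF that] le[OF \<Omega>0] by linarith
  with \<Omega>m(1) show ?thesis by blast
qed

theorem theorem1p1:
  fixes s :: real and K :: nat
  assumes "s > 0" and "K \<ge> 1"
  defines "\<A> \<equiv> {\<Omega> :: complex set. \<Omega> \<in> sets lebesgue \<and> emeasure lebesgue \<Omega> = ennreal s}"
  shows "bdd_above ((\<lambda>\<Omega>. \<Sum>k=1..K. toeplitz_eigenvalue k \<Omega>) ` \<A>) \<and>
    (\<exists>\<Omega>\<in>\<A>. (\<Sum>k=1..K. toeplitz_eigenvalue k \<Omega>) =
       (SUP \<Omega>'\<in>\<A>. \<Sum>k=1..K. toeplitz_eigenvalue k \<Omega>'))"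
proof -
  have \<A>: "\<A> = admissible s" by (simp add: \<A>_def admissible_def)
  obtain \<Omega> where \<Omega>: "\<Omega> \<in> \<A>" "\<And>\<Omega>'. \<Omega>' \<in> \<A> \<Longrightarrow> eigenvalue_sum K \<Omega>' \<le> eigenvalue_sum K \<Omega>"
    using eigenvalue_sum_maximiser[OF assms(1,2)] unfolding \<A> by blast
  \<comment> \<open>The value at the maximiser is the bound; without boundedness the real-valued
    \<open>SUP\<close> would have no meaning.\<close>
  have bdd: "bdd_above (eigenvalue_sum K ` \<A>)" using \<Omega>(2) by (rule bdd_aboveI2)
  have "eigenvalue_sum K \<Omega> = (SUP \<Omega>'\<in>\<A>. eigenvalue_sum K \<Omega>')"
    using \<Omega> by (intro antisym cSUP_upper bdd cSUP_least) auto
  with bdd \<Omega>(1) show ?thesis unfolding eigenvalue_sum_def[abs_def] by blast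
qed

end
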